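(* There exists $s_0$ such that for every even integer $s \geqslant s_0$, \[ \dim_{\mathbb{Q}}\operatorname{Span}_{\mathbb{Q}}\left(1,\zeta(3),\zeta(5),\ldots,\zeta(s-1)\right) \geqslant \frac{1.009}{1+\log 2}\cdot \log s. \]
   Context: $\zeta$ denotes the Riemann zeta function; the span is the $\mathbb{Q}$-linear span inside $\mathbb{R}$ of $1$ and the values $\zeta(i)$ for odd $i$ with $3\leqslant i\leqslant s-1$. *)

theory Defs
  imports "HOL-Analysis.Analysis"
begin

text \<open>
  The Riemann zeta function at an integer \<open>k \<ge> 2\<close>, given by its Dirichlet series
  \<open>\<Sum>n\<ge>1. 1 / n ^ k\<close> (shifted so that the summation starts at \<open>0\<close>). For \<open>k < 2\<close> the series
  diverges and the value is meaningless.
\<close>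
definition zeta :: "nat \<Rightarrow> real" where
  "zeta k = (\<Sum>n. 1 / real (Suc n) ^ k)"

lemma summable_zeta:
  assumes "k \<ge> 2"
  shows "summable (\<lambda>n. 1 / real (Suc n) ^ k)"
proof -
  have "summable (\<lambda>n. inverse (real n ^ k))"
    using inverse_power_summable[OF assms, where ?'a = real] by simp
  then have "summable (\<lambda>n. inverse (real (Suc n) ^ k))"
    by (subst summable_Suc_iff)
  then show ?thesis
    by (simp only: inverse_eq_divide)
qed

global_interpretation rat_vec: vector_space "\<lambda>(q::rat) (x::real). of_rat q * x"
  by unfold_locales (simp_all add: algebra_simps of_rat_add of_rat_mult)

end

theory Submission
  imports Defs "HOL-Complex_Analysis.Complex_Analysis" "HOL-Number_Theory.Prime_Powers"
    "HOL-Real_Asymp.Real_Asymp"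
begin

text \<open>
  The construction is that of Ball and Rivoal, with an arithmetic saving in the style of Zudilin.
  Write \<open>s = 2 * q + 2\<close> and \<open>n = 20 * \<nu>\<close>. The rational function
  \<open>R(t) = (\<Prod>c\<le>r*n. (t - c) * (t + n + c)) / n!^(2*r) * (n! / (\<Prod>j\<le>n. t + j))^(q+1) *
  ((18*\<nu>)! / (\<Prod>j\<in>{\<nu>..19*\<nu>}. t + j))^q\<close> is antisymmetric under \<open>t \<mapsto> - n - t\<close>, so
  \<open>\<Sum>t\<ge>1. R(t)\<close> is a rational linear combination of \<open>1\<close> and the odd zeta values up to \<open>s - 1\<close>.
  The usual common denominator \<open>lcm(1,\<dots>,n)^(2*q+1)\<close> of the coefficients is too large by \<open>p^q\<close> for every
  prime \<open>p\<close> that has a multiple \<open>m * p\<close> in \<open>(19*\<nu>, 20*\<nu>]\<close> with \<open>m \<le> 10\<close>. By the prime number theorem this improves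
  the exponential rate by \<open>q * (\<Sum>m\<le>10. 1/m)\<close>. The factor \<open>1.009\<close> comes out of a Nesterenko-type
  criterion applied with \<open>r\<close> close to \<open>q powr 0.999\<close>: the linear forms decay at rate about \<open>38 * q * ln r\<close>, and the
  sum of the rates is about \<open>(40 - (\<Sum>m\<le>10. 1/m) + 38 * ln 2) * q\<close>.
\<close>

section \<open>The prime number theorem\<close>

text \<open>With two full blocks the forms would decay at rate \<open>40 * q * ln r\<close> against
  a total of \<open>40 * q * (1 + ln 2)\<close>, which is the classical quotient
  \<open>1 / (1 + ln 2)\<close>. Cutting one block to \<open>[\<nu>, 19 \<nu>]\<close> lowers 40 to
  38 in both places where it stands for the degree, so it pays only if the denominators save more
  than 2. They save \<open>(\<Sum>m\<le>10. 1/m)\<close>, about 2.93, and the quotient becomes about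
  \<open>1.0146 / (1 + ln 2)\<close>; the margin above 1.009 absorbs all roundings.

  The saving is measured by the primes in \<open>(19 \<nu> / m, 20 \<nu> / m]\<close>. On such short
  intervals bounds of the right order alone give nothing, hence the prime number theorem.

  The criterion admits different rates for the upper and the lower bound of the forms, at the price
  of their difference. So no exact asymptotics of the series is needed: one term bounds it from
  below, factorwise estimates bound it from above, and the rates differ by O(r ln r + q / r). This
  is o(q) if r is a power of q with exponent slightly below 1, while \<open>ln r\<close> stays close
  to \<open>ln q\<close>.\<close>

lemma holomorphic_series_comparison:
  fixes f :: "nat \<Rightarrow> complex \<Rightarrow> complex"
  assumes S: "open S" and hol: "\<And>n. f n holomorphic_on S"
    and bd: "\<And>x. x \<in> S \<Longrightarrow> \<exists>d>0. \<exists>M::nat \<Rightarrow> real. summable M \<and>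
              (\<forall>n. \<forall>y\<in>ball x d \<inter> S. norm (f n y) \<le> M n)"
  shows "(\<lambda>s. \<Sum>n. f n s) holomorphic_on S" "\<And>s. s \<in> S \<Longrightarrow> summable (\<lambda>n. f n s)"
    "\<And>s. s \<in> S \<Longrightarrow> (\<lambda>n. deriv (f n) s) sums deriv (\<lambda>s. \<Sum>n. f n s) s"
proof -
  have "\<exists>g g'. \<forall>x \<in> S. ((\<lambda>n. f n x) sums g x) \<and> ((\<lambda>n. deriv (f n) x) sums g' x) \<and> (g has_field_derivative g' x) (at x)"
  proof (rule series_and_derivative_comparison_complex[OF S])
    show "(f n has_field_derivative deriv (f n) x) (at x)" if "x \<in> S" for n x
      using holomorphic_derivI[OF hol S that] .
    fix x assume "x \<in> S"
    then obtain d M where dM: "d > 0" "summable M" "\<And>n y. y \<in> ball x d \<inter> S \<Longrightarrow> norm (f n y) \<le> M n"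
      using bd by blast
    have M0: "M n \<ge> 0" for n
      using dM(3)[of x n] dM(1) \<open>x \<in> S\<close> by (auto intro: order_trans[OF norm_ge_zero])
    show "\<exists>d h. 0 < d \<and> summable h \<and> range h \<subseteq> \<real>\<^sub>\<ge>\<^sub>0 \<and>
            (\<forall>\<^sub>F n in sequentially. \<forall>y\<in>ball x d \<inter> S. cmod (f n y) \<le> cmod (h n))"
      by (rule exI[of _ d], rule exI[of _ "\<lambda>n. complex_of_real (M n)"])
         (use dM M0 in \<open>auto simp: summable_of_real\<close>)
  qed
  then obtain g g' where g: "\<And>x. x \<in> S \<Longrightarrow> (\<lambda>n. f n x) sums g x"
      "\<And>x. x \<in> S \<Longrightarrow> (\<lambda>n. deriv (f n) x) sums g' x"
      "\<And>x. x \<in> S \<Longrightarrow> (g has_field_derivative g' x) (at x)" by blast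
  have eq: "(\<Sum>n. f n s) = g s" if "s \<in> S" for s using g(1)[OF that] by (simp add: sums_iff)
  have der: "((\<lambda>s. \<Sum>n. f n s) has_field_derivative g' s) (at s)" if "s \<in> S" for s
    by (rule has_field_derivative_transform_within_open[OF g(3)[OF that] S that]) (simp add: eq)
  show "(\<lambda>s. \<Sum>n. f n s) holomorphic_on S"
    using der by (auto simp: holomorphic_on_open[OF S])
  show "\<And>s. s \<in> S \<Longrightarrow> summable (\<lambda>n. f n s)" using g(1) by (auto simp: sums_iff)
  show "(\<lambda>n. deriv (f n) s) sums deriv (\<lambda>s. \<Sum>n. f n s) s" if "s \<in> S" for s
    using g(2)[OF that] DERIV_imp_deriv[OF der[OF that]] by simp
qed

section \<open>Continuation of \<open>(s - 1) * \<zeta>(s)\<close> to the half-plane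
  \<open>Re s > 0\<close>\<close>

lemma norm_of_nat_powr: "norm (of_nat n powr s :: complex) = real n powr Re s"
  by (subst norm_powr_real_powr) auto

text \<open>The mean value bound is applied twice on the real segment from \<open>n\<close> to
  \<open>n + 1\<close>: to \<open>z powr (w - 1)\<close>, and then to \<open>z powr w\<close> minus
  its linear part at \<open>n\<close>. For \<open>Re w \<le> 2\<close> the second derivative is
  largest in modulus at the left endpoint.\<close>

lemma powr_Suc_taylor:
  fixes w :: complex and n :: nat
  assumes n: "n > 0" and w: "Re w \<le> 2"
  shows "norm (of_nat (Suc n) powr w - of_nat n powr w - w * of_nat n powr (w - 1))
           \<le> norm w * norm (w - 1) * real n powr (Re w - 2)"
proof -
  define S where "S = complex_of_real ` {real n..real (Suc n)}"
  have cS: "convex S" unfolding S_def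
    by (rule convex_linear_image) (auto simp: bounded_linear_of_real bounded_linear.linear)
  have nS: "of_nat n \<in> S" "of_nat (Suc n) \<in> S"
    using imageI[of "real n" "{real n..real (Suc n)}" complex_of_real]
      imageI[of "real (Suc n)" "{real n..real (Suc n)}" complex_of_real]
    unfolding S_def by simp_all
  have S1: "z \<notin> \<real>\<^sub>\<le>\<^sub>0" "z \<noteq> 0" "norm (z - of_nat n) \<le> 1" if zS: "z \<in> S" for z
  proof -
    obtain x where x: "z = of_real x" "x \<in> {real n..real (Suc n)}" using zS unfolding S_def by blast
    show "z \<notin> \<real>\<^sub>\<le>\<^sub>0" "z \<noteq> 0" using x n by (auto simp: complex_nonpos_Reals_iff)
    have "z - of_nat n = of_real (x - real n)" using x by simp
    thus "norm (z - of_nat n) \<le> 1" using x by (simp only: norm_of_real) simp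
  qed
  have b1: "norm (z powr (w - 1) - of_nat n powr (w - 1)) \<le> norm (w - 1) * real n powr (Re w - 2)"
    if z: "z \<in> S" for z
  proof -
    have "norm (z powr (w - 1) - of_nat n powr (w - 1))
        \<le> (norm (w - 1) * real n powr (Re w - 2)) * norm (z - of_nat n)"
    proof (rule field_differentiable_bound[OF cS _ _ z nS(1)])
      fix u assume u: "u \<in> S"
      show "((\<lambda>z. z powr (w - 1)) has_field_derivative (w - 1) * u powr (w - 1 - 1)) (at u within S)"
        using S1[OF u] by (auto intro!: derivative_eq_intros)
      obtain x where x: "u = of_real x" "x \<in> {real n..real (Suc n)}" using u unfolding S_def by blast
      have "norm (u powr (w - 1 - 1)) = x powr (Re w - 2)"
        using x n by (subst norm_powr_real_powr) (auto)
      also have "\<dots> \<le> real n powr (Re w - 2)"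
        using x n w by (intro powr_mono2') auto
      finally show "norm ((w - 1) * u powr (w - 1 - 1)) \<le> norm (w - 1) * real n powr (Re w - 2)"
        by (simp add: norm_mult mult_left_mono)
    qed
    also have "\<dots> \<le> (norm (w - 1) * real n powr (Re w - 2)) * 1"
      by (intro mult_left_mono S1 z) auto
    finally show ?thesis by simp
  qed
  have "norm ((\<lambda>z. z powr w - w * of_nat n powr (w - 1) * z) (of_nat (Suc n))
          - (\<lambda>z. z powr w - w * of_nat n powr (w - 1) * z) (of_nat n))
        \<le> (norm w * norm (w - 1) * real n powr (Re w - 2)) * norm (of_nat (Suc n) - of_nat n :: complex)"
  proof (rule field_differentiable_bound[OF cS _ _ nS(2) nS(1)])
    fix u assume u: "u \<in> S"
    show "((\<lambda>z. z powr w - w * of_nat n powr (w - 1) * z) has_field_derivative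
            w * (u powr (w - 1) - of_nat n powr (w - 1))) (at u within S)"
      using S1[OF u] by (auto intro!: derivative_eq_intros simp: algebra_simps)
    show "norm (w * (u powr (w - 1) - of_nat n powr (w - 1))) \<le> norm w * norm (w - 1) * real n powr (Re w - 2)"
      using b1[OF u] by (simp add: norm_mult mult.assoc mult_left_mono)
  qed
  thus ?thesis by (simp add: algebra_simps)
qed

text \<open>The term \<open>n = 0\<close> vanishes because \<open>0 powr z = 0\<close>.\<close>
definition czeta :: "complex \<Rightarrow> complex" where "czeta s = (\<Sum>n. of_nat n powr (-s))"

text \<open>The second summands telescope to \<open>0\<close> for \<open>Re s > 1\<close>; they make the series for \<open>(s - 1) * \<zeta>(s)\<close> converge
  for \<open>Re s > 0\<close>.\<close>
definition zeta_reg :: "complex \<Rightarrow> complex" where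
  "zeta_reg s = (\<Sum>n. (s - 1) * of_nat n powr (-s) + (of_nat (Suc n) powr (1 - s) - of_nat n powr (1 - s)))"

lemma open_Re_gt: "open {s. Re s > c}"
  by (simp add: open_halfspace_Re_gt)

lemma ball_Re_bounds:
  assumes "y \<in> ball x d" shows "Re y > Re x - d" "norm y < norm x + d"
proof -
  have "norm (x - y) < d" using assms by (simp add: dist_norm)
  moreover have "\<bar>Re (x - y)\<bar> \<le> norm (x - y)" by (rule abs_Re_le_cmod)
  ultimately show "Re y > Re x - d" by simp
  show "norm y < norm x + d" using \<open>norm (x - y) < d\<close> norm_triangle_sub[of y x] by (simp add: norm_minus_commute)
qed

text \<open>This is \<open>powr_Suc_taylor\<close> with \<open>w = 1 - s\<close>, where
  \<open>(s - 1) * n powr (-s)\<close> is minus the linear term. At \<open>n = 0\<close> the summand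
  is 1, since \<open>0 powr z = 0\<close>; the last term of the bound accounts for it.\<close>

lemma zeta_reg_term_bound:
  assumes "Re s > 0"
  shows "norm ((s - 1) * of_nat n powr (-s) + (of_nat (Suc n) powr (1 - s) - of_nat n powr (1 - s)))
      \<le> norm (s - 1) * norm s * real n powr (- Re s - 1) + (if n = 0 then 1 else 0)"
proof (cases "n = 0")
  case False
  have "(s - 1) * of_nat n powr (-s) + (of_nat (Suc n) powr (1 - s) - of_nat n powr (1 - s))
     = of_nat (Suc n) powr (1 - s) - of_nat n powr (1 - s) - (1 - s) * of_nat n powr (1 - s - 1)"
    by (simp add: algebra_simps)
  also have "norm \<dots> \<le> norm (1 - s) * norm (1 - s - 1) * real n powr (Re (1 - s) - 2)"
    by (rule powr_Suc_taylor) (use False assms in auto)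
  also have "Re (1 - s) - 2 = - Re s - 1" by simp
  also have "norm (1 - s) * norm (1 - s - 1) = norm (s - 1) * norm s"
    by (simp add: norm_minus_commute)
  finally show ?thesis using False by simp
qed auto

lemma holomorphic_of_nat_powr [holomorphic_intros]:
  "f holomorphic_on S \<Longrightarrow> (\<lambda>s. of_nat n powr (f s)) holomorphic_on S"
  by (cases "n = 0") (auto intro!: holomorphic_intros)

lemma zeta_reg_holomorphic: "zeta_reg holomorphic_on {s. Re s > 0}"
  and zeta_reg_summable: "Re s > 0 \<Longrightarrow> summable (\<lambda>n. (s - 1) * of_nat n powr (-s) + (of_nat (Suc n) powr (1 - s) - of_nat n powr (1 - s)))"
proof -
  have bd: "\<exists>d>0. \<exists>M. summable M \<and>
              (\<forall>n. \<forall>y\<in>ball x d \<inter> {s. 0 < Re s}.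
                  cmod ((y - 1) * of_nat n powr - y + (of_nat (Suc n) powr (1 - y) - of_nat n powr (1 - y))) \<le> M n)"
    if x: "x \<in> {s. 0 < Re s}" for x
  proof -
    define d where "d = Re x / 2"
    define C where "C = (norm x + d + 1) * (norm x + d)"
    have d: "d > 0" using x by (simp add: d_def)
    have "summable (\<lambda>n. C * real n powr (- d - 1) + (if n = 0 then 1 else 0))"
      by (intro summable_add summable_mult) (use d in \<open>auto simp: summable_real_powr_iff summable_single\<close>)
    moreover have "cmod ((y - 1) * of_nat n powr - y + (of_nat (Suc n) powr (1 - y) - of_nat n powr (1 - y)))
       \<le> C * real n powr (- d - 1) + (if n = 0 then 1 else 0)" if y: "y \<in> ball x d \<inter> {s. 0 < Re s}" for n y
    proof -
      have y': "Re y > d" "norm y < norm x + d" using ball_Re_bounds[of y x d] y by (auto simp: d_def)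
      have "norm (y - 1) * norm y * real n powr (- Re y - 1) \<le> C * real n powr (- d - 1)"
        unfolding C_def
      proof (intro mult_mono)
        show "norm (y - 1) \<le> norm x + d + 1" using norm_triangle_ineq4[of y 1] y' by simp
        show "real n powr (- Re y - 1) \<le> real n powr (- d - 1)"
          using y' by (cases "n = 0") (auto intro!: powr_mono)
      qed (use y' d in auto)
      thus ?thesis using zeta_reg_term_bound[of y n] y by force
    qed
    ultimately show ?thesis using d by blast
  qed
  note * = holomorphic_series_comparison[OF open_Re_gt[of 0] _ bd]
  show "zeta_reg holomorphic_on {s. Re s > 0}" unfolding zeta_reg_def
    by (rule *(1)) (auto intro!: holomorphic_intros)
  show "Re s > 0 \<Longrightarrow> summable (\<lambda>n. (s - 1) * of_nat n powr (-s) + (of_nat (Suc n) powr (1 - s) - of_nat n powr (1 - s)))"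
    by (rule *(2)) (auto intro!: holomorphic_intros)
qed

lemma czeta_holomorphic: "czeta holomorphic_on {s. Re s > 1}"
  and czeta_deriv: "Re s > 1 \<Longrightarrow> (\<lambda>n. - complex_of_real (ln (real n)) * of_nat n powr (-s)) sums deriv czeta s"
proof -
  have bd: "\<exists>d>0. \<exists>M. summable M \<and>
              (\<forall>n. \<forall>y\<in>ball x d \<inter> {s. 1 < Re s}. cmod (of_nat n powr - y) \<le> M n)"
    if x: "x \<in> {s. 1 < Re s}" for x
  proof -
    define d where "d = (Re x - 1) / 2"
    have d: "d > 0" using x by (simp add: d_def)
    have "summable (\<lambda>n. real n powr (- (1 + d)))" using d by (auto simp: summable_real_powr_iff)
    moreover have "cmod (of_nat n powr - y) \<le> real n powr (- (1 + d))" if y: "y \<in> ball x d \<inter> {s. 1 < Re s}" for n y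
    proof -
      have "Re y > Re x - d" using ball_Re_bounds[of y x d] y by auto
      hence "Re y > 1 + d" by (simp add: d_def field_simps)
      thus ?thesis by (cases "n = 0") (auto intro!: powr_mono simp: norm_of_nat_powr)
    qed
    ultimately show ?thesis using d by blast
  qed
  note * = holomorphic_series_comparison[OF open_Re_gt[of 1] _ bd]
  have czeta: "czeta = (\<lambda>s. \<Sum>n. of_nat n powr (-s))" by (auto simp: czeta_def)
  show "czeta holomorphic_on {s. Re s > 1}" unfolding czeta
    by (rule *(1)) (auto intro!: holomorphic_intros)
  show "(\<lambda>n. - complex_of_real (ln (real n)) * of_nat n powr (-s)) sums deriv czeta s" if s: "Re s > 1"
  proof -
    have "deriv (\<lambda>s. of_nat n powr (-s)) s = - complex_of_real (ln (real n)) * of_nat n powr (-s)" for n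
    proof (cases "n = 0")
      case False
      have "((\<lambda>s. of_nat n powr (-s)) has_field_derivative (Ln (of_nat n) * of_nat n powr (-s)) * (-1)) (at s)"
        by (rule DERIV_chain2[OF has_field_derivative_powr_right]) (use False in \<open>auto intro!: derivative_eq_intros\<close>)
      thus ?thesis
        by (intro DERIV_imp_deriv) (use False in \<open>simp add: Ln_of_nat\<close>)
    qed auto
    moreover have "(\<lambda>n. deriv (\<lambda>s. of_nat n powr (-s)) s) sums deriv czeta s"
      unfolding czeta by (rule *(3)) (use s in \<open>auto intro!: holomorphic_intros\<close>)
    ultimately show ?thesis by simp
  qed
qed

lemma czeta_abs_summable: "Re s > 1 \<Longrightarrow> summable (\<lambda>n. norm (of_nat n powr (-s) :: complex))"
  by (simp add: norm_of_nat_powr summable_real_powr_iff)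

lemma zeta_reg_eq: assumes s: "Re s > 1" shows "zeta_reg s = (s - 1) * czeta s"
proof -
  have "(\<lambda>n. of_nat n powr (1 - s)) \<longlonglongrightarrow> 0"
    using tendsto_neg_powr_complex_of_nat[OF filterlim_ident, of "1 - s"] s by simp
  from telescope_sums[OF this]
  have 1: "(\<lambda>n. of_nat (Suc n) powr (1 - s) - of_nat n powr (1 - s)) sums 0" by simp
  have "(\<lambda>n. (s - 1) * of_nat n powr (-s)) sums ((s - 1) * czeta s)" unfolding czeta_def
    by (intro sums_mult summable_sums summable_norm_cancel[OF czeta_abs_summable] s)
  from sums_add[OF this 1] show ?thesis unfolding zeta_reg_def by (simp add: sums_iff)
qed

text \<open>The residue of \<zeta> at 1. All terms with \<open>n > 0\<close> vanish there, and the
  value comes from \<open>n = 0\<close>, where \<open>1 powr 0 - 0 powr 0 = 1\<close>.\<close>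

lemma zeta_reg_1: "zeta_reg 1 = 1"
proof -
  have "(\<lambda>n. if n = 0 then 1 else 0) sums (1::complex)" using sums_single[of 0 "\<lambda>_. 1::complex"] by simp
  moreover have "(\<lambda>n. (1 - 1) * of_nat n powr (- 1) + (of_nat (Suc n) powr (1 - 1) - of_nat n powr (1 - 1)))
     = (\<lambda>n. if n = 0 then 1 else (0::complex))" by (auto simp: fun_eq_iff simp del: of_nat_Suc)
  ultimately show ?thesis unfolding zeta_reg_def by (simp only: sums_iff)
qed

section \<open>The Dirichlet series of the von Mangoldt function\<close>

definition mangoldt_series :: "complex \<Rightarrow> complex" where "mangoldt_series s = (\<Sum>n. mangoldt n * of_nat n powr (-s))"

lemma mangoldt_series_abs_summable:
  assumes "Re s > 1" shows "summable (\<lambda>n. norm (mangoldt n * of_nat n powr (-s) :: complex))"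
proof (rule summable_comparison_test')
  define d where "d = (Re s - 1) / 2"
  have d: "d > 0" using assms by (simp add: d_def)
  show "summable (\<lambda>n. 1 / d * real n powr (d - Re s))"
    using d by (intro summable_mult) (auto simp: summable_real_powr_iff d_def field_simps)
  fix n :: nat assume "n \<ge> 1"
  have "mangoldt n \<le> ln (real n)" using \<open>n \<ge> 1\<close> by (intro mangoldt_le) auto
  also have "\<dots> \<le> real n powr d / d" using \<open>n \<ge> 1\<close> d by (intro ln_powr_bound) auto
  finally have "mangoldt n * real n powr (- Re s) \<le> real n powr d / d * real n powr (- Re s)"
    by (intro mult_right_mono) auto
  also have "\<dots> = 1 / d * real n powr (d - Re s)"
    using \<open>n \<ge> 1\<close> by (simp add: powr_diff powr_minus field_simps)
  finally show "norm (norm (mangoldt n * of_nat n powr (-s) :: complex)) \<le> 1 / d * real n powr (d - Re s)"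
    by (simp only: real_norm_def abs_norm_cancel) (simp only: norm_mult norm_mangoldt norm_of_nat_powr uminus_complex.sel)
qed

text \<open>The divisor sums of \<open>mangoldt\<close> are logarithms, so the Dirichlet product of
  the two series has the coefficients \<open>ln n\<close>. Absolute summability over the pairs
  \<open>(d, m)\<close> permits the regrouping by \<open>n = d * m\<close>.\<close>

lemma czeta_mult_mangoldt_series: assumes s: "Re s > 1" shows "czeta s * mangoldt_series s = - deriv czeta s"
proof -
  define a where "a = (\<lambda>n::nat. mangoldt n * of_nat n powr (-s) :: complex)"
  define b where "b = (\<lambda>n::nat. of_nat n powr (-s) :: complex)"
  have hs0: "(a has_sum mangoldt_series s) UNIV" "(b has_sum czeta s) UNIV"
    unfolding mangoldt_series_def czeta_def a_def b_def
    by (intro norm_summable_imp_has_sum summable_sums summable_norm_cancel[OF czeta_abs_summable]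
          summable_norm_cancel[OF mangoldt_series_abs_summable] czeta_abs_summable mangoldt_series_abs_summable s)+
  have hs: "(a has_sum mangoldt_series s) {1..}" "(b has_sum czeta s) {1..}"
    by (rule has_sum_cong_neutral[THEN iffD1, OF _ _ _ hs0(1)]; force simp: a_def not_le)
       (rule has_sum_cong_neutral[THEN iffD1, OF _ _ _ hs0(2)]; force simp: b_def not_le)
  have an: "(\<lambda>n. norm (a n)) summable_on {1..}" "(\<lambda>n. norm (b n)) summable_on {1..}"
  proof -
    have *: "(\<lambda>n. norm (a n)) summable_on UNIV" "(\<lambda>n. norm (b n)) summable_on UNIV"
      using mangoldt_series_abs_summable[OF s] czeta_abs_summable[OF s] unfolding a_def b_def
      by (simp_all only: summable_on_UNIV_nonneg_real_iff[OF norm_ge_zero])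
    show "(\<lambda>n. norm (a n)) summable_on {1..}" by (rule summable_on_subset_banach[OF *(1) subset_UNIV])
    show "(\<lambda>n. norm (b n)) summable_on {1..}" by (rule summable_on_subset_banach[OF *(2) subset_UNIV])
  qed
  have ab: "(\<lambda>x. norm (case x of (d,m) \<Rightarrow> a d * b m)) summable_on {1..} \<times> {1..}"
    unfolding Infinite_Sum.abs_summable_on_Sigma_iff
  proof (intro conjI ballI)
    fix d :: nat
    show "(\<lambda>y. norm (case (d, y) of (d, m) \<Rightarrow> a d * b m)) summable_on {1..}"
      unfolding prod.case norm_mult by (rule summable_on_cmult_right[OF an(2)])
    have "norm (infsum (\<lambda>y. norm (case (x, y) of (d, m) \<Rightarrow> a d * b m)) {1..}) = norm (a x) * infsum (\<lambda>y. norm (b y)) {1..}" for x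
      unfolding prod.case norm_mult infsum_cmult_right' by (simp add: abs_mult infsum_nonneg)
    thus "(\<lambda>x. norm (infsum (\<lambda>y. norm (case (x, y) of (d, m) \<Rightarrow> a d * b m)) {1..})) summable_on {1..}"
      by (simp only:) (rule summable_on_cmult_left[OF an(1)])
  qed
  have P: "((\<lambda>(d,m). a d * b m) has_sum (mangoldt_series s * czeta s)) ({1..} \<times> {1..})"
    by (rule has_sum_SigmaI[where g = "\<lambda>d. a d * czeta s"])
       (use has_sum_cmult_right[OF hs(2)] has_sum_cmult_left[OF hs(1)] abs_summable_summable[OF ab] in simp_all)
  have "((\<lambda>(n,d). a d * b (n div d)) has_sum (mangoldt_series s * czeta s)) (Sigma {1..} (\<lambda>n. {d. d dvd n}))"
    by (subst has_sum_reindex_bij_witness[of _ "\<lambda>(d,m). (d*m, d)" "\<lambda>(n,d). (d, n div d)"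
           "{1..} \<times> {1..}" "\<lambda>(d,m). a d * b m" _ "mangoldt_series s * czeta s" "mangoldt_series s * czeta s"])
       (use P in \<open>auto simp: Suc_le_eq dvd_div_eq_0_iff elim!: dvdE\<close>)
  hence "((\<lambda>n. \<Sum>d | d dvd n. a d * b (n div d)) has_sum (mangoldt_series s * czeta s)) {1..}"
    by (rule has_sum_SigmaD) (auto intro!: has_sum_finite)
  moreover have "(\<Sum>d | d dvd n. a d * b (n div d)) = complex_of_real (ln (real n)) * of_nat n powr (-s)" if "n \<in> {1..}" for n
  proof -
    have "(\<Sum>d | d dvd n. a d * b (n div d)) = (\<Sum>d | d dvd n. mangoldt d * of_nat n powr (-s))"
    proof (intro sum.cong refl)
      fix d assume "d \<in> {d. d dvd n}"
      then obtain m where n: "n = d * m" "d > 0" using \<open>n \<in> {1..}\<close> by (auto elim!: dvdE)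
      show "a d * b (n div d) = mangoldt d * of_nat n powr (-s)"
        unfolding a_def b_def n using n by (simp add: powr_times_real)
    qed
    also have "\<dots> = (\<Sum>d | d dvd n. mangoldt d) * of_nat n powr (-s)" by (simp add: sum_distrib_right)
    also have "(\<Sum>d | d dvd n. mangoldt d) = complex_of_real (ln (real n))"
      using that by (subst mangoldt_sum) auto
    finally show ?thesis .
  qed
  ultimately have "((\<lambda>n. complex_of_real (ln (real n)) * of_nat n powr (-s)) has_sum (mangoldt_series s * czeta s)) {1..}"
    by (subst (asm) has_sum_cong) auto
  hence "((\<lambda>n. complex_of_real (ln (real n)) * of_nat n powr (-s)) has_sum (mangoldt_series s * czeta s)) UNIV"
    by (rule has_sum_cong_neutral[THEN iffD1, rotated -1]) (auto simp: not_le)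
  hence "(\<lambda>n. complex_of_real (ln (real n)) * of_nat n powr (-s)) sums (mangoldt_series s * czeta s)" by (rule has_sum_imp_sums)
  from sums_minus[OF this] have "(\<lambda>n. - complex_of_real (ln (real n)) * of_nat n powr (-s)) sums (- (mangoldt_series s * czeta s))" by simp
  from sums_unique2[OF this czeta_deriv[OF s]] show ?thesis by (metis minus_minus mult.commute)
qed

section \<open>Nonvanishing of \<zeta> on the line \<open>Re s = 1\<close>\<close>

lemma zeta_reg_factor:
  assumes s: "Re s > 0"
  obtains m :: nat and g r where "r > 0" "g holomorphic_on ball s r" "m > 0 \<longleftrightarrow> zeta_reg s = 0"
    "\<And>w. w \<in> ball s r \<Longrightarrow> zeta_reg w = (w - s) ^ m * g w \<and> g w \<noteq> 0 \<and> Re w > 0"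
proof (cases "zeta_reg s = 0")
  case True
  have nc: "\<not> zeta_reg constant_on {s. Re s > 0}"
  proof
    assume "zeta_reg constant_on {s. Re s > 0}"
    then obtain c where c: "\<And>x. Re x > 0 \<Longrightarrow> zeta_reg x = c" by (auto simp: constant_on_def)
    from c[of 1] c[OF s] True zeta_reg_1 show False by simp
  qed
  have conn: "connected {s. Re s > 0}" by (intro convex_connected convex_halfspace_Re_gt)
  have sin: "s \<in> {s. Re s > 0}" using s by simp
  show thesis
  proof (rule holomorphic_factor_zero_nonconstant[OF zeta_reg_holomorphic open_Re_gt conn sin True nc])
    fix g r and n :: nat
    assume *: "0 < n" "0 < r" "ball s r \<subseteq> {s. Re s > 0}" "g holomorphic_on ball s r"
      "\<And>w. w \<in> ball s r \<Longrightarrow> zeta_reg w = (w - s)^n * g w" "\<And>w. w \<in> ball s r \<Longrightarrow> g w \<noteq> 0"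
    show thesis by (rule that[of r g n]) (use * True in blast)+
  qed
next
  case False
  have "open ({s. Re s > 0} \<inter> zeta_reg -` (- {0}))"
    by (rule continuous_open_preimage[OF holomorphic_on_imp_continuous_on[OF zeta_reg_holomorphic] open_Re_gt]) auto
  moreover have "s \<in> {s. Re s > 0} \<inter> zeta_reg -` (- {0})" using s False by auto
  ultimately obtain r where r: "r > 0" "ball s r \<subseteq> {s. Re s > 0} \<inter> zeta_reg -` (- {0})"
    by (rule openE)
  have "zeta_reg holomorphic_on ball s r" by (rule holomorphic_on_subset[OF zeta_reg_holomorphic]) (use r in auto)
  moreover have "zeta_reg w \<noteq> 0 \<and> Re w > 0" if "w \<in> ball s r" for w using r(2) that by blast
  ultimately show ?thesis using r(1) False by (intro that[of r zeta_reg 0]) (auto simp del: mem_ball)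
qed

lemma deriv_zeta_reg:
  assumes s: "Re s > 1"
  shows "deriv zeta_reg s = czeta s - (s - 1) * czeta s * mangoldt_series s"
proof -
  have "(czeta has_field_derivative deriv czeta s) (at s)"
    by (rule holomorphic_derivI[OF czeta_holomorphic open_Re_gt]) (use s in auto)
  hence "((\<lambda>s. (s - 1) * czeta s) has_field_derivative (czeta s + (s - 1) * deriv czeta s)) (at s)"
    by (auto intro!: derivative_eq_intros simp: algebra_simps)
  hence "(zeta_reg has_field_derivative (czeta s + (s - 1) * deriv czeta s)) (at s)"
    by (rule has_field_derivative_transform_within_open[OF _ open_Re_gt[of 1]]) (use s zeta_reg_eq in auto)
  moreover have "deriv czeta s = - (czeta s * mangoldt_series s)" using czeta_mult_mangoldt_series[OF s] by simp
  ultimately show ?thesis by (simp add: DERIV_imp_deriv algebra_simps)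
qed

text \<open>The residue at \<open>s\<close> of minus the logarithmic derivative of \<zeta>, as a
  limit from the right, where the Dirichlet series represents it: the pole at 1 contributes 1, a
  zero of order \<open>m\<close> contributes \<open>- m\<close>. The case \<open>m = 0\<close> is
  included, so zeros and regular points are treated alike.\<close>

lemma mangoldt_series_limit:
  assumes s: "Re s \<ge> 1"
  obtains m :: nat where "m > 0 \<longleftrightarrow> zeta_reg s = 0"
    "((\<lambda>e::real. of_real e * mangoldt_series (s + of_real e)) \<longlongrightarrow> (if s = 1 then 1 else 0) - of_nat m) (at_right 0)"
proof -
  have "Re s > 0" using s by simp
  from zeta_reg_factor[OF this] obtain m g r where mgr: "r > 0" "g holomorphic_on ball s r" "m > 0 \<longleftrightarrow> zeta_reg s = 0"
    "\<And>w. w \<in> ball s r \<Longrightarrow> zeta_reg w = (w - s) ^ m * g w \<and> g w \<noteq> 0 \<and> Re w > 0" by metis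
  have eq: "of_real e * mangoldt_series (s + of_real e) =
      of_real e / (s + of_real e - 1) - of_nat m - of_real e * deriv g (s + of_real e) / g (s + of_real e)"
    if e: "e > 0" "e < r" for e :: real
  proof -
    define w where "w = s + of_real e"
    have w: "w \<in> ball s r" "Re w > 1" using e s by (auto simp: w_def dist_norm)
    have w1: "w - 1 \<noteq> 0" using w by auto
    have ne: "zeta_reg w \<noteq> 0" "g w \<noteq> 0" using mgr(4)[OF w(1)] e by (auto simp: w_def)
    have "(g has_field_derivative deriv g w) (at w)"
      by (rule holomorphic_derivI[OF mgr(2) _ w(1)]) auto
    hence "((\<lambda>w. (w - s) ^ m * g w) has_field_derivative
             (of_nat m * (w - s) ^ (m - 1) * g w + (w - s) ^ m * deriv g w)) (at w)"
      by (auto intro!: derivative_eq_intros simp: algebra_simps)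
    hence "(zeta_reg has_field_derivative (of_nat m * (w - s) ^ (m - 1) * g w + (w - s) ^ m * deriv g w)) (at w)"
      by (rule has_field_derivative_transform_within_open[OF _ open_ball w(1)]) (use mgr(4) in auto)
    hence d: "deriv zeta_reg w = of_nat m * (w - s) ^ (m - 1) * g w + (w - s) ^ m * deriv g w"
      by (rule DERIV_imp_deriv)
    have "of_real e * (of_nat m * (w - s) ^ (m - 1) * g w) = of_nat m * zeta_reg w"
      using mgr(4)[OF w(1)] by (cases m) (auto simp: w_def)
    hence d1: "of_real e * deriv zeta_reg w = of_nat m * zeta_reg w + of_real e * (zeta_reg w * deriv g w / g w)"
      using d mgr(4)[OF w(1)] by (simp add: algebra_simps)
    have d2: "deriv zeta_reg w = zeta_reg w / (w - 1) - zeta_reg w * mangoldt_series w"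
      using deriv_zeta_reg[OF w(2)] zeta_reg_eq[OF w(2)] w1 by simp
    have "zeta_reg w * (of_real e * mangoldt_series w) = zeta_reg w * (of_real e / (w - 1) - of_nat m - of_real e * deriv g w / g w)"
      using d1 unfolding d2 by (simp add: algebra_simps)
    thus ?thesis using ne(1) unfolding w_def by (simp only: mult_cancel_left) simp
  qed
  have c: "((\<lambda>e::real. deriv g (s + of_real e) / g (s + of_real e)) \<longlongrightarrow> deriv g s / g s) (at_right 0)"
  proof -
    have h: "(\<lambda>w. deriv g w / g w) holomorphic_on ball s r"
      using mgr by (intro holomorphic_intros) auto
    have "isCont (\<lambda>w. deriv g w / g w) s"
      by (rule continuous_on_interior[OF holomorphic_on_imp_continuous_on[OF h]]) (use mgr in \<open>auto simp: interior_open\<close>)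
    moreover have "((\<lambda>e::real. s + of_real e) \<longlongrightarrow> s) (at_right 0)"
      by (auto intro!: tendsto_eq_intros)
    ultimately show ?thesis by (rule isCont_tendsto_compose)
  qed
  have c2: "((\<lambda>e::real. of_real e / (s + of_real e - 1)) \<longlongrightarrow> (if s = 1 then 1 else 0)) (at_right 0)"
  proof (cases "s = 1")
    case True
    have "eventually (\<lambda>e::real. of_real e / (s + of_real e - 1) = 1) (at_right 0)"
      using True eventually_at_right_less[of "0::real"] by (auto elim!: eventually_mono)
    thus ?thesis using True by (simp add: tendsto_eventually)
  qed (auto intro!: tendsto_eq_intros)
  have "((\<lambda>e::real. of_real e / (s + of_real e - 1) - of_nat m
      - of_real e * (deriv g (s + of_real e) / g (s + of_real e))) \<longlongrightarrow>
      (if s = 1 then 1 else 0) - of_nat m - of_real 0 * (deriv g s / g s)) (at_right 0)"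
    by (intro tendsto_diff tendsto_mult c c2 tendsto_const tendsto_of_real tendsto_ident_at)
  moreover have "eventually (\<lambda>e::real. of_real e / (s + of_real e - 1) - of_nat m
      - of_real e * (deriv g (s + of_real e) / g (s + of_real e)) = of_real e * mangoldt_series (s + of_real e)) (at_right 0)"
    using eventually_at_right_real[OF mgr(1)] by (rule eventually_mono) (use eq in auto)
  ultimately have "((\<lambda>e::real. of_real e * mangoldt_series (s + of_real e)) \<longlongrightarrow>
      (if s = 1 then 1 else 0) - of_nat m - of_real 0 * (deriv g s / g s)) (at_right 0)"
    by (rule Lim_transform_eventually)
  hence "((\<lambda>e::real. of_real e * mangoldt_series (s + of_real e)) \<longlongrightarrow> (if s = 1 then 1 else 0) - of_nat m) (at_right 0)"
    by simp
  thus ?thesis using that mgr(3) by blast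
qed

lemma norm_mangoldt_series_le:
  assumes "Re s > 1" "Re t \<ge> Re s"
  shows "norm (mangoldt_series t) \<le> (\<Sum>n. norm (mangoldt n * of_nat n powr (-s) :: complex))"
proof -
  have "norm (mangoldt_series t) \<le> (\<Sum>n. norm (mangoldt n * of_nat n powr (-t) :: complex))"
    unfolding mangoldt_series_def by (rule summable_norm[OF mangoldt_series_abs_summable]) (use assms in auto)
  also have "\<dots> \<le> (\<Sum>n. norm (mangoldt n * of_nat n powr (-s) :: complex))"
  proof (intro suminf_le mangoldt_series_abs_summable)
    fix n show "norm (mangoldt n * of_nat n powr (-t) :: complex) \<le> norm (mangoldt n * of_nat n powr (-s) :: complex)"
      unfolding norm_mult norm_of_nat_powr norm_mangoldt
      by (cases "n = 0") (use assms in \<open>auto intro!: mult_left_mono powr_mono simp: mangoldt_nonneg\<close>)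
  qed (use assms in auto)
  finally show ?thesis .
qed

lemma Re_of_nat_powr:
  "Re (of_nat n powr (- (of_real x + \<i> * of_real t))) = real n powr (-x) * cos (t * ln (real n))"
proof (cases "n = 0")
  case False
  have "of_nat n powr (- (of_real x + \<i> * of_real t)) = exp (of_real (- x * ln (real n)) + \<i> * of_real (- t * ln (real n)))"
    using False by (simp add: powr_def Ln_of_nat algebra_simps)
  hence "Re (of_nat n powr (- (of_real x + \<i> * of_real t))) = exp (- x * ln (real n)) * cos (- t * ln (real n))"
    by (simp only: Re_exp) simp
  thus ?thesis using False by (simp add: powr_def)
qed auto

text \<open>Termwise, with \<open>c = cos (t * ln n)\<close>:
  \<open>3 + 4 * c + (2 * c^2 - 1) = 2 * (1 + c)^2\<close>, and \<open>mangoldt\<close> is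
  nonnegative.\<close>

lemma mangoldt_series_341:
  assumes x: "x > 1"
  shows "Re (3 * mangoldt_series (of_real x) + 4 * mangoldt_series (of_real x + \<i> * of_real t) + mangoldt_series (of_real x + \<i> * of_real (2 * t))) \<ge> 0"
proof -
  have S: "(\<lambda>n. mangoldt n * (real n powr (-x) * cos (u * ln (real n)))) sums Re (mangoldt_series (of_real x + \<i> * of_real u))" for u
  proof -
    have "(\<lambda>n. mangoldt n * of_nat n powr (-(of_real x + \<i> * of_real u))) sums mangoldt_series (of_real x + \<i> * of_real u)"
      unfolding mangoldt_series_def by (intro summable_sums summable_norm_cancel[OF mangoldt_series_abs_summable]) (use x in auto)
    from sums_Re[OF this] show ?thesis
      by (simp only: times_complex.sel Re_mangoldt Im_mangoldt Re_of_nat_powr mult_zero_left diff_zero)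
  qed
  have S3: "(\<lambda>n. 3 * (mangoldt n * (real n powr (-x) * cos (0 * ln (real n)))) + 4 * (mangoldt n * (real n powr (-x) * cos (t * ln (real n))))
     + mangoldt n * (real n powr (-x) * cos ((2 * t) * ln (real n)))) sums
     (3 * Re (mangoldt_series (of_real x + \<i> * of_real 0)) + 4 * Re (mangoldt_series (of_real x + \<i> * of_real t)) + Re (mangoldt_series (of_real x + \<i> * of_real (2 * t))))"
    by (intro sums_add sums_mult S)
  have nn: "0 \<le> 3 * (mangoldt n * (real n powr (-x) * cos (0 * ln (real n)))) + 4 * (mangoldt n * (real n powr (-x) * cos (t * ln (real n))))
     + mangoldt n * (real n powr (-x) * cos ((2 * t) * ln (real n)))" for n
  proof -
    define c where "c = cos (t * ln (real n))"
    have h: "cos ((2 * t) * ln (real n)) = 2 * c\<^sup>2 - 1" unfolding c_def using cos_double_cos[of "t * ln (real n)"] by (simp add: mult.assoc)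
    have "3 * (mangoldt n * (real n powr (-x) * cos (0 * ln (real n)))) + 4 * (mangoldt n * (real n powr (-x) * cos (t * ln (real n))))
     + mangoldt n * (real n powr (-x) * cos ((2 * t) * ln (real n))) = mangoldt n * real n powr (-x) * (2 * (1 + c)\<^sup>2)"
      unfolding h c_def[symmetric] by (simp add: power2_eq_square algebra_simps)
    also have "\<dots> \<ge> 0" by (intro mult_nonneg_nonneg) (auto simp: mangoldt_nonneg)
    finally show ?thesis .
  qed
  have "0 \<le> 3 * Re (mangoldt_series (of_real x + \<i> * of_real 0)) + 4 * Re (mangoldt_series (of_real x + \<i> * of_real t)) + Re (mangoldt_series (of_real x + \<i> * of_real (2 * t)))"
    by (rule sums_le[OF nn sums_zero S3])
  thus ?thesis by simp
qed

text \<open>To the right of the line the series stays bounded near \<open>s\<close>, so the limit of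
  \<open>mangoldt_series_limit\<close> is 0 and the order \<open>m\<close> vanishes. On the line,
  multiplying the 3-4-1 inequality by \<open>e\<close> and letting \<open>e\<close> tend to 0 gives
  \<open>3 * (1 - m0) - 4 * m1 - m2 \<ge> 0\<close> for the orders at 1, \<open>1 + \<i> * t\<close>
  and \<open>1 + 2 * \<i> * t\<close>; a zero at \<open>1 + \<i> * t\<close> would make the left
  side negative.\<close>

lemma zeta_reg_nonzero:
  assumes s: "Re s \<ge> 1" shows "zeta_reg s \<noteq> 0"
proof (cases "Re s > 1")
  case True
  obtain m where m: "m > 0 \<longleftrightarrow> zeta_reg s = 0"
    "((\<lambda>e::real. of_real e * mangoldt_series (s + of_real e)) \<longlongrightarrow> (if s = 1 then 1 else 0) - of_nat m) (at_right 0)"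
    using mangoldt_series_limit[OF s] by blast
  define C where "C = (\<Sum>n. norm (mangoldt n * of_nat n powr (-s) :: complex))"
  have "((\<lambda>e::real. of_real e * mangoldt_series (s + of_real e)) \<longlongrightarrow> 0) (at_right 0)"
  proof (rule Lim_null_comparison)
    show "eventually (\<lambda>e::real. norm (of_real e * mangoldt_series (s + of_real e)) \<le> e * C) (at_right 0)"
      using eventually_at_right_less[of "0::real"]
      by (rule eventually_mono) (use True norm_mangoldt_series_le[of s] in \<open>auto simp: norm_mult C_def intro!: mult_left_mono\<close>)
    show "((\<lambda>e::real. e * C) \<longlongrightarrow> 0) (at_right 0)" by (auto intro!: tendsto_eq_intros)
  qed
  from tendsto_unique[OF _ m(2) this] have "complex_of_nat m = 0" using True by (auto split: if_splits)
  thus ?thesis using m(1) by simp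
next
  case False
  hence R: "Re s = 1" using s by simp
  define t where "t = Im s"
  have s_eq: "s = 1 + \<i> * of_real t" using R by (simp add: complex_eq_iff t_def)
  show ?thesis
  proof (cases "t = 0")
    case True thus ?thesis using zeta_reg_1 s_eq by simp
  next
    case t: False
    obtain m0 where m0: "m0 > 0 \<longleftrightarrow> zeta_reg 1 = 0"
      "((\<lambda>e::real. of_real e * mangoldt_series (1 + of_real e)) \<longlongrightarrow> 1 - of_nat m0) (at_right 0)"
      using mangoldt_series_limit[of 1] by auto
    obtain m1 where m1: "m1 > 0 \<longleftrightarrow> zeta_reg s = 0"
      "((\<lambda>e::real. of_real e * mangoldt_series (s + of_real e)) \<longlongrightarrow> - of_nat m1) (at_right 0)"
      using mangoldt_series_limit[OF s] s_eq t by auto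
    obtain m2 where m2:
      "((\<lambda>e::real. of_real e * mangoldt_series (1 + \<i> * of_real (2 * t) + of_real e)) \<longlongrightarrow> - of_nat m2) (at_right 0)"
      using mangoldt_series_limit[of "1 + \<i> * of_real (2 * t)"] t by auto
    have "((\<lambda>e::real. Re (3 * (of_real e * mangoldt_series (1 + of_real e)) + 4 * (of_real e * mangoldt_series (s + of_real e))
        + of_real e * mangoldt_series (1 + \<i> * of_real (2 * t) + of_real e))) \<longlongrightarrow>
       Re (3 * (1 - of_nat m0) + 4 * (- of_nat m1) + - of_nat m2)) (at_right 0)"
      by (intro tendsto_Re tendsto_add tendsto_mult tendsto_const m0(2) m1(2) m2)
    moreover have "eventually (\<lambda>e::real. Re (3 * (of_real e * mangoldt_series (1 + of_real e)) + 4 * (of_real e * mangoldt_series (s + of_real e))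
        + of_real e * mangoldt_series (1 + \<i> * of_real (2 * t) + of_real e)) \<ge> 0) (at_right 0)"
      using eventually_at_right_less[of "0::real"]
    proof (rule eventually_mono)
      fix e :: real assume e: "0 < e"
      have "3 * (of_real e * mangoldt_series (1 + of_real e)) + 4 * (of_real e * mangoldt_series (s + of_real e))
        + of_real e * mangoldt_series (1 + \<i> * of_real (2 * t) + of_real e)
        = of_real e * (3 * mangoldt_series (of_real (1 + e)) + 4 * mangoldt_series (of_real (1 + e) + \<i> * of_real t) + mangoldt_series (of_real (1 + e) + \<i> * of_real (2 * t)))"
        by (simp add: s_eq algebra_simps)
      also have "Re \<dots> = e * Re (3 * mangoldt_series (of_real (1 + e)) + 4 * mangoldt_series (of_real (1 + e) + \<i> * of_real t) + mangoldt_series (of_real (1 + e) + \<i> * of_real (2 * t)))"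
        by (simp only: Re_complex_of_real Im_complex_of_real times_complex.sel mult_zero_left diff_zero)
      also have "\<dots> \<ge> 0" using mangoldt_series_341[of "1 + e" t] e by (intro mult_nonneg_nonneg) auto
      finally show "Re (3 * (of_real e * mangoldt_series (1 + of_real e)) + 4 * (of_real e * mangoldt_series (s + of_real e))
        + of_real e * mangoldt_series (1 + \<i> * of_real (2 * t) + of_real e)) \<ge> 0" .
    qed
    ultimately have "Re (3 * (1 - of_nat m0) + 4 * (- of_nat m1) + - of_nat m2) \<ge> 0"
      by (intro tendsto_lowerbound) auto
    hence "4 * m1 \<le> 3" using m0(1) zeta_reg_1 by simp
    hence "m1 = 0" by simp
    thus ?thesis using m1(1) by simp
  qed
qed

text \<open>The continuation of \<open>- \<zeta>'/\<zeta> - \<zeta>\<close>, whose poles at \<open>1\<close> cancel.\<close>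
definition log_deriv_reg :: "complex \<Rightarrow> complex" where
  "log_deriv_reg s = - deriv zeta_reg s / zeta_reg s - (if s = 1 then deriv zeta_reg 1 else (zeta_reg s - zeta_reg 1) / (s - 1))"

lemma open_zeta_reg: "open {s. Re s > 0 \<and> zeta_reg s \<noteq> 0}"
proof -
  have "open ({s. Re s > 0} \<inter> zeta_reg -` (- {0}))"
    by (rule continuous_open_preimage[OF holomorphic_on_imp_continuous_on[OF zeta_reg_holomorphic] open_Re_gt]) auto
  also have "{s. Re s > 0} \<inter> zeta_reg -` (- {0}) = {s. Re s > 0 \<and> zeta_reg s \<noteq> 0}" by auto
  finally show ?thesis .
qed

lemma log_deriv_reg_holomorphic: "log_deriv_reg holomorphic_on {s. Re s > 0 \<and> zeta_reg s \<noteq> 0}"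
proof -
  have h: "zeta_reg holomorphic_on {s. Re s > 0 \<and> zeta_reg s \<noteq> 0}"
    by (rule holomorphic_on_subset[OF zeta_reg_holomorphic]) auto
  have "(\<lambda>s. if s = 1 then deriv zeta_reg 1 else (zeta_reg s - zeta_reg 1) / (s - 1)) holomorphic_on {s. Re s > 0 \<and> zeta_reg s \<noteq> 0}"
    by (rule pole_lemma[OF h]) (use open_zeta_reg zeta_reg_1 in \<open>auto simp: interior_open\<close>)
  thus ?thesis unfolding log_deriv_reg_def using h open_zeta_reg by (intro holomorphic_intros) auto
qed

lemma log_deriv_reg_eq: assumes s: "Re s > 1" shows "log_deriv_reg s = mangoldt_series s - czeta s"
proof -
  have s1: "s - 1 \<noteq> 0" "s \<noteq> 1" using s by auto
  have ne: "zeta_reg s \<noteq> 0" using zeta_reg_nonzero[of s] s by auto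
  have czeta: "czeta s = zeta_reg s / (s - 1)" using zeta_reg_eq[OF s] s1 by simp
  have "deriv zeta_reg s = zeta_reg s * (1 / (s - 1) - mangoldt_series s)"
    unfolding deriv_zeta_reg[OF s] czeta using s1 by (simp add: right_diff_distrib)
  hence "deriv zeta_reg s / zeta_reg s = 1 / (s - 1) - mangoldt_series s" using ne by simp
  thus ?thesis using s1 zeta_reg_1 unfolding log_deriv_reg_def czeta by (simp add: diff_divide_distrib)
qed

section \<open>Chebyshev's upper bound for \<open>psi\<close>\<close>

definition psi :: "nat \<Rightarrow> real" where "psi n = (\<Sum>k\<le>n. mangoldt k)"

text \<open>Legendre's formula in logarithmic form. From \<open>N\<close> to \<open>N + 1\<close>
  the quotient by \<open>d\<close> grows by one exactly for the divisors of \<open>N + 1\<close>,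
  and \<open>mangoldt\<close> sums to \<open>ln (N + 1)\<close> over these.\<close>

lemma sum_mangoldt_div: "(\<Sum>d\<in>{1..N}. mangoldt d * real (N div d)) = ln (fact N)"
proof (induction N)
  case (Suc N)
  have *: "Suc N div d = N div d + (if d dvd Suc N then 1 else 0)" if "d \<in> {1..Suc N}" for d
    using that by (auto simp: div_Suc dvd_eq_mod_eq_0)
  have "(\<Sum>d\<in>{1..Suc N}. mangoldt d * real (Suc N div d)) =
      (\<Sum>d\<in>{1..Suc N}. mangoldt d * real (N div d) + (if d dvd Suc N then mangoldt d else 0))"
    by (intro sum.cong refl) (simp add: * algebra_simps)
  also have "\<dots> = (\<Sum>d\<in>{1..Suc N}. mangoldt d * real (N div d)) + (\<Sum>d\<in>{1..Suc N}. if d dvd Suc N then mangoldt d else 0)"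
    by (rule sum.distrib)
  also have "(\<Sum>d\<in>{1..Suc N}. mangoldt d * real (N div d)) = (\<Sum>d\<in>{1..N}. mangoldt d * real (N div d))"
    by simp
  also have "(\<Sum>d\<in>{1..Suc N}. if d dvd Suc N then mangoldt d else 0) = (\<Sum>d | d dvd Suc N. mangoldt d :: real)"
    by (rule sum.mono_neutral_cong_right) (auto dest: dvd_imp_le simp: Suc_le_eq intro!: Nat.gr0I)
  also have "\<dots> = ln (real (Suc N))" by (subst mangoldt_sum) auto
  also have "(\<Sum>d\<in>{1..N}. mangoldt d * real (N div d)) = ln (fact N)" by (rule Suc.IH)
  also have "ln (fact N) + ln (real (Suc N)) = ln (real (Suc N) * fact N)"
    by (simp add: ln_mult del: of_nat_Suc)
  also have "real (Suc N) * fact N = fact (Suc N)" by (simp only: fact_Suc of_nat_id)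
  finally show ?case .
qed auto

text \<open>In the logarithm of the central binomial coefficient, at most \<open>m * ln 4\<close>,
  the weight of \<open>mangoldt d\<close> is \<open>2 * m div d - 2 * (m div d)\<close>. It is never
  negative, and at least 1 for \<open>m < d \<le> 2 * m\<close>.\<close>

lemma psi_double: "psi (2 * m) \<le> psi m + real m * ln 4"
proof -
  have "ln (fact (2 * m)) - 2 * ln (fact m) =
     (\<Sum>d\<in>{1..2*m}. mangoldt d * real (2 * m div d)) - 2 * (\<Sum>d\<in>{1..2*m}. mangoldt d * real (m div d))"
    by (subst sum_mangoldt_div, subst sum.mono_neutral_right[of "{1..2*m}" "{1..m}"])
       (auto simp: sum_mangoldt_div[of m, simplified] sum_mangoldt_div not_le)
  also have "\<dots> = (\<Sum>d\<in>{1..2*m}. mangoldt d * (real (2 * m div d) - 2 * real (m div d)))"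
    by (simp add: sum_distrib_left sum_subtractf algebra_simps)
  also have "\<dots> \<ge> (\<Sum>d\<in>{1..2*m}. if d > m then mangoldt d else 0)"
  proof (rule sum_mono)
    fix d assume d: "d \<in> {1..2*m}"
    show "(if d > m then mangoldt d else 0) \<le> mangoldt d * (real (2 * m div d) - 2 * real (m div d))"
    proof (cases "d > m")
      case True
      have "2 * m div d \<ge> 1" using d by (simp add: div_greater_zero_iff Suc_le_eq)
      hence "mangoldt d * 1 \<le> (mangoldt d * real (2 * m div d) :: real)"
        by (intro mult_left_mono) (auto simp: mangoldt_nonneg)
      thus ?thesis using True by simp
    next
      case False
      have "2 * (m div d) * d \<le> 2 * m" using div_times_less_eq_dividend[of m d] by (simp only: mult.assoc mult_le_mono2)
      hence "2 * (m div d) \<le> 2 * m div d" using d by (subst less_eq_div_iff_mult_less_eq) auto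
      hence "real (2 * m div d) - 2 * real (m div d) \<ge> 0" by linarith
      thus ?thesis using False by (simp add: mangoldt_nonneg)
    qed
  qed
  also have "(\<Sum>d\<in>{1..2*m}. if d > m then mangoldt d else 0) = psi (2 * m) - psi m"
  proof -
    have "psi (2 * m) = (\<Sum>d\<in>{..m} \<union> {d\<in>{1..2*m}. d > m}. mangoldt d)"
      unfolding psi_def by (intro sum.cong) auto
    also have "\<dots> = psi m + (\<Sum>d\<in>{d\<in>{1..2*m}. d > m}. mangoldt d)"
      unfolding psi_def by (rule sum.union_disjoint) auto
    finally have *: "psi (2 * m) = psi m + (\<Sum>d\<in>{d\<in>{1..2*m}. d > m}. mangoldt d)" .
    show ?thesis using *[unfolded sum.inter_filter[OF finite_atLeastAtMost]] by linarith
  qed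
  finally have "psi (2 * m) - psi m \<le> ln (fact (2 * m)) - 2 * ln (fact m)" .
  also have "\<dots> = ln (real ((2 * m) choose m))"
  proof -
    have "real (fact (2 * m)) = real (fact m) ^ 2 * real ((2 * m) choose m)"
    proof -
      have "fact (2 * m) = fact m * fact m * ((2 * m) choose m)"
        using binomial_fact_lemma[of m "2 * m"] by (simp add: mult_2)
      thus ?thesis by (simp only: of_nat_mult power2_eq_square)
    qed
    hence "fact (2 * m) = (fact m) ^ 2 * real ((2 * m) choose m)" by (simp only: of_nat_fact)
    moreover have "ln ((fact m) ^ 2 * real ((2 * m) choose m)) = ln ((fact m)^2) + ln (real ((2 * m) choose m))"
      by (rule ln_mult_pos) (auto simp: zero_less_binomial_iff)
    ultimately show ?thesis by (simp add: ln_realpow)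
  qed
  also have "\<dots> \<le> ln (4 ^ m)"
  proof -
    have "(2 * m) choose m \<le> 2 ^ (2 * m)" by (rule binomial_le_pow2)
    hence "real ((2 * m) choose m) \<le> real (2 ^ (2 * m))" by (rule of_nat_mono)
    hence "real ((2 * m) choose m) \<le> 4 ^ m" by (simp add: power_mult)
    thus ?thesis by (subst ln_le_cancel_iff) auto
  qed
  also have "\<dots> = real m * ln 4" by (simp add: ln_realpow)
  finally show ?thesis by simp
qed

lemma psi_mono: "m \<le> n \<Longrightarrow> psi m \<le> psi n"
  unfolding psi_def by (intro sum_mono2) (auto simp: mangoldt_nonneg)

lemma psi_nonneg: "psi n \<ge> 0" unfolding psi_def by (intro sum_nonneg mangoldt_nonneg)

text \<open>Iterated doubling gives \<open>psi (2 ^ k) \<le> 2 ^ k * ln 4\<close>; passing to the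
  next power of 2 above \<open>n\<close> costs the factor 2.\<close>

lemma psi_le: "psi n \<le> 2 * ln 4 * real n"
proof (cases "n = 0")
  case False
  have p2: "psi (2 ^ k) \<le> 2 ^ k * ln 4" for k
  proof (induction k)
    case (Suc k)
    show ?case using psi_double[of "2 ^ k"] Suc by simp
  qed (simp add: psi_def atMost_Suc numeral_2_eq_2)
  obtain k where k: "2 ^ k \<le> n" "n < 2 ^ Suc k"
    using False ex_power_ivl1[of 2 n] by auto
  have "psi n \<le> psi (2 ^ Suc k)" by (rule psi_mono) (use k in simp)
  also have "\<dots> \<le> 2 * 2 ^ k * ln 4" using p2[of "Suc k"] by simp
  also have "\<dots> \<le> 2 * real n * ln 4" using of_nat_mono[OF k(1), where 'a = real] by (intro mult_right_mono) auto
  finally show ?thesis by (simp add: mult_ac)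
qed (simp add: psi_def)

section \<open>Newman's Tauberian theorem\<close>

lemma half_plane_contours:
  fixes \<phi> :: "complex \<Rightarrow> complex"
  assumes S: "open S" "convex S" "0 \<in> S" and hol: "\<phi> holomorphic_on S"
    and g: "valid_path g" "path_image g \<subseteq> S" "\<And>z. z \<in> path_image g \<Longrightarrow> Re z \<ge> 0 \<and> z \<noteq> 0"
      "pathstart g = - (\<i> * of_real R)" "pathfinish g = \<i> * of_real R"
    and h: "valid_path h" "path_image h \<subseteq> S" "\<And>z. z \<in> path_image h \<Longrightarrow> Re z \<le> 0 \<and> z \<noteq> 0"
      "pathstart h = \<i> * of_real R" "pathfinish h = - (\<i> * of_real R)"
    and R: "R > 0"
  obtains I J where "((\<lambda>z. \<phi> z / z) has_contour_integral I) g" "((\<lambda>z. \<phi> z / z) has_contour_integral J) h"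
    "I + J = 2 * of_real pi * \<i> * \<phi> 0"
proof -
  \<comment> \<open>Primitives replace the residue theorem. The difference quotient has one on the
    convex set \<open>S\<close>, while \<open>1 / z\<close> has \<open>Ln z\<close> on the right
    half-plane and \<open>Ln (- z)\<close> on the left one. For the latter each half contributes
    \<open>pi * \<i>\<close>. Treating the halves separately lets the same right arc be completed by
    different left paths.\<close>
  define F where "F = (\<lambda>z. if z = 0 then deriv \<phi> 0 else (\<phi> z - \<phi> 0) / (z - 0))"
  have F: "F holomorphic_on S" unfolding F_def
    by (rule pole_lemma[OF hol]) (use S in \<open>auto simp: interior_open\<close>)
  obtain P where P: "\<And>x. x \<in> S \<Longrightarrow> (P has_field_derivative F x) (at x within S)"
  proof (rule holomorphic_convex_primitive[of S "{}" F])
    show "F field_differentiable at x" if "x \<in> interior S - {}" for x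
      using that F S(1) by (auto simp: interior_open intro: holomorphic_on_imp_differentiable_at)
  qed (use F S in \<open>auto intro: holomorphic_on_imp_continuous_on\<close>)
  have L1: "(Ln has_field_derivative inverse z) (at z within {z. Re z \<ge> 0 \<and> z \<noteq> 0})"
    if "z \<in> {z. Re z \<ge> 0 \<and> z \<noteq> 0}" for z
  proof -
    have "z \<notin> \<real>\<^sub>\<le>\<^sub>0" using that by (auto simp: complex_nonpos_Reals_iff complex_eq_iff)
    thus ?thesis by (rule has_field_derivative_at_within[OF has_field_derivative_Ln])
  qed
  have L2: "((\<lambda>z. Ln (- z)) has_field_derivative inverse z) (at z within {z. Re z \<le> 0 \<and> z \<noteq> 0})"
    if "z \<in> {z. Re z \<le> 0 \<and> z \<noteq> 0}" for z
  proof -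
    have "- z \<notin> \<real>\<^sub>\<le>\<^sub>0" using that by (auto simp: complex_nonpos_Reals_iff complex_eq_iff)
    hence "((\<lambda>z. Ln (- z)) has_field_derivative inverse (-z) * (-1)) (at z)"
      by (intro DERIV_chain2[OF has_field_derivative_Ln]) (auto intro!: derivative_eq_intros)
    hence "((\<lambda>z. Ln (- z)) has_field_derivative inverse z) (at z)" by simp
    thus ?thesis by (rule has_field_derivative_at_within)
  qed
  have i1: "(F has_contour_integral (P (\<i> * of_real R) - P (- (\<i> * of_real R)))) g"
    using contour_integral_primitive[OF P g(1,2)] g by simp
  have i2: "(F has_contour_integral (P (- (\<i> * of_real R)) - P (\<i> * of_real R))) h"
    using contour_integral_primitive[OF P h(1,2)] h by simp
  have j1: "(inverse has_contour_integral (Ln (\<i> * of_real R) - Ln (- (\<i> * of_real R)))) g"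
    using contour_integral_primitive[OF L1 g(1)] g by auto
  have j2: "(inverse has_contour_integral (Ln (\<i> * of_real R) - Ln (- (\<i> * of_real R)))) h"
    using contour_integral_primitive[OF L2 h(1)] h by auto
  have lni: "Ln (\<i> * of_real R) = ln R + \<i> * of_real pi / 2" "Ln (- (\<i> * of_real R)) = ln R - \<i> * of_real pi / 2"
    using R Ln_times_of_real[of R \<i>] Ln_times_of_real[of R "-\<i>"] by (simp_all add: mult.commute Ln_of_real)
  define d where "d = Ln (\<i> * of_real R) - Ln (- (\<i> * of_real R))"
  have d: "d = of_real pi * \<i>" unfolding d_def lni by simp
  have eq: "F z + \<phi> 0 * inverse z = \<phi> z / z" if "z \<noteq> 0" for z
    using that by (simp add: F_def field_simps)
  have k1: "((\<lambda>z. \<phi> z / z) has_contour_integral (P (\<i> * of_real R) - P (- (\<i> * of_real R)) + \<phi> 0 * d)) g"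
    by (rule has_contour_integral_eq[OF has_contour_integral_add[OF i1 has_contour_integral_lmul[OF j1, folded d_def]]])
       (use g(3) eq in auto)
  have k2: "((\<lambda>z. \<phi> z / z) has_contour_integral (P (- (\<i> * of_real R)) - P (\<i> * of_real R) + \<phi> 0 * d)) h"
    by (rule has_contour_integral_eq[OF has_contour_integral_add[OF i2 has_contour_integral_lmul[OF j2, folded d_def]]])
       (use h(3) eq in auto)
  show thesis by (rule that[OF k1 k2]) (simp add: d)
qed

text \<open>Along the segment \<open>Re z\<close> falls linearly from 0 to
  \<open>- \<delta>\<close>, so the exponential integrates to at most
  \<open>1 / (l * \<delta>)\<close>. With \<open>l = ln N\<close> this gives decay in
  \<open>N\<close>, although the segment starts on the imaginary axis, where the exponential has
  modulus 1.\<close>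

lemma decaying_line_integral:
  fixes f :: "complex \<Rightarrow> complex"
  assumes i: "((\<lambda>z. f z * exp (of_real l * z)) has_contour_integral I) (linepath a b)"
    and a: "Re a = 0" and b: "Re b = - \<delta>" and \<delta>: "\<delta> > 0" and l: "l > 0"
    and M: "\<And>z. z \<in> closed_segment a b \<Longrightarrow> norm (f z) \<le> M"
  shows "norm I \<le> M * norm (b - a) / (l * \<delta>)"
proof -
  have M0: "M \<ge> 0" using M[of a] by (auto intro: order_trans[OF norm_ge_zero])
  define c where "c = l * \<delta>"
  have c: "c > 0" using \<delta> l by (simp add: c_def)
  have i': "((\<lambda>x. f (linepath a b x) * exp (of_real l * linepath a b x) * (b - a)) has_integral I) {0..1}"
    using i by (simp add: has_contour_integral_linepath)
  have g: "((\<lambda>x. M * norm (b - a) * exp (- c * x)) has_integral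
             (M * norm (b - a) * (- exp (- c * 1) / c) - M * norm (b - a) * (- exp (- c * 0) / c))) {0..1}"
    by (rule fundamental_theorem_of_calculus)
       (use c in \<open>auto intro!: derivative_eq_intros simp flip: has_real_derivative_iff_has_vector_derivative\<close>)
  have "norm (integral {0..1} (\<lambda>x. f (linepath a b x) * exp (of_real l * linepath a b x) * (b - a)))
     \<le> integral {0..1} (\<lambda>x. M * norm (b - a) * exp (- c * x))"
  proof (rule Henstock_Kurzweil_Integration.integral_norm_bound_integral)
    fix x :: real assume x: "x \<in> {0..1}"
    have "Re (linepath a b x) = - \<delta> * x" using a b by (simp add: linepath_def)
    hence "norm (exp (of_real l * linepath a b x)) = exp (- c * x)" by (simp add: c_def)
    moreover have "norm (f (linepath a b x)) \<le> M"
      using x by (intro M linepath_in_path) auto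
    ultimately have "norm (f (linepath a b x)) * (norm (exp (of_real l * linepath a b x)) * norm (b - a)) \<le> M * (exp (- c * x) * norm (b - a))"
      by (intro mult_mono) (use M0 in auto)
    thus "norm (f (linepath a b x) * exp (of_real l * linepath a b x) * (b - a)) \<le> M * norm (b - a) * exp (- c * x)"
      by (simp only: norm_mult mult_ac)
  qed (use i' g in blast)+
  also have "\<dots> = M * norm (b - a) * (1 - exp (- c)) / c"
    using integral_unique[OF g] c by (simp add: field_simps)
  also have "\<dots> \<le> M * norm (b - a) * 1 / c"
    using c M0 by (intro divide_right_mono mult_left_mono) auto
  finally show ?thesis using integral_unique[OF i'] by (simp add: c_def)
qed

lemma powr_neg_Suc_le:
  assumes x: "x > 0" and k: "k > 0"
  shows "real (Suc k) powr (-1 - x) \<le> (real k powr (-x) - real (Suc k) powr (-x)) / x"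
proof -
  have "\<exists>z>real k. z < real (Suc k) \<and> real (Suc k) powr (-x) - real k powr (-x) = (real (Suc k) - real k) * (-x * z powr (-x - 1))"
    by (rule MVT2) (use k in \<open>auto intro!: derivative_eq_intros\<close>)
  then obtain z where z: "z > real k" "z < real (Suc k)" "real k powr (-x) - real (Suc k) powr (-x) = x * z powr (-x - 1)"
    by auto
  have h: "real (Suc k) powr (-x - 1) \<le> z powr (-x - 1)"
    using z x k by (intro powr_mono2') auto
  have e: "-1 - x = -x - 1" by simp
  show ?thesis unfolding z(3) e using h x by simp
qed

text \<open>Comparison with the integral of \<open>u powr (x - 1)\<close>. For
  \<open>x \<ge> 1\<close> the summand increases and the telescoping sum does not cover its last
  value, which is the first summand of the bound.\<close>

lemma sum_powr_le:
  assumes x: "x > 0" and N: "N > 0"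
  shows "(\<Sum>n\<in>{1..N}. real n powr (x - 1)) \<le> real N powr (x - 1) + real N powr x / x"
proof -
  have st: "\<exists>z>real k. z < real (Suc k) \<and> real (Suc k) powr x - real k powr x = x * z powr (x - 1)" if "k > 0" for k :: nat
  proof -
    have "\<exists>z>real k. z < real (Suc k) \<and> real (Suc k) powr x - real k powr x = (real (Suc k) - real k) * (x * z powr (x - 1))"
      by (rule MVT2) (use that in \<open>auto intro!: derivative_eq_intros\<close>)
    thus ?thesis by auto
  qed
  show ?thesis
  proof (cases "x \<ge> 1")
    case True
    have s: "real k powr (x - 1) \<le> (real (Suc k) powr x - real k powr x) / x" for k
    proof (cases "k = 0")
      case False
      then obtain z where z: "z > real k" "real (Suc k) powr x - real k powr x = x * z powr (x - 1)" using st[of k] by auto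
      have "real k powr (x - 1) \<le> z powr (x - 1)" using z True by (intro powr_mono2) auto
      thus ?thesis using x unfolding z(2) by simp
    qed (use x in auto)
    obtain M where M: "N = Suc M" using N by (cases N) auto
    have "(\<Sum>n\<in>{1..N}. real n powr (x - 1)) = (\<Sum>n\<in>{1..M}. real n powr (x - 1)) + real N powr (x - 1)"
      unfolding M by simp
    also have "(\<Sum>n\<in>{1..M}. real n powr (x - 1)) \<le> (\<Sum>n\<le>M. (real (Suc n) powr x - real n powr x) / x)"
      by (rule order_trans[OF sum_mono[OF s] sum_mono2]) (use x in \<open>auto intro!: divide_nonneg_pos powr_mono2\<close>)
    also have "\<dots> = real N powr x / x"
      unfolding sum_divide_distrib[symmetric] M lessThan_Suc_atMost[symmetric]
      by (simp only: sum_lessThan_telescope[of "\<lambda>n. real n powr x"]) simp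
    finally show ?thesis by simp
  next
    case False
    have s: "real (Suc k) powr (x - 1) \<le> (real (Suc k) powr x - real k powr x) / x" for k
    proof (cases "k = 0")
      case False
      then obtain z where z: "z > real k" "z < real (Suc k)" "real (Suc k) powr x - real k powr x = x * z powr (x - 1)" using st[of k] by auto
      have "real (Suc k) powr (x - 1) \<le> z powr (x - 1)" using z False \<open>\<not> x \<ge> 1\<close> by (intro powr_mono2') auto
      thus ?thesis using x unfolding z(3) by simp
    next
      case True thus ?thesis using x \<open>\<not> x \<ge> 1\<close> by simp
    qed
    have "(\<Sum>n\<in>{1..N}. real n powr (x - 1)) = (\<Sum>k<N. real (Suc k) powr (x - 1))"
      by (rule sum.reindex_bij_witness[of _ Suc "\<lambda>n. n - 1"]) auto
    also have "\<dots> \<le> (\<Sum>k<N. (real (Suc k) powr x - real k powr x) / x)" by (rule sum_mono[OF s])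
    also have "\<dots> = real N powr x / x"
      unfolding sum_divide_distrib[symmetric] by (simp only: sum_lessThan_telescope[of "\<lambda>n. real n powr x"]) simp
    finally show ?thesis by (simp add: add_increasing)
  qed
qed

text \<open>On the circle \<open>z * cnj z = R^2\<close>, so the kernel equals
  \<open>2 * Re z / R^2\<close>. The factor \<open>Re z\<close> is what cancels the
  \<open>1 / Re z\<close> in the bounds for tails and partial sums.\<close>

lemma kernel_norm:
  assumes "norm z = R" "R > 0"
  shows "norm ((1 + z\<^sup>2 / of_real (R\<^sup>2)) / z) = 2 * \<bar>Re z\<bar> / R\<^sup>2"
proof -
  have z: "z \<noteq> 0" using assms by auto
  have "z * cnj z = of_real (R\<^sup>2)" using assms by (simp add: complex_norm_square[symmetric])
  hence "(1 + z\<^sup>2 / of_real (R\<^sup>2)) / z = (cnj z + z) / of_real (R\<^sup>2)"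
    using z assms by (simp add: field_simps power2_eq_square)
  also have "cnj z + z = of_real (2 * Re z)" by (simp add: complex_eq_iff)
  finally show ?thesis using assms by (simp add: norm_divide norm_mult flip: of_real_power)
qed

lemma part_circle_right:
  assumes "z \<in> path_image (part_circlepath 0 R (- pi / 2) (pi / 2))" "R > 0"
  shows "Re z \<ge> 0" "norm z = R"
proof -
  obtain x where x: "x \<in> closed_segment (- pi / 2) (pi / 2)" "z = of_real R * cis x"
    using assms(1) unfolding path_image_part_circlepath' by auto
  have "-pi/2 \<le> x" "x \<le> pi/2" using x(1) by (auto simp: closed_segment_eq_real_ivl split: if_splits)
  hence "cos x \<ge> 0" by (intro cos_ge_zero) auto
  thus "Re z \<ge> 0" "norm z = R" using x(2) assms(2) by (auto simp: norm_mult)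
qed

lemma part_circle_left:
  assumes "z \<in> path_image (part_circlepath 0 R (pi / 2) (3 * pi / 2))" "R > 0"
  shows "Re z \<le> 0" "norm z = R"
proof -
  obtain x where x: "x \<in> closed_segment (pi / 2) (3 * pi / 2)" "z = of_real R * cis x"
    using assms(1) unfolding path_image_part_circlepath' by auto
  have "pi/2 \<le> x" "x \<le> 3*pi/2" using x(1) by (auto simp: closed_segment_eq_real_ivl split: if_splits)
  hence "cos (x - pi) \<ge> 0" by (intro cos_ge_zero) auto
  hence "cos x \<le> 0" by (simp add: cos_diff)
  thus "Re z \<le> 0" "norm z = R" using x(2) assms(2) by (auto simp: norm_mult mult_nonneg_nonpos)
qed

lemma norm_eq_Re_zero:
  assumes "norm z = R" "Re z = 0" shows "z \<in> {\<i> * of_real R, - (\<i> * of_real R)}"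
proof -
  have "\<bar>Im z\<bar> = R" using assms by (simp add: cmod_def)
  thus ?thesis using assms(2) by (auto simp: complex_eq_iff abs_if split: if_splits)
qed

text \<open>Let \<open>P N\<close> be the partial sum shifted by 1. Then \<open>f (1 + z)\<close>
  and \<open>P N z\<close> are integrated against \<open>N powr z * (1 + z^2 / R^2) / z\<close>
  around 0. On the right arc their difference is a tail, and on the left arc \<open>P N\<close>
  alone remains; both contribute about \<open>C / R\<close>. The function \<open>f\<close> runs
  along a path in the left half-plane, where \<open>N powr z\<close> makes its part vanish as
  \<open>N\<close> grows with \<open>R\<close> fixed.\<close>

theorem newman:
  fixes b :: "nat \<Rightarrow> real" and f :: "complex \<Rightarrow> complex"
  assumes U: "open U" "\<And>s. Re s \<ge> 1 \<Longrightarrow> s \<in> U" and hol: "f holomorphic_on U"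
    and bC: "\<And>n. \<bar>b n\<bar> \<le> C"
    and sm: "\<And>s. Re s > 1 \<Longrightarrow> (\<lambda>n. of_real (b n) * of_nat n powr (-s)) sums f s"
  shows "(\<lambda>N. \<Sum>n\<in>{1..N}. of_real (b n) * of_nat n powr (-1)) \<longlonglongrightarrow> f 1"
proof -
  define P where "P = (\<lambda>N z. \<Sum>n\<in>{1..N}. complex_of_real (b n) * of_nat n powr (-(1 + z)))"
  have C0: "C \<ge> 0" using bC[of 0] by linarith
  have T1: "norm (f (1 + z) - P N z) \<le> C * (real N powr (- Re z) / Re z)" if z: "Re z > 0" and N: "N > 0" for N z
  proof -
    define x where "x = Re z"
    have x: "x > 0" using z by (simp add: x_def)
    define t where "t = (\<lambda>n. complex_of_real (b n) * of_nat n powr (-(1 + z)))"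
    have "t sums f (1 + z)" unfolding t_def by (rule sm) (use z in simp)
    from sums_split_initial_segment[OF this, of "Suc N"]
    have "(\<lambda>n. t (n + Suc N)) sums (f (1 + z) - (\<Sum>i<Suc N. t i))" .
    also have "(\<Sum>i<Suc N. t i) = P N z"
      unfolding P_def t_def by (rule sum.mono_neutral_cong_right) (auto simp: not_le)
    finally have 1: "(\<lambda>n. t (n + Suc N)) sums (f (1 + z) - P N z)" .
    have lim: "(\<lambda>n. real (n + N) powr (-x)) \<longlonglongrightarrow> 0" using x by real_asymp
    have "(\<lambda>n. C * ((real (n + N) powr (-x) - real (Suc n + N) powr (-x)) / x)) sums (C * ((real (0 + N) powr (-x) - 0) / x))"
      by (intro sums_mult sums_divide telescope_sums'[OF lim])
    moreover have "norm (t (n + Suc N)) \<le> C * ((real (n + N) powr (-x) - real (Suc n + N) powr (-x)) / x)" for n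
    proof -
      have "norm (t (n + Suc N)) = \<bar>b (n + Suc N)\<bar> * real (Suc (n + N)) powr (-1 - x)"
        unfolding t_def norm_mult norm_of_nat_powr by (simp add: x_def)
      also have "\<dots> \<le> C * ((real (n + N) powr (-x) - real (Suc (n + N)) powr (-x)) / x)"
        by (intro mult_mono bC powr_neg_Suc_le) (use x N C0 in auto)
      finally show ?thesis by simp
    qed
    ultimately have "norm (f (1 + z) - P N z) \<le> C * ((real (0 + N) powr (-x) - 0) / x)"
      using norm_sums_le[OF 1] by blast
    thus ?thesis by (simp add: x_def)
  qed
  have T2: "norm (P N z) \<le> C * (real N powr (x - 1) + real N powr x / x)"
    if z: "Re z = - x" "x > 0" and N: "N > 0" for N z x
  proof -
    have "norm (P N z) \<le> (\<Sum>n\<in>{1..N}. norm (complex_of_real (b n) * of_nat n powr (-(1 + z))))"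
      unfolding P_def by (rule norm_sum)
    also have "\<dots> \<le> (\<Sum>n\<in>{1..N}. C * real n powr (x - 1))"
    proof (rule sum_mono)
      fix n
      have "norm (complex_of_real (b n) * of_nat n powr (-(1 + z))) = \<bar>b n\<bar> * real n powr (x - 1)"
        unfolding norm_mult norm_of_nat_powr using z by simp
      also have "\<dots> \<le> C * real n powr (x - 1)" by (intro mult_right_mono bC) auto
      finally show "norm (complex_of_real (b n) * of_nat n powr (-(1 + z))) \<le> C * real n powr (x - 1)" .
    qed
    also have "\<dots> = C * (\<Sum>n\<in>{1..N}. real n powr (x - 1))" by (simp add: sum_distrib_left)
    also have "\<dots> \<le> C * (real N powr (x - 1) + real N powr x / x)"
      by (intro mult_left_mono sum_powr_le z N C0)
    finally show ?thesis .
  qed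
  have key: "\<exists>K. \<forall>N\<ge>2. norm (f 1 - P N 0) \<le> 2 * C / R + C / real N + K / ln (real N)" if R: "R \<ge> 1" for R
  proof -
    have R0: "R > 0" using R by simp
    have cpt: "compact ((\<lambda>y. 1 + \<i> * complex_of_real y) ` {-(R+1)..R+1})"
      by (intro compact_continuous_image continuous_intros) auto
    have KU: "(\<lambda>y. 1 + \<i> * complex_of_real y) ` {-(R+1)..R+1} \<subseteq> U"
      by (intro image_subsetI U(2)) simp
    \<comment> \<open>Holomorphy is known only on a neighbourhood of the closed half-plane;
      compactness of the segment gives a strip of uniform width \<open>e\<close> to its
      left.\<close>
    obtain e where e: "e > 0" "(\<Union>x\<in>(\<lambda>y. 1 + \<i> * complex_of_real y) ` {-(R+1)..R+1}. ball x e) \<subseteq> U"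
      by (rule compact_subset_open_imp_ball_epsilon_subset[OF cpt U(1) KU])
    define S where "S = {z. - e < Re z} \<inter> {z. - (R+1) < Im z} \<inter> {z. Im z < R + 1}"
    have S: "open S" "convex S" unfolding S_def
      by (intro open_Int open_halfspace_Re_gt open_halfspace_Im_gt open_halfspace_Im_lt)
         (intro convex_Int convex_halfspace_Re_gt convex_halfspace_Im_gt convex_halfspace_Im_lt)
    have S0: "0 \<in> S" using R e by (simp add: S_def)
    have SU: "1 + z \<in> U" if "z \<in> S" for z
    proof (cases "Re z \<ge> 0")
      case True thus ?thesis by (intro U(2)) simp
    next
      case False
      have "(1 + \<i> * of_real (Im z)) - (1 + z) = of_real (- Re z)" by (simp add: complex_eq_iff)
      hence "dist (1 + \<i> * of_real (Im z)) (1 + z) = \<bar>Re z\<bar>" unfolding dist_norm by (simp only: norm_of_real abs_minus_cancel)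
      hence "1 + z \<in> ball (1 + \<i> * complex_of_real (Im z)) e" using False that by (simp add: S_def)
      moreover have "Im z \<in> {-(R+1)..R+1}" using that by (simp add: S_def)
      ultimately show ?thesis using e(2) by blast
    qed
    define F where "F = (\<lambda>z. f (1 + z))"
    have F: "F holomorphic_on S" unfolding F_def
      by (rule holomorphic_on_compose[OF _ holomorphic_on_subset[OF hol], unfolded o_def])
         (use SU in \<open>auto intro!: holomorphic_intros\<close>)
    define d where "d = e / 2"
    have d: "d > 0" "d < e" using e by (simp_all add: d_def)
    define a where "a = \<i> * complex_of_real R"
    define b1 where "b1 = - complex_of_real d"
    have inS: "a \<in> S" "- a \<in> S" "b1 \<in> S" using R e d by (auto simp: S_def a_def b1_def)
    have seg: "closed_segment a b1 \<subseteq> S" "closed_segment (-a) b1 \<subseteq> S"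
      by (intro closed_segment_subset inS S(2))+
    have seg2: "Re z \<le> 0 \<and> z \<noteq> 0" if zz: "z \<in> closed_segment a b1 \<union> closed_segment (-a) b1" for z
    proof -
      have "\<exists>u. 0 \<le> u \<and> u \<le> 1 \<and> (z = (1 - u) *\<^sub>R a + u *\<^sub>R b1 \<or> z = (1 - u) *\<^sub>R (-a) + u *\<^sub>R b1)"
        using zz unfolding Un_iff in_segment by blast
      then obtain u where u0: "0 \<le> u" "u \<le> 1" "z = (1 - u) *\<^sub>R a + u *\<^sub>R b1 \<or> z = (1 - u) *\<^sub>R (-a) + u *\<^sub>R b1"
        by blast
      have u: "Re z = - (u * d)" "Im z = (1 - u) * R \<or> Im z = - ((1 - u) * R)"
        using u0(3) by (auto simp: a_def b1_def)
      have "z \<noteq> 0"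
      proof
        assume "z = 0"
        hence "u = 0" "u = 1" using u d R0 by auto
        thus False by simp
      qed
      thus ?thesis using u u0 d by simp
    qed
    define q where "q = (\<lambda>z. F z * ((1 + z\<^sup>2 / of_real (R\<^sup>2)) / z))"
    have qc: "continuous_on (closed_segment a b1 \<union> closed_segment (-a) b1) q"
      unfolding q_def using seg seg2
      by (intro continuous_intros holomorphic_on_imp_continuous_on[OF holomorphic_on_subset[OF F]]) (use R0 in auto)
    have "compact (q ` (closed_segment a b1 \<union> closed_segment (-a) b1))"
      by (intro compact_continuous_image qc compact_Un compact_segment)
    hence "bounded (q ` (closed_segment a b1 \<union> closed_segment (-a) b1))" by (rule compact_imp_bounded)
    then obtain M where M0: "\<forall>x\<in>q ` (closed_segment a b1 \<union> closed_segment (-a) b1). norm x \<le> M"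
      unfolding bounded_iff by (rule exE)
    have M: "norm (q z) \<le> M" if "z \<in> closed_segment a b1 \<union> closed_segment (-a) b1" for z
      by (rule bspec[OF M0 imageI[OF that]])
    define A where "A = part_circlepath 0 R (- pi / 2) (pi / 2)"
    define A' where "A' = part_circlepath 0 R (pi / 2) (3 * pi / 2)"
    \<comment> \<open>The left path for \<open>f\<close>: from \<open>a\<close> through the real
      point \<open>- d\<close> to \<open>- a\<close>, inside the strip.\<close>
    define B where "B = linepath a b1 +++ linepath b1 (-a)"
    have cis: "cis (pi / 2) = \<i>" "cis (- pi / 2) = - \<i>" "cis (3 * pi / 2) = - \<i>"
    proof -
      show "cis (pi / 2) = \<i>" by simp
      show "cis (- pi / 2) = - \<i>" by (simp add: complex_eq_iff)
      have "3 * pi / 2 = pi + pi / 2" by simp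
      thus "cis (3 * pi / 2) = - \<i>" by (simp only: cis_mult[symmetric]) simp
    qed
    have ends: "pathstart A = - (\<i> * of_real R)" "pathfinish A = \<i> * of_real R"
      "pathstart A' = \<i> * of_real R" "pathfinish A' = - (\<i> * of_real R)"
      "pathstart B = \<i> * of_real R" "pathfinish B = - (\<i> * of_real R)"
      unfolding A_def A'_def B_def a_def
      by (simp_all only: pathstart_part_circlepath pathfinish_part_circlepath cis_conv_exp[symmetric] cis
            pathstart_join pathfinish_join pathstart_linepath pathfinish_linepath) simp_all
    have AS: "path_image A \<subseteq> S"
    proof
      fix z assume "z \<in> path_image A"
      hence "Re z \<ge> 0" "norm z = R" using part_circle_right R0 unfolding A_def by auto
      thus "z \<in> S" using abs_Im_le_cmod[of z] e by (auto simp: S_def)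
    qed
    have Ap: "Re z \<ge> 0 \<and> z \<noteq> 0" if "z \<in> path_image A" for z
      using part_circle_right[of z R] that R0 unfolding A_def by auto
    have A'p: "Re z \<le> 0 \<and> z \<noteq> 0" if "z \<in> path_image A'" for z
      using part_circle_left[of z R] that R0 unfolding A'_def by auto
    have pB: "path_image B = closed_segment a b1 \<union> closed_segment (-a) b1"
      unfolding B_def by (subst path_image_join) (auto simp: closed_segment_commute)
    have vp: "valid_path A" "valid_path A'" "valid_path B"
      unfolding A_def A'_def B_def by (auto intro!: valid_path_join)
    have BS: "path_image B \<subseteq> S" unfolding pB using seg by blast
    have Bp: "Re z \<le> 0 \<and> z \<noteq> 0" if "z \<in> path_image B" for z
      using seg2 that unfolding pB .
    have main: "norm (f 1 - P N 0) \<le> 2 * C / R + C / real N + (M * norm (b1 - a) + M * norm (b1 + a)) / (2 * pi * d) / ln (real N)"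
      if N: "N \<ge> 2" for N
    proof -
      define l where "l = ln (real N)"
      have l: "l > 0" using N by (simp add: l_def)
      define w where "w = (\<lambda>z::complex. exp (of_real l * z) * (1 + z\<^sup>2 / of_real (R\<^sup>2)))"
      have nw: "norm (w z / z) = real N powr (Re z) * (2 * \<bar>Re z\<bar> / R\<^sup>2)" if "norm z = R" for z
      proof -
        have "w z / z = exp (of_real l * z) * ((1 + z\<^sup>2 / of_real (R\<^sup>2)) / z)" by (simp add: w_def)
        also have "norm \<dots> = exp (l * Re z) * (2 * \<bar>Re z\<bar> / R\<^sup>2)"
          unfolding norm_mult kernel_norm[OF that R0] by simp
        finally show ?thesis using N by (simp add: powr_def l_def mult.commute)
      qed
      have "(\<lambda>z. F z * w z) holomorphic_on S" unfolding w_def using R0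
        by (intro holomorphic_intros F) auto
      then obtain I1 J1 where I1: "((\<lambda>z. F z * w z / z) has_contour_integral I1) A"
          "((\<lambda>z. F z * w z / z) has_contour_integral J1) B" "I1 + J1 = 2 * of_real pi * \<i> * (F 0 * w 0)"
        by (rule half_plane_contours[OF S S0 _ vp(1) AS Ap ends(1,2) vp(3) BS Bp ends(5,6) R0])
      \<comment> \<open>The partial sum is entire, so its left path may be the whole semicircle,
        where \<open>T2\<close> and the kernel control it.\<close>
      have "(\<lambda>z. P N z * w z) holomorphic_on UNIV" unfolding w_def P_def using R0
        by (intro holomorphic_intros) auto
      then obtain I2 J2 where I2: "((\<lambda>z. P N z * w z / z) has_contour_integral I2) A"
          "((\<lambda>z. P N z * w z / z) has_contour_integral J2) A'" "I2 + J2 = 2 * of_real pi * \<i> * (P N 0 * w 0)"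
        by (rule half_plane_contours[OF open_UNIV convex_UNIV UNIV_I _ vp(1) subset_UNIV Ap ends(1,2) vp(2) subset_UNIV A'p ends(3,4) R0])
      have w0: "w 0 = 1" by (simp add: w_def)
      have "norm (I1 - I2) \<le> 2 * C / R\<^sup>2 * R * (pi / 2 - (- pi / 2))"
      proof (rule has_contour_integral_bound_part_circlepath_strong[OF has_contour_integral_diff[OF I1(1) I2(1), unfolded A_def], where k = "{\<i> * of_real R, - (\<i> * of_real R)}"])
        fix z assume z: "z \<in> path_image (part_circlepath 0 R (- pi / 2) (pi / 2)) - {\<i> * of_real R, - (\<i> * of_real R)}"
        have z1: "Re z \<ge> 0" "norm z = R" using part_circle_right[of z R] z R0 by auto
        with norm_eq_Re_zero[of z R] z have z2: "Re z > 0" by force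
        have "norm (F z * w z / z - P N z * w z / z) = norm (f (1 + z) - P N z) * norm (w z / z)"
          unfolding norm_mult[symmetric] by (simp add: F_def algebra_simps diff_divide_distrib)
        also have "\<dots> \<le> C * (real N powr (- Re z) / Re z) * (real N powr (Re z) * (2 * \<bar>Re z\<bar> / R\<^sup>2))"
          unfolding nw[OF z1(2)] by (intro mult_right_mono T1) (use z2 N in auto)
        also have "\<dots> = 2 * C / R\<^sup>2" using z2 N by (simp add: powr_minus field_simps)
        finally show "norm (F z * w z / z - P N z * w z / z) \<le> 2 * C / R\<^sup>2" .
      qed (use C0 R0 in auto)
      also have "\<dots> = 2 * pi * (C / R)" using R0 by (simp add: power2_eq_square)
      finally have b1': "norm (I1 - I2) \<le> 2 * pi * (C / R)" .
      have "norm J2 \<le> 2 * C * (R / real N + 1) / R\<^sup>2 * R * (3 * pi / 2 - pi / 2)"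
      proof (rule has_contour_integral_bound_part_circlepath_strong[OF I2(2)[unfolded A'_def], where k = "{\<i> * of_real R, - (\<i> * of_real R)}"])
        fix z assume z: "z \<in> path_image (part_circlepath 0 R (pi / 2) (3 * pi / 2)) - {\<i> * of_real R, - (\<i> * of_real R)}"
        define x where "x = - Re z"
        have z1: "Re z \<le> 0" "norm z = R" using part_circle_left[of z R] z R0 by auto
        with norm_eq_Re_zero[of z R] z have x: "x > 0" unfolding x_def by force
        have xR: "x \<le> R" using abs_Re_le_cmod[of z] z1 by (simp add: x_def)
        have "norm (P N z * w z / z) = norm (P N z) * norm (w z / z)"
          by (simp add: norm_mult norm_divide)
        also have "\<dots> \<le> C * (real N powr (x - 1) + real N powr x / x) * (real N powr (-x) * (2 * x / R\<^sup>2))"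
        proof -
          have "Re z = - x" "\<bar>Re z\<bar> = x" using x by (simp_all add: x_def)
          hence nw': "norm (w z / z) = real N powr (-x) * (2 * x / R\<^sup>2)" using nw[OF z1(2)] by simp
          show ?thesis unfolding nw' by (intro mult_right_mono T2) (use x N \<open>Re z = - x\<close> in auto)
        qed
        also have "\<dots> = 2 * C * (x / real N + 1) / R\<^sup>2"
        proof -
          have "p * (C * (p' / n + p' / x) * (1 / p' * (2 * x / R\<^sup>2))) = p * (2 * C * (x / n + 1) / R\<^sup>2)"
            if "p' \<noteq> 0" "n \<noteq> 0" for p p' n :: real
            using that x R0 by (simp add: field_simps)
          from this[of "real N powr x" "real N" 1] show ?thesis using N
            by (simp add: powr_minus powr_diff inverse_eq_divide)
        qed
        also have "\<dots> \<le> 2 * C * (R / real N + 1) / R\<^sup>2"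
          by (intro divide_right_mono mult_left_mono add_right_mono) (use xR C0 in auto)
        finally show "norm (P N z * w z / z) \<le> 2 * C * (R / real N + 1) / R\<^sup>2" .
      qed (use C0 R0 in auto)
      also have "\<dots> = 2 * pi * (C / real N + C / R)" using R0 N by (simp add: power2_eq_square field_simps)
      finally have b2': "norm J2 \<le> 2 * pi * (C / real N + C / R)" .
      have fq: "F z * w z / z = q z * exp (of_real l * z)" for z by (simp add: q_def w_def)
      have cl: "continuous_on (closed_segment a b1) (\<lambda>z. q z * exp (of_real l * z))"
        "continuous_on (closed_segment (-a) b1) (\<lambda>z. q z * exp (of_real l * z))"
        by (intro continuous_intros continuous_on_subset[OF qc]; simp)+
      obtain j1 where j1: "((\<lambda>z. q z * exp (of_real l * z)) has_contour_integral j1) (linepath a b1)"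
        using contour_integrable_continuous_linepath[OF cl(1)] by (auto simp: contour_integrable_on_def)
      obtain j2 where j2: "((\<lambda>z. q z * exp (of_real l * z)) has_contour_integral j2) (linepath (-a) b1)"
        using contour_integrable_continuous_linepath[OF cl(2)] by (auto simp: contour_integrable_on_def)
      have "((\<lambda>z. q z * exp (of_real l * z)) has_contour_integral (j1 + - j2)) B"
        unfolding B_def using has_contour_integral_reversepath[OF _ j2] j1
        by (intro has_contour_integral_join) auto
      hence J1: "J1 = j1 - j2" using has_contour_integral_unique[OF I1(2)] by (simp add: fq)
      have "norm j1 \<le> M * norm (b1 - a) / (l * d)"
        by (rule decaying_line_integral[OF j1]) (use M d l in \<open>auto simp: a_def b1_def\<close>)
      moreover have "norm j2 \<le> M * norm (b1 - (- a)) / (l * d)"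
        by (rule decaying_line_integral[OF j2]) (use M d l in \<open>auto simp: a_def b1_def\<close>)
      ultimately have b3': "norm J1 \<le> M * norm (b1 - a) / (l * d) + M * norm (b1 + a) / (l * d)"
        using norm_triangle_ineq4[of j1 j2] unfolding J1 by simp
      \<comment> \<open>Both closed contours share the right arc, so only the difference of the
        integrals enters there.\<close>
      have "2 * of_real pi * \<i> * (f 1 - P N 0) = (I1 - I2) - J2 + J1"
        using I1(3) I2(3) by (simp add: w0 F_def algebra_simps)
      hence "2 * pi * norm (f 1 - P N 0) = norm ((I1 - I2) - J2 + J1)"
        by (metis (no_types, lifting) norm_mult norm_ii norm_numeral norm_of_real abs_of_pos pi_gt_zero mult.right_neutral)
      also have "\<dots> \<le> norm (I1 - I2) + norm J2 + norm J1"
        using norm_triangle_ineq[of "(I1 - I2) - J2" J1] norm_triangle_ineq4[of "I1 - I2" J2] by linarith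
      also have "\<dots> \<le> 2 * pi * (C / R) + 2 * pi * (C / real N + C / R) + (M * norm (b1 - a) / (l * d) + M * norm (b1 + a) / (l * d))"
        using b1' b2' b3' by linarith
      also have "\<dots> = 2 * pi * (2 * C / R + C / real N + (M * norm (b1 - a) + M * norm (b1 + a)) / (2 * pi * d) / l)"
        using d l by (simp add: field_simps)
      finally show ?thesis unfolding l_def by simp
    qed
    thus ?thesis by blast
  qed
  have "(\<lambda>N. P N 0) \<longlonglongrightarrow> f 1"
  proof (rule tendstoI)
    fix e :: real assume e: "e > 0"
    \<comment> \<open>This gives \<open>2 * C / R < e / 2\<close>, and the summand 1 ensures
      \<open>R \<ge> 1\<close> also for \<open>C = 0\<close>.\<close>
    define R where "R = 4 * C / e + 1"
    have R: "R \<ge> 1" using C0 e by (simp add: R_def)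
    obtain K where K: "\<And>N. N \<ge> 2 \<Longrightarrow> norm (f 1 - P N 0) \<le> 2 * C / R + C / real N + K / ln (real N)"
      using key[OF R] by blast
    have cR: "2 * C / R < e / 2" using C0 e by (simp add: R_def field_simps)
    have "(\<lambda>N. C / real N + K / ln (real N)) \<longlonglongrightarrow> 0" by real_asymp
    hence "eventually (\<lambda>N. C / real N + K / ln (real N) < e / 2) sequentially"
      using e by (intro order_tendstoD) auto
    thus "eventually (\<lambda>N. dist (P N 0) (f 1) < e) sequentially"
      using eventually_ge_at_top[of 2]
    proof eventually_elim
      case (elim N)
      hence "norm (f 1 - P N 0) < e" using K[of N] cR by linarith
      thus ?case by (simp add: dist_norm norm_minus_commute)
    qed
  qed
  thus ?thesis by (simp add: P_def)
qed

section \<open>The prime number theorem for \<open>psi\<close> and \<open>theta\<close>\<close>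

definition psi_err :: "nat \<Rightarrow> real" where "psi_err n = psi n - real n"

lemma psi_err_0 [simp]: "psi_err 0 = 0" by (simp add: psi_err_def psi_def)

lemma psi_err_bound: "\<bar>psi_err n\<bar> \<le> (2 * ln 4 + 1) * real n"
  using psi_le[of n] psi_nonneg[of n] by (simp add: psi_err_def abs_le_iff algebra_simps)

text \<open>The error in a summation by parts when \<open>n powr (-s) - (n + 1) powr (-s)\<close> is
  replaced by its linear approximation \<open>s * n powr (-s - 1)\<close>. The second order bound on
  the bracket makes up for the linear growth of \<open>psi_err\<close>, so the series is holomorphic
  for \<open>Re s > 0\<close>.\<close>

definition psi_E :: "complex \<Rightarrow> complex" where
  "psi_E s = (\<Sum>n. of_real (psi_err n) * (of_nat (Suc n) powr (-s) - of_nat n powr (-s) + s * of_nat n powr (-s - 1)))"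

lemma psi_E_holomorphic: "psi_E holomorphic_on {s. Re s > 0}"
  and psi_E_summable: "Re s > 0 \<Longrightarrow> summable (\<lambda>n. complex_of_real (psi_err n) * (of_nat (Suc n) powr (-s) - of_nat n powr (-s) + s * of_nat n powr (-s - 1)))"
proof -
  have bd: "\<exists>d>0. \<exists>M. summable M \<and>
              (\<forall>n. \<forall>y\<in>ball x d \<inter> {s. 0 < Re s}.
                  cmod (complex_of_real (psi_err n) * (of_nat (Suc n) powr (-y) - of_nat n powr (-y) + y * of_nat n powr (-y - 1))) \<le> M n)"
    if x: "x \<in> {s. 0 < Re s}" for x
  proof -
    define d where "d = Re x / 2"
    define C where "C = (2 * ln 4 + 1) * ((norm x + d) * (norm x + d + 1))"
    have d: "d > 0" using x by (simp add: d_def)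
    have C: "C \<ge> 0" using d by (simp add: C_def)
    have "summable (\<lambda>n. C * real n powr (- d - 1))"
      by (intro summable_mult) (use d in \<open>auto simp: summable_real_powr_iff\<close>)
    moreover have "cmod (complex_of_real (psi_err n) * (of_nat (Suc n) powr (-y) - of_nat n powr (-y) + y * of_nat n powr (-y - 1)))
       \<le> C * real n powr (- d - 1)" if y: "y \<in> ball x d \<inter> {s. 0 < Re s}" for n y
    proof (cases "n = 0")
      case False
      have y': "Re y > d" "norm y < norm x + d" using ball_Re_bounds[of y x d] y by (auto simp: d_def)
      have "of_nat (Suc n) powr (-y) - of_nat n powr (-y) + y * of_nat n powr (-y - 1)
          = of_nat (Suc n) powr (-y) - of_nat n powr (-y) - (-y) * of_nat n powr (-y - 1)" by simp
      also have "norm \<dots> \<le> norm (-y) * norm (-y - 1) * real n powr (Re (-y) - 2)"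
        by (rule powr_Suc_taylor) (use False y in auto)
      also have "\<dots> \<le> (norm x + d) * (norm x + d + 1) * real n powr (- d - 2)"
      proof (intro mult_mono)
        show "norm (-y - 1) \<le> norm x + d + 1" using norm_triangle_ineq4[of "-y" 1] y' by simp
        show "real n powr (Re (-y) - 2) \<le> real n powr (- d - 2)"
          using y' False by (auto intro!: powr_mono)
      qed (use y' d in auto)
      finally have "cmod (complex_of_real (psi_err n) * (of_nat (Suc n) powr (-y) - of_nat n powr (-y) + y * of_nat n powr (-y - 1)))
         \<le> ((2 * ln 4 + 1) * real n) * ((norm x + d) * (norm x + d + 1) * real n powr (- d - 2))"
        unfolding norm_mult by (intro mult_mono) (use psi_err_bound in auto)
      also have "\<dots> = C * (real n * real n powr (- d - 2))" by (simp add: C_def)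
      also have "real n * real n powr (- d - 2) = real n powr (1 + (- d - 2))"
        using False by (subst powr_add) simp
      also have "1 + (- d - 2) = - d - 1" by simp
      finally show ?thesis .
    qed simp
    ultimately show ?thesis using d by blast
  qed
  note * = holomorphic_series_comparison[OF open_Re_gt[of 0] _ bd]
  show "psi_E holomorphic_on {s. Re s > 0}" unfolding psi_E_def
    by (rule *(1)) (auto intro!: holomorphic_intros)
  show "Re s > 0 \<Longrightarrow> summable (\<lambda>n. complex_of_real (psi_err n) * (of_nat (Suc n) powr (-s) - of_nat n powr (-s) + s * of_nat n powr (-s - 1)))"
    by (rule *(2)) (auto intro!: holomorphic_intros)
qed

lemma psi_err_Suc: "psi_err (Suc n) = psi_err n + (mangoldt (Suc n) - 1)"
  by (simp add: psi_err_def psi_def)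

text \<open>Summation by parts turns the series with coefficients \<open>mangoldt n - 1\<close>,
  which is \<open>log_deriv_reg\<close>, into one with coefficients \<open>psi_err n\<close>.
  Dividing by \<open>s\<close> leaves the coefficients \<open>psi_err n / n\<close>, which are
  bounded by Chebyshev's estimate, as the Tauberian theorem requires.\<close>

lemma psi_err_dirichlet:
  assumes s: "Re s > 1"
  shows "(\<lambda>n. of_real (psi_err n / real n) * of_nat n powr (-s)) sums ((log_deriv_reg s + psi_E s) / s)"
proof -
  have s0: "s \<noteq> 0" using s by auto
  define C where "C = 2 * ln (4::real) + 1"
  define f where "f = (\<lambda>n. complex_of_real (psi_err n) * of_nat n powr (-s))"
  have "f \<longlonglongrightarrow> 0"
  proof (rule Lim_null_comparison)
    show "eventually (\<lambda>n. norm (f n) \<le> C * real n powr (1 - Re s)) sequentially"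
      using eventually_gt_at_top[of 0]
    proof eventually_elim
      case (elim n)
      have "norm (f n) \<le> (C * real n) * real n powr (- Re s)"
        unfolding f_def norm_mult norm_of_nat_powr C_def using psi_err_bound[of n]
        by (intro mult_mono) auto
      also have "\<dots> = C * real n powr (1 - Re s)" using elim by (simp add: powr_diff powr_minus field_simps)
      finally show ?case .
    qed
    show "(\<lambda>n. C * real n powr (1 - Re s)) \<longlonglongrightarrow> 0" using s by real_asymp
  qed
  from telescope_sums'[OF this]
  have 1: "(\<lambda>n. f n - f (Suc n)) sums 0" by (simp add: f_def)
  have "(\<lambda>n. mangoldt n * of_nat n powr (-s) - of_nat n powr (-s)) sums (mangoldt_series s - czeta s)"
    unfolding mangoldt_series_def czeta_def
    by (intro sums_diff summable_sums summable_norm_cancel[OF mangoldt_series_abs_summable] summable_norm_cancel[OF czeta_abs_summable] s)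
  hence "(\<lambda>n. mangoldt n * of_nat n powr (-s) - of_nat n powr (-s)) sums log_deriv_reg s" using log_deriv_reg_eq[OF s] by simp
  hence 2: "(\<lambda>n. mangoldt (Suc n) * of_nat (Suc n) powr (-s) - of_nat (Suc n) powr (-s)) sums log_deriv_reg s"
    by (subst sums_Suc_iff) simp
  have "(\<lambda>n. complex_of_real (psi_err n) * (of_nat (Suc n) powr (-s) - of_nat n powr (-s) + s * of_nat n powr (-s - 1))) sums psi_E s"
    unfolding psi_E_def by (rule summable_sums[OF psi_E_summable]) (use s in simp)
  from sums_add[OF sums_add[OF 1 2] this]
  have "(\<lambda>n. f n - f (Suc n) + (mangoldt (Suc n) * of_nat (Suc n) powr (-s) - of_nat (Suc n) powr (-s)) +
     complex_of_real (psi_err n) * (of_nat (Suc n) powr (-s) - of_nat n powr (-s) + s * of_nat n powr (-s - 1))) sums (log_deriv_reg s + psi_E s)"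
    by simp
  also have "(\<lambda>n. f n - f (Suc n) + (mangoldt (Suc n) * of_nat (Suc n) powr (-s) - of_nat (Suc n) powr (-s)) +
     complex_of_real (psi_err n) * (of_nat (Suc n) powr (-s) - of_nat n powr (-s) + s * of_nat n powr (-s - 1)))
     = (\<lambda>n. s * (complex_of_real (psi_err n) * of_nat n powr (-s - 1)))"
  proof
    fix n
    have "complex_of_real (psi_err (Suc n)) = complex_of_real (psi_err n) + (mangoldt (Suc n) - 1)"
      unfolding psi_err_Suc by simp
    thus "f n - f (Suc n) + (mangoldt (Suc n) * of_nat (Suc n) powr (-s) - of_nat (Suc n) powr (-s)) +
       complex_of_real (psi_err n) * (of_nat (Suc n) powr (-s) - of_nat n powr (-s) + s * of_nat n powr (-s - 1))
       = s * (complex_of_real (psi_err n) * of_nat n powr (-s - 1))"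
      unfolding f_def by (simp only:) (simp add: algebra_simps del: of_nat_Suc)
  qed
  finally have "(\<lambda>n. s * (complex_of_real (psi_err n) * of_nat n powr (-s - 1)) / s) sums ((log_deriv_reg s + psi_E s) / s)"
    by (rule sums_divide)
  moreover have "s * (complex_of_real (psi_err n) * of_nat n powr (-s - 1)) / s = of_real (psi_err n / real n) * of_nat n powr (-s)" for n
  proof (cases "n = 0")
    case False
    have "complex_of_nat n powr (-s - 1) = of_nat n powr (-s) / of_nat n"
      using False by (simp add: powr_diff)
    thus ?thesis using s0 by simp
  qed simp
  ultimately show ?thesis by simp
qed

lemma psi_err_series: "convergent (\<lambda>N. \<Sum>n\<in>{1..N}. psi_err n / real n ^ 2)"
proof -
  define b where "b = (\<lambda>n. psi_err n / real n)"
  define f where "f = (\<lambda>s. (log_deriv_reg s + psi_E s) / s)"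
  have "(\<lambda>N. \<Sum>n\<in>{1..N}. complex_of_real (b n) * of_nat n powr (-1)) \<longlonglongrightarrow> f 1"
  proof (rule newman[OF open_zeta_reg])
    show "s \<in> {s. Re s > 0 \<and> zeta_reg s \<noteq> 0}" if "Re s \<ge> 1" for s using that zeta_reg_nonzero[of s] by auto
    show "f holomorphic_on {s. 0 < Re s \<and> zeta_reg s \<noteq> 0}" unfolding f_def
      by (intro holomorphic_intros log_deriv_reg_holomorphic holomorphic_on_subset[OF psi_E_holomorphic]) auto
    show "\<bar>b n\<bar> \<le> 2 * ln 4 + 1" for n
      using psi_err_bound[of n] by (cases "n = 0") (auto simp: b_def field_simps)
    show "(\<lambda>n. complex_of_real (b n) * complex_of_nat n powr - s) sums f s" if "Re s > 1" for s
      using psi_err_dirichlet[OF that] unfolding b_def f_def .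
  qed
  from tendsto_Re[OF this]
  have "(\<lambda>N. \<Sum>n\<in>{1..N}. Re (complex_of_real (b n) * of_nat n powr (-1))) \<longlonglongrightarrow> Re (f 1)"
    by (simp only: Re_sum)
  moreover have "Re (complex_of_real (b n) * of_nat n powr (-1)) = psi_err n / real n ^ 2" for n
  proof -
    have "(of_nat n :: complex) powr (-1) = of_real (1 / real n)"
      by (cases "n = 0") (auto simp: powr_minus inverse_eq_divide)
    thus ?thesis by (simp only: of_real_mult[symmetric] Re_complex_of_real) (simp add: b_def power2_eq_square)
  qed
  ultimately show ?thesis by (simp add: convergent_def) blast
qed

text \<open>If \<open>psi N\<close> were at least \<open>(1 + 2 * \<eta>) * N\<close>, monotonicity
  would keep \<open>psi_err\<close> above \<open>\<eta> * N\<close> on a window of at least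
  \<open>\<eta> * N / 2\<close> integers after \<open>N\<close>. Each summand there is at least
  \<open>\<eta> / (4 * N)\<close>, so the window would carry \<open>\<eta>^2 / 8\<close>, against
  the Cauchy property of the convergent series. A value that is too small is excluded by a window
  before \<open>N\<close>.\<close>

theorem psi_asymp: "(\<lambda>n. psi n / real n) \<longlonglongrightarrow> 1"
proof (rule LIMSEQ_I)
  fix r :: real assume r: "r > 0"
  define \<eta> where "\<eta> = min (r / 4) (1 / 4)"
  have \<eta>: "\<eta> > 0" "\<eta> \<le> 1/4" "2 * \<eta> < r" using r by (auto simp: \<eta>_def)
  define c where "c = (\<lambda>n. psi_err n / real n ^ 2)"
  have "Cauchy (\<lambda>N. \<Sum>n\<in>{1..N}. c n)"
    using psi_err_series unfolding c_def by (rule convergent_Cauchy)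
  then obtain N0 where N0: "\<And>m n. m \<ge> N0 \<Longrightarrow> n \<ge> N0 \<Longrightarrow> \<bar>(\<Sum>n\<in>{1..m}. c n) - (\<Sum>n\<in>{1..n}. c n)\<bar> < \<eta>\<^sup>2 / 8"
    using \<eta> unfolding Cauchy_def dist_real_def by (metis zero_less_divide_iff zero_less_power zero_less_numeral)
  have win: "\<bar>\<Sum>n\<in>{m<..n}. c n\<bar> < \<eta>\<^sup>2 / 8" if "m \<ge> N0" "m \<le> n" for m n
  proof -
    have "(\<Sum>n\<in>{1..n}. c n) = (\<Sum>n\<in>{1..m}. c n) + (\<Sum>n\<in>{m<..n}. c n)"
      using that(2) by (subst sum.union_disjoint[symmetric]) (auto intro!: sum.cong)
    thus ?thesis using N0[of n m] that by simp
  qed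
  define N1 where "N1 = max (2 * N0) (nat \<lceil>2 / \<eta>\<rceil> + 1)"
  have "norm (psi N / real N - 1) < r" if N: "N \<ge> N1" for N
  proof -
    have N': "N \<ge> 2 * N0" "N > 0" "\<eta> * real N \<ge> 2"
    proof -
      show "N \<ge> 2 * N0" "N > 0" using N by (auto simp: N1_def)
      have "real N \<ge> 2 / \<eta>" using N unfolding N1_def by linarith
      thus "\<eta> * real N \<ge> 2" using \<eta> by (simp add: field_simps)
    qed
    define k where "k = nat \<lfloor>\<eta> * real N\<rfloor>"
    have k: "real k \<le> \<eta> * real N" "real k \<ge> \<eta> * real N / 2"
      unfolding k_def using N' by linarith+
    have kN: "2 * k \<le> N" using k(1) \<eta> mult_right_mono[of \<eta> "1/4" "real N"] by linarith
    have up: "psi N < (1 + 2 * \<eta>) * real N"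
    proof (rule ccontr)
      assume "\<not> ?thesis"
      hence a: "psi N \<ge> (1 + 2 * \<eta>) * real N" by simp
      have "real k * (\<eta> / (4 * real N)) = (\<Sum>n\<in>{N<..N+k}. \<eta> / (4 * real N))" by simp
      also have "\<dots> \<le> (\<Sum>n\<in>{N<..N+k}. c n)"
      proof (rule sum_mono)
        fix n assume n: "n \<in> {N<..N+k}"
        have "psi n \<ge> (1 + 2 * \<eta>) * real N" using a psi_mono[of N n] n by auto
        moreover have "real n \<le> (1 + \<eta>) * real N" using n k(1) by (auto simp: algebra_simps)
        ultimately have e: "psi_err n \<ge> \<eta> * real N" unfolding psi_err_def by (simp add: algebra_simps)
        have "real n ^ 2 \<le> (2 * real N) ^ 2" using n kN by (intro power_mono) auto
        hence "\<eta> * real N / (2 * real N) ^ 2 \<le> \<eta> * real N / real n ^ 2"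
          by (intro divide_left_mono) (use N' \<eta> n in auto)
        moreover have "\<eta> / (4 * real N) = \<eta> * real N / (2 * real N) ^ 2"
          using N' by (simp add: power2_eq_square)
        moreover have "\<eta> * real N / real n ^ 2 \<le> c n" unfolding c_def using e by (intro divide_right_mono) auto
        ultimately show "\<eta> / (4 * real N) \<le> c n" by linarith
      qed
      also have "\<dots> < \<eta>\<^sup>2 / 8" using win[of N "N + k"] N' by auto
      finally have "real k * \<eta> < \<eta>\<^sup>2 / 2 * real N" using N' by (simp add: field_simps)
      moreover have "real k * \<eta> \<ge> \<eta> * real N / 2 * \<eta>" using k(2) \<eta> by (intro mult_right_mono) auto
      ultimately show False by (simp add: power2_eq_square mult_ac)
    qed
    have lo: "psi N > (1 - 2 * \<eta>) * real N"
    proof (rule ccontr)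
      assume "\<not> ?thesis"
      hence a: "psi N \<le> (1 - 2 * \<eta>) * real N" by simp
      have "(\<Sum>n\<in>{N-k<..N}. c n) \<le> (\<Sum>n\<in>{N-k<..N}. - \<eta> / real N)"
      proof (rule sum_mono)
        fix n assume n: "n \<in> {N-k<..N}"
        have n0: "n > 0" using n by auto
        have "psi n \<le> (1 - 2 * \<eta>) * real N" using a psi_mono[of n N] n by auto
        moreover have "real n \<ge> (1 - \<eta>) * real N" using n k(1) kN by (auto simp: algebra_simps)
        ultimately have e: "psi_err n \<le> - \<eta> * real N" unfolding psi_err_def by (simp add: algebra_simps)
        have "c n \<le> - \<eta> * real N / real n ^ 2" unfolding c_def using e by (intro divide_right_mono) auto
        also have "\<dots> = - (\<eta> * real N / real n ^ 2)" by simp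
        also have "\<dots> \<le> - (\<eta> * real N / real N ^ 2)"
          using n n0 N' \<eta> by (auto intro!: divide_left_mono power_mono)
        also have "\<dots> = - \<eta> / real N" using N' by (simp add: power2_eq_square)
        finally show "c n \<le> - \<eta> / real N" .
      qed
      also have "\<dots> = real k * (- \<eta> / real N)" using kN by simp
      finally have "real k * (\<eta> / real N) \<le> - (\<Sum>n\<in>{N-k<..N}. c n)" by simp
      also have "\<dots> < \<eta>\<^sup>2 / 8"
      proof -
        have "N0 \<le> N - k" using N' kN by linarith
        from win[OF this, of N] show ?thesis by (simp add: abs_less_iff)
      qed
      finally have "real k * \<eta> < \<eta>\<^sup>2 / 8 * real N" using N' by (simp add: field_simps)
      moreover have "real k * \<eta> \<ge> \<eta> * real N / 2 * \<eta>" using k(2) \<eta> by (intro mult_right_mono) auto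
      moreover have "\<eta>\<^sup>2 * real N > 0" using \<eta> N' by simp
      ultimately show False by (simp add: power2_eq_square mult_ac)
    qed
    have "psi N / real N < 1 + 2 * \<eta>" "psi N / real N > 1 - 2 * \<eta>"
      using up lo N' by (simp_all add: field_simps)
    thus ?thesis using \<eta>(3) unfolding real_norm_def abs_less_iff by linarith
  qed
  thus "\<exists>no. \<forall>n\<ge>no. norm (psi n / real n - 1) < r" by blast
qed

definition theta :: "nat \<Rightarrow> real" where "theta n = (\<Sum>p | prime p \<and> p \<le> n. ln (real p))"

text \<open>The difference comes from powers \<open>p ^ i\<close> with \<open>i \<ge> 2\<close>.
  Then \<open>p \<le> sqrt n\<close> and \<open>i \<le> log 2 n\<close>, which bounds their number,
  and each contributes at most \<open>ln n\<close>.\<close>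

lemma psi_theta: "theta n \<le> psi n" "psi n \<le> theta n + (log 2 (real n) * sqrt (real n)) * ln (real n)" if n: "n > 0"
proof -
  have "psi n = (\<Sum>k\<in>{k. k \<le> n \<and> primepow k}. mangoldt k)"
    unfolding psi_def by (rule sum.mono_neutral_right) (auto simp: mangoldt_def)
  also have "{k. k \<le> n \<and> primepow k} = {p. prime p \<and> p \<le> n} \<union> {k. k \<le> n \<and> primepow k \<and> \<not> prime k}"
    by auto
  also have "(\<Sum>k\<in>\<dots>. mangoldt k) = (\<Sum>p | prime p \<and> p \<le> n. mangoldt p) + (\<Sum>k | k \<le> n \<and> primepow k \<and> \<not> prime k. mangoldt k)"
    by (rule sum.union_disjoint) auto
  also have "(\<Sum>p | prime p \<and> p \<le> n. mangoldt p) = theta n"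
    unfolding theta_def by (intro sum.cong) auto
  finally have eq: "psi n = theta n + (\<Sum>k | k \<le> n \<and> primepow k \<and> \<not> prime k. mangoldt k)" .
  show "theta n \<le> psi n" unfolding eq by (simp add: sum_nonneg mangoldt_nonneg)
  define L where "L = nat \<lfloor>log 2 (real n)\<rfloor>"
  define Q where "Q = nat \<lfloor>sqrt (real n)\<rfloor>"
  have LQ: "real L \<le> log 2 (real n)" "real Q \<le> sqrt (real n)" unfolding L_def Q_def using n by auto
  have sub: "{k. k \<le> n \<and> primepow k \<and> \<not> prime k} \<subseteq> (\<lambda>(i,m). m ^ i) ` ({1..L} \<times> {1..Q})"
  proof
    fix k assume "k \<in> {k. k \<le> n \<and> primepow k \<and> \<not> prime k}"
    then obtain p i where p: "prime p" "i > 0" "k = p ^ i" "k \<le> n" "\<not> prime k" by (auto simp: primepow_def)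
    have i: "i \<ge> 2" using p by (cases "i = 1") auto
    have p2: "p \<ge> 2" using p(1) by (rule prime_ge_2_nat)
    have "real 2 ^ i \<le> real n"
    proof -
      have "2 ^ i \<le> p ^ i" using p2 by (rule power_mono) simp
      hence "2 ^ i \<le> n" using p(3,4) by linarith
      thus ?thesis by (metis of_nat_le_iff of_nat_power)
    qed
    hence "real i \<le> log 2 (real n)" using n by (subst le_log_iff) (auto simp: powr_realpow)
    hence iL: "i \<le> L" unfolding L_def by (simp add: le_nat_floor)
    have "p ^ 2 \<le> p ^ i" using i p2 by (intro power_increasing) auto
    hence "p ^ 2 \<le> n" using p by simp
    hence "(real p)\<^sup>2 \<le> real n" by (metis of_nat_le_iff of_nat_power)
    hence "real p \<le> sqrt (real n)" by (rule real_le_rsqrt)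
    hence "p \<le> Q" unfolding Q_def by (simp add: le_nat_floor)
    thus "k \<in> (\<lambda>(i,m). m ^ i) ` ({1..L} \<times> {1..Q})" using iL i p2 p by (auto intro!: image_eqI[of _ _ "(i,p)"])
  qed
  have "(\<Sum>k | k \<le> n \<and> primepow k \<and> \<not> prime k. mangoldt k) \<le> (\<Sum>k | k \<le> n \<and> primepow k \<and> \<not> prime k. ln (real n))"
  proof (rule sum_mono)
    fix k assume k: "k \<in> {k. k \<le> n \<and> primepow k \<and> \<not> prime k}"
    hence "k > 0" by (auto intro!: Nat.gr0I)
    have "mangoldt k \<le> ln (real k)" by (rule mangoldt_le) fact
    also have "\<dots> \<le> ln (real n)" using k \<open>k > 0\<close> by simp
    finally show "mangoldt k \<le> ln (real n)" .
  qed
  also have "\<dots> = real (card {k. k \<le> n \<and> primepow k \<and> \<not> prime k}) * ln (real n)" by simp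
  also have "\<dots> \<le> (real L * real Q) * ln (real n)"
  proof (rule mult_right_mono)
    have "card {k. k \<le> n \<and> primepow k \<and> \<not> prime k} \<le> card ({1..L} \<times> {1..Q})"
      by (rule surj_card_le[OF _ sub]) auto
    thus "real (card {k. k \<le> n \<and> primepow k \<and> \<not> prime k}) \<le> real L * real Q"
      by (simp flip: of_nat_mult)
  qed (use n in auto)
  also have "\<dots> \<le> (log 2 (real n) * sqrt (real n)) * ln (real n)"
    using LQ n by (intro mult_right_mono mult_mono) auto
  finally show "psi n \<le> theta n + (log 2 (real n) * sqrt (real n)) * ln (real n)" unfolding eq by simp
qed

theorem theta_asymp: "(\<lambda>n. theta n / real n) \<longlonglongrightarrow> 1"
proof (rule tendsto_sandwich[OF _ _ _ psi_asymp])
  show "eventually (\<lambda>n. theta n / real n \<le> psi n / real n) sequentially"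
    using eventually_gt_at_top[of 0] by eventually_elim (auto intro!: divide_right_mono psi_theta)
  show "eventually (\<lambda>n. psi n / real n - log 2 (real n) * sqrt (real n) * ln (real n) / real n \<le> theta n / real n) sequentially"
    using eventually_gt_at_top[of 0]
  proof eventually_elim
    case (elim n)
    have "psi n - log 2 (real n) * sqrt (real n) * ln (real n) \<le> theta n" using psi_theta(2)[OF elim] by simp
    hence "(psi n - log 2 (real n) * sqrt (real n) * ln (real n)) / real n \<le> theta n / real n"
      by (intro divide_right_mono) auto
    thus ?case by (simp add: diff_divide_distrib)
  qed
  have "(\<lambda>n. log 2 (real n) * sqrt (real n) * ln (real n) / real n) \<longlonglongrightarrow> 0" by real_asymp
  from tendsto_diff[OF psi_asymp this]
  show "(\<lambda>n. psi n / real n - log 2 (real n) * sqrt (real n) * ln (real n) / real n) \<longlonglongrightarrow> 1" by simp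
qed

section \<open>A linear independence criterion\<close>

lemma common_denominator:
  assumes "finite (Q :: rat set)"
  obtains d :: int where "d > 0" "\<And>q. q \<in> Q \<Longrightarrow> \<exists>z. of_int d * q = of_int z"
proof -
  have "\<exists>d::int. d > 0 \<and> (\<forall>q\<in>Q. \<exists>z. of_int d * q = of_int z)"
    using assms
  proof (induction Q)
    case (insert x Q)
    then obtain d :: int where d: "d > 0" "\<And>q. q \<in> Q \<Longrightarrow> \<exists>z. of_int d * q = of_int z" by blast
    obtain a b :: int where ab: "x = of_int a / of_int b" "b > 0"
      using quotient_of_div[of x] quotient_of_denom_pos[of x] by (metis surj_pair)
    have "\<exists>z. of_int (d * b) * q = of_int z" if q: "q \<in> insert x Q" for q
    proof (cases "q = x")
      case True thus ?thesis using ab by (intro exI[of _ "d * a"]) simp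
    next
      case False
      then obtain z where "of_int d * q = of_int z" using q d(2) by blast
      thus ?thesis by (intro exI[of _ "b * z"]) (simp add: mult_ac flip: \<open>of_int d * q = of_int z\<close>)
    qed
    thus ?case using d(1) ab(2) by (intro exI[of _ "d * b"]) auto
  qed (intro exI[of _ 1], simp)
  thus ?thesis using that by blast
qed

text \<open>A form of Nesterenko's criterion, by simultaneous Dirichlet approximation. The forms are
  rewritten over a rational basis containing 1, with common denominator \<open>D\<close>. If
  \<open>q\<close> times each basis element is within \<open>1 / T\<close> of an integer, replacing
  the basis by these integers turns \<open>q * D * L \<nu>\<close> into an integer \<open>W\<close>
  up to an error. For a suitable \<open>\<nu>\<close> the value is at most 1/2 and the error is
  smaller than the value, so \<open>0 < \<bar>W\<bar> < 1\<close>, which is absurd. The loss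
  \<open>\<tau>1 - \<tau>2\<close> enters because the error must be compared with the lower
  bound.\<close>

theorem linear_independence_criterion:
  fixes \<xi> :: "nat \<Rightarrow> real" and l :: "nat \<Rightarrow> nat \<Rightarrow> int"
  assumes fin: "finite J" and j0: "j0 \<in> J" "\<xi> j0 = 1"
    and B: "B \<ge> 0" and \<tau>: "0 < \<tau>2" "\<tau>2 \<le> \<tau>1"
    and ev: "eventually (\<lambda>\<nu>. (\<forall>j\<in>J. real_of_int \<bar>l \<nu> j\<bar> \<le> exp (B * real \<nu>)) \<and>
        exp (- \<tau>1 * real \<nu>) \<le> \<bar>\<Sum>j\<in>J. of_int (l \<nu> j) * \<xi> j\<bar> \<and>
        \<bar>\<Sum>j\<in>J. of_int (l \<nu> j) * \<xi> j\<bar> \<le> exp (- \<tau>2 * real \<nu>)) sequentially"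
  shows "\<tau>2 \<le> (real (rat_vec.dim (\<xi> ` J)) - 1) * (B + \<tau>1 - \<tau>2)"
proof -
  have "rat_vec.independent {1}" by (simp add: rat_vec.dependent_single)
  then obtain Bs where Bs: "{1} \<subseteq> Bs" "Bs \<subseteq> \<xi> ` J" "rat_vec.independent Bs" "\<xi> ` J \<subseteq> rat_vec.span Bs"
    using rat_vec.maximal_independent_subset_extend[of "{1}" "\<xi> ` J"] j0 by (auto simp: image_iff)
  have finB: "finite Bs" using Bs(2) fin finite_subset by blast
  have dim: "card Bs = rat_vec.dim (\<xi> ` J)" by (rule rat_vec.basis_card_eq_dim) (use Bs in auto)
  define d where "d = card (Bs - {1})"
  have dimd: "rat_vec.dim (\<xi> ` J) = d + 1"
    using card_Suc_Diff1[OF finB, of 1] Bs(1) by (simp add: d_def dim)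
  obtain e where e: "bij_betw e {..<d} (Bs - {1})"
    using ex_bij_betw_nat_finite[of "Bs - {1}"] finB by (auto simp: d_def atLeast0LessThan)
  have "\<exists>u. \<xi> j = (\<Sum>b\<in>Bs. of_rat (u b) * b)" if "j \<in> J" for j
  proof -
    have "\<xi> j \<in> rat_vec.span Bs" using Bs(4) that by blast
    thus ?thesis unfolding rat_vec.span_finite[OF finB] by blast
  qed
  then obtain u where u: "\<And>j. j \<in> J \<Longrightarrow> \<xi> j = (\<Sum>b\<in>Bs. of_rat (u j b) * b)" by metis
  obtain D :: int where D: "D > 0" "\<And>q. q \<in> (\<lambda>(j,b). u j b) ` (J \<times> Bs) \<Longrightarrow> \<exists>z. of_int D * q = of_int z"
    using common_denominator[of "(\<lambda>(j,b). u j b) ` (J \<times> Bs)"] fin finB by blast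
  have "\<exists>z. of_int D * u j b = of_int z" if "j \<in> J" "b \<in> Bs" for j b
    using D(2)[of "u j b"] that by force
  then obtain z where z: "\<And>j b. j \<in> J \<Longrightarrow> b \<in> Bs \<Longrightarrow> of_int D * u j b = of_int (z j b)" by metis
  have D\<xi>: "of_int D * \<xi> j = (\<Sum>b\<in>Bs. of_int (z j b) * b)" if "j \<in> J" for j
  proof -
    have "of_int D * \<xi> j = (\<Sum>b\<in>Bs. (of_int D * of_rat (u j b)) * b)"
      by (simp add: u[OF that] sum_distrib_left mult.assoc)
    also have "\<dots> = (\<Sum>b\<in>Bs. of_int (z j b) * b)"
    proof (intro sum.cong refl)
      fix b assume b: "b \<in> Bs"
      have "(of_int D * of_rat (u j b) :: real) = of_rat (of_int D * u j b)" by (simp add: of_rat_mult)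
      also have "\<dots> = of_int (z j b)" by (simp add: z[OF that b])
      finally show "(of_int D * of_rat (u j b)) * b = of_int (z j b) * b" by simp
    qed
    finally show ?thesis .
  qed
  define l' where "l' = (\<lambda>\<nu> b. \<Sum>j\<in>J. l \<nu> j * z j b)"
  define L where "L = (\<lambda>\<nu>. \<Sum>j\<in>J. of_int (l \<nu> j) * \<xi> j)"
  define C where "C = (\<Sum>b\<in>Bs. \<Sum>j\<in>J. \<bar>real_of_int (z j b)\<bar>)"
  have DL: "of_int D * L \<nu> = (\<Sum>b\<in>Bs. of_int (l' \<nu> b) * b)" for \<nu>
  proof -
    have "of_int D * L \<nu> = (\<Sum>j\<in>J. of_int (l \<nu> j) * (of_int D * \<xi> j))"
      by (simp add: L_def sum_distrib_left mult_ac)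
    also have "\<dots> = (\<Sum>j\<in>J. \<Sum>b\<in>Bs. of_int (l \<nu> j * z j b) * b)"
      by (intro sum.cong refl) (simp add: D\<xi> sum_distrib_left mult_ac)
    also have "\<dots> = (\<Sum>b\<in>Bs. of_int (l' \<nu> b) * b)"
      by (subst sum.swap) (simp add: l'_def sum_distrib_right)
    finally show ?thesis .
  qed
  obtain \<nu>0 where \<nu>0: "\<And>\<nu> j. \<nu> \<ge> \<nu>0 \<Longrightarrow> j \<in> J \<Longrightarrow> real_of_int \<bar>l \<nu> j\<bar> \<le> exp (B * real \<nu>)"
      "\<And>\<nu>. \<nu> \<ge> \<nu>0 \<Longrightarrow> exp (- \<tau>1 * real \<nu>) \<le> \<bar>L \<nu>\<bar>" "\<And>\<nu>. \<nu> \<ge> \<nu>0 \<Longrightarrow> \<bar>L \<nu>\<bar> \<le> exp (- \<tau>2 * real \<nu>)"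
    using ev unfolding eventually_sequentially L_def by blast
  have C0: "C \<ge> 0" unfolding C_def by (intro sum_nonneg) auto
  have l'b: "\<bar>real_of_int (l' \<nu> b)\<bar> \<le> C * exp (B * real \<nu>)" if "\<nu> \<ge> \<nu>0" "b \<in> Bs" for \<nu> b
  proof -
    have "\<bar>real_of_int (l' \<nu> b)\<bar> \<le> (\<Sum>j\<in>J. \<bar>real_of_int (l \<nu> j) * real_of_int (z j b)\<bar>)"
      unfolding l'_def of_int_sum of_int_mult by (rule sum_abs)
    also have "\<dots> \<le> (\<Sum>j\<in>J. exp (B * real \<nu>) * \<bar>real_of_int (z j b)\<bar>)"
      unfolding abs_mult using \<nu>0(1)[OF that(1)] by (intro sum_mono mult_right_mono) auto
    also have "\<dots> = exp (B * real \<nu>) * (\<Sum>j\<in>J. \<bar>real_of_int (z j b)\<bar>)" by (simp add: sum_distrib_left)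
    also have "\<dots> \<le> exp (B * real \<nu>) * C" unfolding C_def
      by (intro mult_left_mono member_le_sum) (use that finB in \<open>auto intro: sum_nonneg\<close>)
    finally show ?thesis by (simp add: mult.commute)
  qed
  define g where "g = B + \<tau>1 - \<tau>2"
  have g0: "g \<ge> 0" using B \<tau> by (simp add: g_def)
  have "\<tau>2 \<le> real d * g"
  proof (rule ccontr)
    assume nt: "\<not> \<tau>2 \<le> real d * g"
    \<comment> \<open>With \<open>q \<le> T ^ d\<close> and \<open>\<nu>\<close> about
      \<open>ln (2 * D * q) / \<tau>2\<close>, the factor \<open>exp (g * \<nu>)\<close> in the
      error is at most a constant times \<open>T powr \<kappa>\<close>. The gain from the
      approximation is a factor \<open>T\<close>, so \<open>\<kappa> < 1\<close> suffices;
      \<open>K\<close> and \<open>c\<close> collect the constants.\<close>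
    define \<kappa> where "\<kappa> = real d * g / \<tau>2"
    have \<kappa>: "\<kappa> < 1" using nt \<tau> by (simp add: \<kappa>_def)
    define K where "K = real (card Bs) * C * exp (g * (real \<nu>0 + 1)) * exp (g * ln (2 * of_int D) / \<tau>2)"
    define c where "c = exp (- \<tau>2 * (real \<nu>0 + 1)) / 2"
    have "(\<lambda>T::nat. K * real T powr (\<kappa> - 1)) \<longlonglongrightarrow> 0" using \<kappa> by real_asymp
    moreover have "c > 0" by (simp add: c_def)
    ultimately have "eventually (\<lambda>T. K * real T powr (\<kappa> - 1) < c) sequentially" by (rule order_tendstoD)
    hence "eventually (\<lambda>T. T > 0 \<and> K * real T powr (\<kappa> - 1) < c) sequentially"
      using eventually_gt_at_top[of 0] by eventually_elim simp
    then obtain T :: nat where T: "T > 0" "K * real T powr (\<kappa> - 1) < c"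
      by (auto simp: eventually_sequentially)
    have T': "K * real T powr \<kappa> < c * real T"
      using T by (simp add: powr_diff field_simps)
    obtain q p where qp: "0 < q" "q \<le> int (T ^ d)" "\<And>i. i < d \<Longrightarrow> \<bar>of_int q * e i - of_int (p i)\<bar> < 1 / real T"
      using Dirichlet_approx_simult[OF T(1), of d e] by blast
    \<comment> \<open>The basis element 1 is approximated without error by \<open>q\<close> itself,
      so only the other \<open>d\<close> elements count.\<close>
    define pb where "pb = (\<lambda>b. if b = 1 then q else p (inv_into {..<d} e b))"
    have pb: "\<bar>of_int q * b - of_int (pb b)\<bar> \<le> 1 / real T" if "b \<in> Bs" for b
    proof (cases "b = 1")
      case False
      hence "b \<in> e ` {..<d}" using e that by (auto simp: bij_betw_def)
      hence "inv_into {..<d} e b < d" "e (inv_into {..<d} e b) = b"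
        using inv_into_into[of b e "{..<d}"] f_inv_into_f[of b e "{..<d}"] by auto
      thus ?thesis using qp(3)[of "inv_into {..<d} e b"] False by (simp add: pb_def)
    qed (simp add: pb_def)
    define x where "x = ln (2 * of_int D * real_of_int q)"
    have Dq: "real_of_int D \<ge> 1" "real_of_int q \<ge> 1" using D(1) qp(1) by simp_all
    hence Dq1: "real_of_int D * real_of_int q \<ge> 1" using mult_mono[of 1 "real_of_int D" 1 "real_of_int q"] by simp
    hence x0: "x \<ge> 0" unfolding x_def by (intro ln_ge_zero) simp
    have ex: "exp (- x) = 1 / (2 * of_int D * of_int q)"
      using Dq by (simp add: x_def exp_minus inverse_eq_divide)
    \<comment> \<open>Large enough for \<open>exp (- \<tau>2 * \<nu>) \<le> 1 / (2 * D * q)\<close>,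
      yet not larger than needed up to a constant, because the error grows with
      \<open>\<nu>\<close>.\<close>
    define \<nu> where "\<nu> = \<nu>0 + nat \<lceil>x / \<tau>2\<rceil>"
    have \<nu>: "\<nu> \<ge> \<nu>0" by (simp add: \<nu>_def)
    have "x / \<tau>2 \<ge> 0" using x0 \<tau> by simp
    hence \<nu>1: "real \<nu> \<ge> x / \<tau>2" "real \<nu> \<le> (real \<nu>0 + 1) + x / \<tau>2" unfolding \<nu>_def by linarith+
    have t1: "x \<le> \<tau>2 * real \<nu>" using \<nu>1(1) \<tau> by (simp add: field_simps)
    have t2: "\<tau>2 * real \<nu> \<le> \<tau>2 * (real \<nu>0 + 1) + x"
    proof -
      have "\<tau>2 * real \<nu> \<le> \<tau>2 * ((real \<nu>0 + 1) + x / \<tau>2)" by (rule mult_left_mono[OF \<nu>1(2)]) (use \<tau> in simp)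
      also have "\<dots> = \<tau>2 * (real \<nu>0 + 1) + x" using \<tau> by (subst distrib_left) simp
      finally show ?thesis .
    qed
    have "\<bar>L \<nu>\<bar> \<le> exp (- \<tau>2 * real \<nu>)" by (rule \<nu>0(3)[OF \<nu>])
    also have "\<dots> \<le> exp (- x)" using t1 by simp
    finally have up: "of_int q * (of_int D * \<bar>L \<nu>\<bar>) \<le> 1 / 2"
      unfolding ex using Dq by (simp add: field_simps)
    define err where "err = (\<Sum>b\<in>Bs. real_of_int (l' \<nu> b) * (of_int q * b - of_int (pb b)))"
    have "\<bar>err\<bar> \<le> (\<Sum>b\<in>Bs. \<bar>real_of_int (l' \<nu> b) * (of_int q * b - of_int (pb b))\<bar>)"
      unfolding err_def by (rule sum_abs)
    also have "\<dots> \<le> (\<Sum>b\<in>Bs. (C * exp (B * real \<nu>)) * (1 / real T))"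
      unfolding abs_mult using l'b[OF \<nu>] pb C0 by (intro sum_mono mult_mono) auto
    also have "\<dots> = real (card Bs) * C * exp (B * real \<nu>) / real T" by simp
    finally have err: "\<bar>err\<bar> \<le> real (card Bs) * C * exp (B * real \<nu>) / real T" .
    have "real (card Bs) * C * exp (g * real \<nu>) \<le> K * real T powr \<kappa>"
    proof -
      have "ln (real_of_int q) \<le> ln (real T ^ d)"
      proof (subst ln_le_cancel_iff)
        have "real_of_int q \<le> real_of_int (int (T ^ d))" using qp(2) by (subst of_int_le_iff)
        thus "real_of_int q \<le> real T ^ d" by simp
      qed (use qp(1) T(1) in auto)
      hence "ln (real_of_int q) \<le> real d * ln (real T)" using T(1) by (simp add: ln_realpow)
      hence "x \<le> ln (2 * of_int D) + real d * ln (real T)"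
        unfolding x_def using Dq by (simp add: ln_mult_pos)
      hence "x / \<tau>2 \<le> (ln (2 * of_int D) + real d * ln (real T)) / \<tau>2"
        using \<tau> by (intro divide_right_mono) auto
      hence "real \<nu> \<le> (real \<nu>0 + 1) + (ln (2 * of_int D) + real d * ln (real T)) / \<tau>2"
        using \<nu>1(2) by linarith
      hence "g * real \<nu> \<le> g * ((real \<nu>0 + 1) + (ln (2 * of_int D) + real d * ln (real T)) / \<tau>2)"
        by (rule mult_left_mono[OF _ g0])
      also have "\<dots> = g * (real \<nu>0 + 1) + g * ln (2 * of_int D) / \<tau>2 + \<kappa> * ln (real T)"
        unfolding \<kappa>_def by (simp add: add_divide_distrib algebra_simps)
      finally have "exp (g * real \<nu>) \<le> exp (g * (real \<nu>0 + 1)) * exp (g * ln (2 * of_int D) / \<tau>2) * real T powr \<kappa>"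
        using T(1) by (simp add: powr_def flip: exp_add)
      hence "(real (card Bs) * C) * exp (g * real \<nu>) \<le> (real (card Bs) * C) * (exp (g * (real \<nu>0 + 1)) * exp (g * ln (2 * of_int D) / \<tau>2) * real T powr \<kappa>)"
        by (intro mult_left_mono) (use C0 in auto)
      thus ?thesis by (simp add: K_def mult_ac)
    qed
    also have "\<dots> < c * real T" by (rule T')
    also have "c = of_int q * of_int D * (exp (- \<tau>2 * (real \<nu>0 + 1)) * exp (- x))"
      unfolding ex c_def using Dq by simp
    also have "\<dots> \<le> of_int q * of_int D * exp (- \<tau>2 * real \<nu>)"
      unfolding exp_add[symmetric] using t2 Dq by (intro mult_left_mono) auto
    finally have "real (card Bs) * C * exp (g * real \<nu>) < of_int q * of_int D * exp (- \<tau>2 * real \<nu>) * real T"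
      using T(1) by simp
    hence "real (card Bs) * C * exp (g * real \<nu>) * exp (- (\<tau>1 - \<tau>2) * real \<nu>) < of_int q * of_int D * exp (- \<tau>2 * real \<nu>) * real T * exp (- (\<tau>1 - \<tau>2) * real \<nu>)"
      by (rule mult_strict_right_mono) simp
    moreover have "exp (g * real \<nu>) * exp (- (\<tau>1 - \<tau>2) * real \<nu>) = exp (B * real \<nu>)"
      by (simp add: g_def algebra_simps flip: exp_add)
    moreover have "exp (- \<tau>2 * real \<nu>) * exp (- (\<tau>1 - \<tau>2) * real \<nu>) = exp (- \<tau>1 * real \<nu>)"
      by (simp add: algebra_simps flip: exp_add)
    ultimately have "real (card Bs) * C * exp (B * real \<nu>) < of_int q * of_int D * exp (- \<tau>1 * real \<nu>) * real T"
      by (simp only: mult_ac)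
    hence "real (card Bs) * C * exp (B * real \<nu>) / real T < of_int q * (of_int D * exp (- \<tau>1 * real \<nu>))"
      using T(1) by (simp add: field_simps)
    also have "\<dots> \<le> of_int q * (of_int D * \<bar>L \<nu>\<bar>)"
      using \<nu>0(2)[OF \<nu>] Dq by (intro mult_left_mono) auto
    finally have err2: "\<bar>err\<bar> < of_int q * (of_int D * \<bar>L \<nu>\<bar>)" using err by linarith
    define W where "W = (\<Sum>b\<in>Bs. l' \<nu> b * pb b)"
    have W: "real_of_int W = of_int q * (of_int D * L \<nu>) - err"
    proof -
      have "of_int q * (of_int D * L \<nu>) = (\<Sum>b\<in>Bs. real_of_int (l' \<nu> b) * (of_int q * b))"
        by (simp add: DL sum_distrib_left mult_ac)
      thus ?thesis unfolding W_def err_def by (simp add: sum_subtractf algebra_simps)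
    qed
    have aL: "\<bar>of_int q * (of_int D * L \<nu>)\<bar> = of_int q * (of_int D * \<bar>L \<nu>\<bar>)"
      using Dq by (simp add: abs_mult)
    have "real_of_int W \<noteq> 0" "\<bar>real_of_int W\<bar> < 1" using W aL err2 up by linarith+
    thus False by simp
  qed
  thus ?thesis using dimd by (simp add: g_def)
qed

section \<open>Expansions of rational functions\<close>

unbundle fps_syntax
unbundle no vec_syntax

definition linear_fps :: "real \<Rightarrow> real fps" where "linear_fps c = fps_const c + fps_X"
definition inv_linear_fps :: "real \<Rightarrow> real fps" where "inv_linear_fps c = Abs_fps (\<lambda>l. (-1) ^ l / c ^ (Suc l))"

lemma linear_fps_nth: "linear_fps c $ l = (if l = 0 then c else if l = 1 then 1 else 0)"
  by (simp add: linear_fps_def)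

lemma linear_fps_inv_linear_fps: assumes "c \<noteq> 0" shows "linear_fps c * inv_linear_fps c = 1"
proof (rule fps_ext)
  fix l show "(linear_fps c * inv_linear_fps c) $ l = 1 $ l"
    using assms by (cases l) (simp_all add: linear_fps_def distrib_right inv_linear_fps_def field_simps)
qed

lemma power_dvd_of_coeffs_zero:
  fixes p :: "real poly"
  assumes "\<And>l. l < a \<Longrightarrow> coeff p l = 0"
  shows "[:0, 1:] ^ a dvd p"
  using assms monom_1_dvd_iff'[of a p] by (simp add: monom_altdef)

lemma card_mult_le_degree:
  fixes Q :: "real poly"
  assumes "Q \<noteq> 0" "finite S" "\<And>c. c \<in> S \<Longrightarrow> [:- c, 1:] ^ a dvd Q"
  shows "card S * a \<le> degree Q"
  using assms(2,1,3)
proof (induction S arbitrary: Q)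
  case (insert c S)
  obtain Q' where Q': "Q = [:- c, 1:] ^ a * Q'" using insert.prems(2)[of c] by (auto elim: dvdE)
  have Q0: "Q' \<noteq> 0" using insert.prems(1) Q' by auto
  have "card S * a \<le> degree Q'"
  proof (rule insert.IH[OF Q0])
    fix c' assume c': "c' \<in> S"
    hence ne: "c' \<noteq> c" using insert.hyps by auto
    have "a \<le> order c' Q"
      using insert.prems(2)[of c'] c' insert.prems(1) by (simp add: order_divides)
    also have "order c' Q = order c' ([:- c, 1:] ^ a) + order c' Q'"
      unfolding Q' by (rule order_mult) (use insert.prems(1) Q' in auto)
    also have "order c' ([:- c, 1:] ^ a) = 0" by (rule order_0I) (use ne in auto)
    finally show "[:- c', 1:] ^ a dvd Q'" using Q0 by (simp add: order_divides)
  qed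
  moreover have "degree Q = a + degree Q'"
    unfolding Q' by (subst degree_mult_eq) (use Q0 in \<open>auto simp: degree_power_eq\<close>)
  ultimately show ?case using insert.hyps by simp
qed simp

lemma pcompose_shift_back: "(p \<circ>\<^sub>p [:- c, 1:]) \<circ>\<^sub>p [:c, 1:] = (p :: real poly)"
  by (simp add: pcompose_assoc[symmetric] pcompose_pCons)

lemma pcompose_power: "(p ^ n) \<circ>\<^sub>p q = (p \<circ>\<^sub>p q) ^ n" for p q :: "real poly"
  by (induction n) (simp_all add: pcompose_mult pcompose_1)

lemma fps_of_poly_linear_pcompose:
  "fps_of_poly ([:b, 1:] \<circ>\<^sub>p [:- c, 1:]) = linear_fps (b - c)"
  by (rule fps_ext) (auto simp: linear_fps_def fps_of_poly_nth pcompose_pCons coeff_pCons split: nat.splits)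

text \<open>The second hypothesis says, without division, that \<open>G k\<close> is the expansion
  of \<open>P\<close> over the other factors in powers of \<open>t + k\<close>. Subtracting the
  numerators built from its first \<open>a\<close> coefficients leaves a polynomial \<open>Q\<close>
  divisible by \<open>(t + k) ^ a\<close> for every \<open>k \<le> n\<close>. Its degree is below
  \<open>a * (n + 1)\<close>, so it vanishes.\<close>

theorem partial_fractions:
  fixes P :: "real poly" and G :: "nat \<Rightarrow> real fps"
  assumes deg: "degree P < a * (n + 1)"
    and G: "\<And>k. k \<le> n \<Longrightarrow> fps_of_poly (P \<circ>\<^sub>p [:- real k, 1:]) = G k * (\<Prod>j\<in>{..n}-{k}. linear_fps (real j - real k)) ^ a"
    and t: "\<And>k. k \<le> n \<Longrightarrow> t + real k \<noteq> 0"
  shows "poly P t / (\<Prod>j\<le>n. t + real j) ^ a = (\<Sum>k\<le>n. \<Sum>l<a. G k $ l / (t + real k) ^ (a - l))"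
proof -
  have a: "a > 0" using deg by (cases a) auto
  define W where "W = (\<lambda>k. \<Prod>j\<in>{..n}-{k}. [:real j, 1:] ^ a)"
  define B where "B = (\<lambda>k. \<Sum>l<a. smult (G k $ l) ([:real k, 1:] ^ l))"
  define Q where "Q = P - (\<Sum>k\<le>n. B k * W k)"
  have dW: "degree (W k) = n * a" if "k \<le> n" for k
  proof -
    have "degree (W k) = (\<Sum>j\<in>{..n}-{k}. degree ([:real j, 1:] ^ a))"
      unfolding W_def by (rule degree_prod_eq_sum_degree) auto
    also have "\<dots> = (\<Sum>j\<in>{..n}-{k}. a)" by (intro sum.cong) (auto simp: degree_power_eq)
    also have "\<dots> = n * a" using that by simp
    finally show ?thesis .
  qed
  have dB: "degree (B k) < a" for k unfolding B_def
  proof (rule degree_sum_less[OF _ a])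
    fix l assume "l \<in> {..<a}"
    have "degree (smult (G k $ l) ([:real k, 1:] ^ l)) \<le> degree ([:real k, 1:] ^ l)" by (rule degree_smult_le)
    also have "\<dots> = l" by (simp add: degree_power_eq)
    finally show "degree (smult (G k $ l) ([:real k, 1:] ^ l)) < a" using \<open>l \<in> {..<a}\<close> by simp
  qed
  have dQ: "degree Q < a * (n + 1)" unfolding Q_def
  proof (rule degree_diff_less[OF deg degree_sum_less])
    fix k assume "k \<in> {..n}"
    have "degree (B k * W k) \<le> degree (B k) + degree (W k)" by (rule degree_mult_le)
    also have "\<dots> < a + n * a" using dB[of k] dW[of k] \<open>k \<in> {..n}\<close> by simp
    finally show "degree (B k * W k) < a * (n + 1)" by (simp add: algebra_simps)
  qed (use a in simp)
  have dvd: "[:real k, 1:] ^ a dvd Q" if k: "k \<le> n" for k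
  proof -
    have "Q = (P - B k * W k) - (\<Sum>i\<in>{..n}-{k}. B i * W i)"
      unfolding Q_def by (subst sum.remove[of "{..n}" k]) (use k in auto)
    moreover have "[:real k, 1:] ^ a dvd (\<Sum>i\<in>{..n}-{k}. B i * W i)"
    proof (rule dvd_sum)
      fix i assume i: "i \<in> {..n} - {k}"
      have "[:real k, 1:] ^ a dvd W i" unfolding W_def by (rule dvd_prodI) (use i k in auto)
      thus "[:real k, 1:] ^ a dvd B i * W i" by simp
    qed
    moreover have "[:real k, 1:] ^ a dvd P - B k * W k"
    proof -
      define M where "M = (\<Prod>j\<in>{..n}-{k}. linear_fps (real j - real k)) ^ a"
      have wM: "fps_of_poly (W k \<circ>\<^sub>p [:- real k, 1:]) = M"
        unfolding W_def M_def pcompose_prod fps_of_poly_prod pcompose_power fps_of_poly_power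
          fps_of_poly_linear_pcompose prod_power_distrib ..
      have bB: "fps_of_poly (B k \<circ>\<^sub>p [:- real k, 1:]) = fps_cutoff a (G k)"
      proof -
        have "B k \<circ>\<^sub>p [:- real k, 1:] = (\<Sum>l<a. smult (G k $ l) ([:0, 1:] ^ l))"
          unfolding B_def pcompose_sum pcompose_smult pcompose_power
          by (simp add: pcompose_pCons)
        also have "\<dots> = (\<Sum>l<a. monom (G k $ l) l)" by (simp add: monom_altdef)
        finally show ?thesis
          by (intro fps_ext) (auto simp: fps_of_poly_nth coeff_sum coeff_monom fps_cutoff_nth)
      qed
      define R where "R = (P - B k * W k) \<circ>\<^sub>p [:- real k, 1:]"
      have R: "fps_of_poly R = (G k - fps_cutoff a (G k)) * M"
        unfolding R_def pcompose_diff pcompose_mult fps_of_poly_diff fps_of_poly_mult wM bB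
          G[OF k] M_def[symmetric] by (simp add: algebra_simps)
      have "coeff R l = 0" if l: "l < a" for l
      proof -
        have "coeff R l = fps_of_poly R $ l" by simp
        also have "\<dots> = 0" unfolding R fps_mult_nth using l by (intro sum.neutral) auto
        finally show ?thesis .
      qed
      hence "[:0, 1:] ^ a dvd R" by (rule power_dvd_of_coeffs_zero)
      then obtain S where "R = [:0, 1:] ^ a * S" by (auto elim: dvdE)
      hence "R \<circ>\<^sub>p [:real k, 1:] = [:real k, 1:] ^ a * (S \<circ>\<^sub>p [:real k, 1:])"
        by (simp add: pcompose_mult pcompose_power pcompose_pCons)
      thus ?thesis unfolding R_def pcompose_shift_back by simp
    qed
    ultimately show ?thesis by (simp add: dvd_diff)
  qed
  have "Q = 0"
  proof (rule ccontr)
    assume "Q \<noteq> 0"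
    hence "card ((\<lambda>k. - real k) ` {..n}) * a \<le> degree Q"
      by (rule card_mult_le_degree) (use dvd in auto)
    moreover have "card ((\<lambda>k. - real k) ` {..n}) = n + 1"
      by (subst card_image) (auto simp: inj_on_def)
    ultimately show False using dQ by (simp add: mult.commute)
  qed
  hence P: "P = (\<Sum>k\<le>n. B k * W k)" by (simp add: Q_def)
  have "poly P t / (\<Prod>j\<le>n. t + real j) ^ a = (\<Sum>k\<le>n. poly (B k) t * poly (W k) t / (\<Prod>j\<le>n. t + real j) ^ a)"
    unfolding P by (simp add: poly_sum sum_divide_distrib)
  also have "\<dots> = (\<Sum>k\<le>n. \<Sum>l<a. G k $ l / (t + real k) ^ (a - l))"
  proof (intro sum.cong refl)
    fix k assume k: "k \<in> {..n}"
    have wk: "poly (W k) t = (\<Prod>j\<in>{..n}-{k}. t + real j) ^ a"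
      by (simp add: W_def poly_prod prod_power_distrib add.commute)
    have wk0: "(\<Prod>j\<in>{..n}-{k}. t + real j) \<noteq> 0" using t by auto
    have tk: "t + real k \<noteq> 0" using t k by auto
    have full: "(\<Prod>j\<le>n. t + real j) = (t + real k) * (\<Prod>j\<in>{..n}-{k}. t + real j)"
      by (rule prod.remove) (use k in auto)
    have bk: "poly (B k) t = (\<Sum>l<a. G k $ l * (t + real k) ^ l)"
      by (simp add: B_def poly_sum add.commute)
    have "poly (B k) t * poly (W k) t / (\<Prod>j\<le>n. t + real j) ^ a = (\<Sum>l<a. G k $ l * (t + real k) ^ l) / (t + real k) ^ a"
      unfolding wk full bk power_mult_distrib using wk0 by simp
    also have "\<dots> = (\<Sum>l<a. G k $ l / (t + real k) ^ (a - l))"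
      unfolding sum_divide_distrib
    proof (intro sum.cong refl)
      fix l assume "l \<in> {..<a}"
      hence "(t + real k) ^ a = (t + real k) ^ l * (t + real k) ^ (a - l)"
        by (simp flip: power_add)
      thus "G k $ l * (t + real k) ^ l / (t + real k) ^ a = G k $ l / (t + real k) ^ (a - l)"
        using tk by simp
    qed
    finally show "poly (B k) t * poly (W k) t / (\<Prod>j\<le>n. t + real j) ^ a = (\<Sum>l<a. G k $ l / (t + real k) ^ (a - l))" .
  qed
  finally show ?thesis .
qed

section \<open>Integrality of power series at a prime\<close>

definition p_integral :: "nat \<Rightarrow> real \<Rightarrow> bool" where
  "p_integral p x \<longleftrightarrow> (\<exists>a b::int. \<not> int p dvd b \<and> x = of_int a / of_int b)"

context
  fixes p :: nat assumes p: "prime p"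
begin

lemma pp: "prime (int p)" using p by simp

lemma p_integral_of_int [intro, simp]: "p_integral p (of_int a)"
  unfolding p_integral_def by (rule exI[of _ a], rule exI[of _ 1]) (use pp in \<open>auto dest: not_prime_unit\<close>)

lemma p_integral_0 [simp]: "p_integral p 0" and p_integral_1 [simp]: "p_integral p 1"
  using p_integral_of_int[of 0] p_integral_of_int[of 1] by simp_all

lemma p_integral_of_nat [intro, simp]: "p_integral p (of_nat a)"
  using p_integral_of_int[of "int a"] by simp

lemma p_integral_mult: assumes "p_integral p x" "p_integral p y" shows "p_integral p (x * y)"
proof -
  obtain a b c d :: int where *: "\<not> int p dvd b" "x = of_int a / of_int b" "\<not> int p dvd d" "y = of_int c / of_int d"
    using assms unfolding p_integral_def by blast
  have "\<not> int p dvd b * d" using * pp by (simp add: prime_dvd_mult_iff)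
  thus ?thesis unfolding p_integral_def by (intro exI[of _ "a * c"] exI[of _ "b * d"]) (simp add: *)
qed

lemma p_integral_add: assumes "p_integral p x" "p_integral p y" shows "p_integral p (x + y)"
proof -
  obtain a b c d :: int where *: "\<not> int p dvd b" "x = of_int a / of_int b" "\<not> int p dvd d" "y = of_int c / of_int d"
    using assms unfolding p_integral_def by blast
  have "b \<noteq> 0" "d \<noteq> 0" using * by auto
  moreover have "\<not> int p dvd b * d" using * pp by (simp add: prime_dvd_mult_iff)
  ultimately show ?thesis unfolding p_integral_def
    by (intro exI[of _ "a * d + c * b"] exI[of _ "b * d"]) (simp add: * field_simps)
qed

lemma p_integral_uminus: "p_integral p x \<Longrightarrow> p_integral p (- x)"
  using p_integral_mult[OF p_integral_of_int[of "-1"], of x] by simp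

lemma p_integral_sum: "(\<And>i. i \<in> S \<Longrightarrow> p_integral p (f i)) \<Longrightarrow> p_integral p (sum f S)"
  by (induction S rule: infinite_finite_induct) (auto intro: p_integral_add)

lemma p_integral_power: "p_integral p x \<Longrightarrow> p_integral p (x ^ n)"
  by (induction n) (auto intro: p_integral_mult)

lemma p_integral_inverse_int: "\<not> int p dvd b \<Longrightarrow> p_integral p (1 / of_int b)"
  unfolding p_integral_def by (rule exI[of _ 1], rule exI[of _ b]) auto

lemma p_integral_powi: "i \<ge> 0 \<Longrightarrow> p_integral p (real p powi i)"
  by (auto simp: power_int_def intro: p_integral_power)

text \<open>The \<open>l\<close>-th coefficient has \<open>p\<close>-adic valuation at least \<open>E - e * l\<close>.\<close>
definition val_bounded :: "nat \<Rightarrow> int \<Rightarrow> real fps \<Rightarrow> bool" where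
  "val_bounded e E f \<longleftrightarrow> (\<forall>l. p_integral p (f $ l * real p powi (int (e * l) - E)))"

lemma p0: "real p \<noteq> 0" using p by (auto dest: prime_gt_0_nat)

text \<open>The lower bound on the valuations is affine in the index, so under convolution the
  intercepts add and the slope is kept.\<close>

lemma val_bounded_mult: assumes "val_bounded e E f" "val_bounded e E' g" shows "val_bounded e (E + E') (f * g)"
  unfolding val_bounded_def
proof
  fix l
  have "(f * g) $ l * real p powi (int (e * l) - (E + E')) =
     (\<Sum>i\<in>{0..l}. (f $ i * real p powi (int (e * i) - E)) * (g $ (l - i) * real p powi (int (e * (l - i)) - E')))"
    unfolding fps_mult_nth sum_distrib_right
  proof (intro sum.cong refl)
    fix i assume i: "i \<in> {0..l}"
    have "e * l = e * i + e * (l - i)" using i by (simp flip: add_mult_distrib2)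
    hence "int (e * l) = int (e * i) + int (e * (l - i))" by (simp only: of_nat_add)
    hence ex: "int (e * l) - (E + E') = (int (e * i) - E) + (int (e * (l - i)) - E')" by linarith
    have "real p powi (int (e * l) - (E + E')) = real p powi (int (e * i) - E) * real p powi (int (e * (l - i)) - E')"
      unfolding ex by (rule power_int_add) (use p0 in simp)
    thus "f $ i * g $ (l - i) * real p powi (int (e * l) - (E + E')) =
      (f $ i * real p powi (int (e * i) - E)) * (g $ (l - i) * real p powi (int (e * (l - i)) - E'))" by simp
  qed
  also have "p_integral p \<dots>"
    by (rule p_integral_sum, rule p_integral_mult) (use assms in \<open>unfold val_bounded_def, blast+\<close>)
  finally show "p_integral p ((f * g) $ l * real p powi (int (e * l) - (E + E')))" .
qed

lemma val_bounded_mono: assumes "val_bounded e E f" "E' \<le> E" shows "val_bounded e E' f"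
  unfolding val_bounded_def
proof
  fix l
  have ex: "int (e * l) - E' = (int (e * l) - E) + (E - E')" by simp
  have "real p powi (int (e * l) - E') = real p powi (int (e * l) - E) * real p powi (E - E')"
    unfolding ex by (rule power_int_add) (use p0 in simp)
  moreover have "p_integral p (f $ l * real p powi (int (e * l) - E) * real p powi (E - E'))"
    by (rule p_integral_mult[OF _ p_integral_powi]) (use assms in \<open>auto simp: val_bounded_def\<close>)
  ultimately show "p_integral p (f $ l * real p powi (int (e * l) - E'))" by (simp only: mult.assoc)
qed

lemma val_bounded_const: assumes "p_integral p z" shows "val_bounded e E (fps_const (real p powi E * z))"
  unfolding val_bounded_def using assms p0 by (auto simp: power_int_diff power_int_minus_divide)

lemma val_bounded_1: "val_bounded e 0 1" using val_bounded_const[of 1 e 0] by simp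

lemma val_bounded_prod: "(\<And>i. i \<in> S \<Longrightarrow> val_bounded e (E i) (f i)) \<Longrightarrow> val_bounded e (sum E S) (prod f S)"
  by (induction S rule: infinite_finite_induct) (auto intro: val_bounded_mult val_bounded_1)

lemma val_bounded_power: "val_bounded e E f \<Longrightarrow> val_bounded e (int m * E) (f ^ m)"
proof (induction m)
  case (Suc m)
  show ?case using val_bounded_mult[OF Suc.prems Suc.IH[OF Suc.prems]] by (simp add: algebra_simps)
qed (simp add: val_bounded_1)

text \<open>The \<open>p\<close>-adic valuation of \<open>c\<close>, truncated at \<open>e\<close>.\<close>
definition val_upto :: "nat \<Rightarrow> int \<Rightarrow> nat" where "val_upto e c = card {h\<in>{1..e}. int p ^ h dvd c}"

lemma val_upto_set: "{h\<in>{1..e}. int p ^ h dvd c} = {1..val_upto e c}"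
proof -
  define S where "S = {h\<in>{1..e}. int p ^ h dvd c}"
  have fin: "finite S" by (simp add: S_def)
  have down: "h' \<in> S" if "h \<in> S" "1 \<le> h'" "h' \<le> h" for h h'
    using that by (auto simp: S_def intro: dvd_trans[OF le_imp_power_dvd])
  have "S = {1..card S}"
  proof (cases "S = {}")
    case False
    have "S = {1..Max S}"
    proof (intro equalityI subsetI)
      fix h assume h: "h \<in> S" thus "h \<in> {1..Max S}" using fin by (auto simp: S_def)
    next
      fix h assume "h \<in> {1..Max S}"
      thus "h \<in> S" using down[OF Max_in[OF fin False]] by auto
    qed
    thus ?thesis by (metis card_atLeastAtMost diff_Suc_1)
  qed simp
  thus ?thesis by (simp add: S_def val_upto_def)
qed

lemma val_upto_le: "val_upto e c \<le> e"
proof -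
  have "card {h\<in>{1..e}. int p ^ h dvd c} \<le> card {1..e}" by (rule card_mono) auto
  thus ?thesis by (simp add: val_upto_def)
qed

lemma val_upto_0 [simp]: "val_upto e 0 = e"
proof -
  have "{h\<in>{1..e}. int p ^ h dvd 0} = {1..e}" by auto
  thus ?thesis unfolding val_upto_def by simp
qed

lemma val_upto_dvd: "int p ^ val_upto e c dvd c"
proof (cases "val_upto e c = 0")
  case False
  hence "val_upto e c \<in> {1..val_upto e c}" by auto
  thus ?thesis unfolding val_upto_set[symmetric] by simp
qed simp

text \<open>The size condition excludes divisibility by \<open>p ^ Suc e\<close>, so the truncated
  valuation is the true one.\<close>

lemma val_upto_exact:
  assumes "c \<noteq> 0" "\<bar>c\<bar> < int p ^ Suc e"
  obtains c' where "c = int p ^ val_upto e c * c'" "\<not> int p dvd c'"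
proof -
  obtain c' where c': "c = int p ^ val_upto e c * c'" by (rule dvdE[OF val_upto_dvd])
  have "\<not> int p dvd c'"
  proof
    assume "int p dvd c'"
    hence d: "int p ^ Suc (val_upto e c) dvd c" using c' by (metis mult_dvd_mono dvd_refl mult.commute power_Suc)
    show False
    proof (cases "val_upto e c < e")
      case True
      hence "Suc (val_upto e c) \<in> {h\<in>{1..e}. int p ^ h dvd c}" using d by auto
      thus False unfolding val_upto_set by simp
    next
      case False
      hence "val_upto e c = e" using val_upto_le[of e c] by simp
      hence "int p ^ Suc e dvd \<bar>c\<bar>" using d by simp
      hence "int p ^ Suc e \<le> \<bar>c\<bar>" using assms(1) by (intro zdvd_imp_le) auto
      thus False using assms(2) by simp
    qed
  qed
  thus ?thesis using that c' by blast
qed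

lemma val_bounded_linear_fps: "val_bounded e (int (val_upto e c)) (linear_fps (of_int c))"
  unfolding val_bounded_def
proof
  fix l
  obtain c' where c': "c = int p ^ val_upto e c * c'" by (rule dvdE[OF val_upto_dvd])
  have "of_int c * real p powi (- int (val_upto e c)) = (of_int c' :: real)"
    by (subst c') (use p0 in \<open>simp add: power_int_minus_divide\<close>)
  moreover have "p_integral p (real p powi (int e - int (val_upto e c)))" by (rule p_integral_powi) (use val_upto_le in auto)
  ultimately show "p_integral p (linear_fps (of_int c) $ l * real p powi (int (e * l) - int (val_upto e c)))"
    by (auto simp: linear_fps_nth)
qed

text \<open>With \<open>v\<close> the valuation of \<open>c\<close>, the coefficient of index
  \<open>l\<close> has valuation \<open>- (l + 1) * v\<close>, and \<open>v \<le> e\<close> turns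
  this into a bound with slope \<open>e\<close>.\<close>

lemma val_bounded_inv_linear_fps:
  assumes "c \<noteq> 0" "\<bar>c\<bar> < int p ^ Suc e"
  shows "val_bounded e (- int (val_upto e c)) (inv_linear_fps (of_int c))"
  unfolding val_bounded_def
proof
  fix l
  define v where "v = val_upto e c"
  obtain c' where c': "c = int p ^ v * c'" "\<not> int p dvd c'" using val_upto_exact[OF assms] unfolding v_def by metis
  have denom_rate: "c' \<noteq> 0" using c' by auto
  have "inv_linear_fps (of_int c) $ l * real p powi (int (e * l) + int v)
     = (-1) ^ l * (1 / of_int c') ^ Suc l * (real p powi (int (e * l) + int v) / (real p ^ v) ^ Suc l)"
    unfolding inv_linear_fps_def c'(1) by (simp add: power_mult_distrib field_simps)
  also have "real p powi (int (e * l) + int v) / (real p ^ v) ^ Suc l = real p powi (int (e * l) - int (v * l))"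
    using p0 by (simp add: power_int_add power_int_diff power_mult[symmetric] power_add flip: of_nat_mult)
  finally have "inv_linear_fps (of_int c) $ l * real p powi (int (e * l) + int v) =
     (-1) ^ l * (1 / of_int c') ^ Suc l * real p powi (int (e * l) - int (v * l))" .
  moreover have "p_integral p ((-1) ^ l * (1 / of_int c') ^ Suc l * real p powi (int (e * l) - int (v * l)))"
  proof (intro p_integral_mult p_integral_power p_integral_powi p_integral_inverse_int c'(2))
    show "p_integral p (-1)" using p_integral_of_int[of "-1"] by simp
    have "v * l \<le> e * l" unfolding v_def by (intro mult_right_mono val_upto_le) auto
    hence "int (v * l) \<le> int (e * l)" by (simp only: of_nat_le_iff)
    thus "0 \<le> int (e * l) - int (v * l)" by linarith
  qed
  ultimately show "p_integral p (inv_linear_fps (of_int c) $ l * real p powi (int (e * l) - - int (val_upto e c)))" by (simp add: v_def)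
qed

lemma val_bounded_const_int: "val_bounded e (int (val_upto e c)) (fps_const (of_int c))"
proof -
  obtain c' where c': "c = int p ^ val_upto e c * c'" by (rule dvdE[OF val_upto_dvd])
  have "(of_int c :: real) = real p powi (int (val_upto e c)) * of_int c'" by (subst c') simp
  thus ?thesis using val_bounded_const[of "of_int c'" e "int (val_upto e c)"] by simp
qed

lemma val_bounded_const_inv:
  assumes "c \<noteq> 0" "\<bar>c\<bar> < int p ^ Suc e"
  shows "val_bounded e (- int (val_upto e c)) (fps_const (1 / of_int c))"
proof -
  obtain c' where c': "c = int p ^ val_upto e c * c'" "\<not> int p dvd c'" using val_upto_exact[OF assms] by metis
  have "(1 / of_int c :: real) = real p powi (- int (val_upto e c)) * (1 / of_int c')"
    by (subst c'(1)) (use p0 in \<open>simp add: power_int_minus_divide\<close>)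
  thus ?thesis using val_bounded_const[OF p_integral_inverse_int[OF c'(2)], of e "- int (val_upto e c)"] by simp
qed

lemma card_dvd_interval:
  fixes P :: int assumes "P > 0" "B \<ge> A - 1"
  shows "int (card {c\<in>{A..B}. P dvd c}) = B div P - (A - 1) div P"
  using assms(2)
proof (induction B rule: int_ge_induct)
  case (step B)
  have "{A..B + 1} = insert (B + 1) {A..B}" using step by auto
  hence "{c\<in>{A..B+1}. P dvd c} = (if P dvd B + 1 then insert (B + 1) {c\<in>{A..B}. P dvd c} else {c\<in>{A..B}. P dvd c})"
    by auto
  moreover have "card (insert (B + 1) {c\<in>{A..B}. P dvd c}) = Suc (card {c\<in>{A..B}. P dvd c})"
    by (rule card_insert_disjoint) (rule finite_subset[of _ "{A..B}"], auto)
  ultimately have "int (card {c\<in>{A..B+1}. P dvd c}) = int (card {c\<in>{A..B}. P dvd c}) + (if P dvd B + 1 then 1 else 0)"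
    by (simp only: split: if_split) simp
  moreover have "(B + 1) div P = B div P + (if P dvd B + 1 then 1 else 0)"
  proof (cases "P dvd B + 1")
    case True
    then obtain k where k: "B + 1 = P * k" by (rule dvdE)
    have "B = P * (k - 1) + (P - 1)" using k by (simp add: algebra_simps)
    hence "B div P = k - 1" by (rule int_div_pos_eq) (use assms(1) in auto)
    thus ?thesis using True k assms(1) by simp
  next
    case False
    have "B mod P + 1 \<noteq> P"
    proof
      assume "B mod P + 1 = P"
      hence "B + 1 = P * (B div P) + P" using mult_div_mod_eq[of P B] by linarith
      hence "B + 1 = P * (B div P + 1)" by (simp add: distrib_left)
      thus False using False by simp
    qed
    moreover have "B mod P < P" "0 \<le> B mod P" using assms(1) by auto
    moreover have "B + 1 = P * (B div P) + (B mod P + 1)" using mult_div_mod_eq[of P B] by simp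
    ultimately have "(B + 1) div P = B div P" by (intro int_div_pos_eq[of _ _ _ "B mod P + 1"]) auto
    thus ?thesis using False by simp
  qed
  ultimately show ?case using step.IH by simp
qed simp

text \<open>Legendre's formula for an interval of integers, which may contain 0 and negative
  numbers: the valuations are summed by counting the multiples of each \<open>p ^ h\<close>.\<close>

lemma sum_val_upto_interval:
  assumes "B \<ge> A - 1"
  shows "(\<Sum>c\<in>{A..B}. int (val_upto e c)) = (\<Sum>h\<in>{1..e}. B div int p ^ h - (A - 1) div int p ^ h)"
proof -
  have "(\<Sum>c\<in>{A..B}. int (val_upto e c)) = (\<Sum>c\<in>{A..B}. \<Sum>h\<in>{1..e}. if int p ^ h dvd c then 1 else 0)"
    unfolding val_upto_def by (intro sum.cong refl) (simp add: sum.If_cases Int_def)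
  also have "\<dots> = (\<Sum>h\<in>{1..e}. \<Sum>c\<in>{A..B}. if int p ^ h dvd c then 1 else 0)" by (rule sum.swap)
  also have "\<dots> = (\<Sum>h\<in>{1..e}. int (card {c\<in>{A..B}. int p ^ h dvd c}))"
    by (intro sum.cong refl) (simp add: sum.If_cases Int_def)
  also have "\<dots> = (\<Sum>h\<in>{1..e}. B div int p ^ h - (A - 1) div int p ^ h)"
    using p by (intro sum.cong refl card_dvd_interval assms) (auto dest: prime_gt_0_nat)
  finally show ?thesis .
qed

end

lemma p_integral_imp_int:
  assumes "x = of_int a / of_int b" "b \<noteq> 0" "\<And>p. prime p \<Longrightarrow> p_integral p x"
  shows "\<exists>z::int. x = of_int z"
proof -
  define g where "g = gcd a b"
  obtain a' b' where ab: "a = g * a'" "b = g * b'" "coprime a' b'"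
    using assms(2) gcd_coprime_exists[of a b] unfolding g_def by (metis gcd_eq_0_iff mult.commute)
  have x: "x = of_int a' / of_int b'" "b' \<noteq> 0" using assms(1,2) ab by auto
  have "is_unit b'"
  proof (rule ccontr)
    assume "\<not> is_unit b'"
    then obtain r where r: "prime r" "r dvd b'" using x(2) by (metis prime_divisor_exists)
    define p where "p = nat r"
    have p: "prime p" "int p = r" using r(1) prime_gt_0_int[of r] by (auto simp: p_def)
    obtain c d :: int where cd: "\<not> int p dvd d" "x = of_int c / of_int d"
      using assms(3)[OF p(1)] unfolding p_integral_def by blast
    have "d \<noteq> 0" using cd(1) by auto
    hence "real_of_int a' * real_of_int d = real_of_int c * real_of_int b'"
      using x cd(2) frac_eq_eq[of "real_of_int b'" "real_of_int d" "real_of_int a'" "real_of_int c"] by simp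
    hence "real_of_int (a' * d) = real_of_int (c * b')" by simp
    hence "a' * d = c * b'" by (simp only: of_int_eq_iff)
    hence "r dvd a' * d" using r by simp
    hence "r dvd a'" using cd p r(1) by (auto simp: prime_dvd_mult_iff)
    thus False using r ab(3) by (meson coprime_common_divisor not_prime_unit)
  qed
  thus ?thesis using x(1) by (auto simp: zdvd1_eq abs_if intro: exI[of _ "-a'"] exI[of _ a'] split: if_splits)
qed

section \<open>Local expansion of one block of the denominator\<close>

lemma inv_linear_fps_linear_fps: "c \<noteq> 0 \<Longrightarrow> inv_linear_fps c * linear_fps c = 1"
  by (subst mult.commute) (rule linear_fps_inv_linear_fps)

lemma fps_const_prod: "fps_const (prod f S) = (\<Prod>c\<in>S. fps_const (f c :: real))"
  by (induction S rule: infinite_finite_induct) (simp_all add: fps_const_mult[symmetric] del: fps_const_mult)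

text \<open>The expansion in \<open>t + k\<close> of \<open>(\<beta> - \<alpha>)! * (t + k) / (\<Prod>j\<in>{\<alpha>..\<beta>}. t + j)\<close>.\<close>
definition block_fps :: "nat \<Rightarrow> nat \<Rightarrow> nat \<Rightarrow> real fps" where
  "block_fps \<alpha> \<beta> k = fps_const (fact (\<beta> - \<alpha>)) *
     (if k \<in> {\<alpha>..\<beta>} then \<Prod>j\<in>{\<alpha>..\<beta>}-{k}. inv_linear_fps (of_int (int j - int k))
      else fps_X * (\<Prod>j\<in>{\<alpha>..\<beta>}. inv_linear_fps (of_int (int j - int k))))"

lemma cancel_middle: "a * b = 1 \<Longrightarrow> x * a * (b * c) = x * c" for a b c x :: "'a :: comm_ring_1"
proof -
  assume "a * b = 1"
  moreover have "x * a * (b * c) = (a * b) * (x * c)" by (simp only: mult_ac)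
  ultimately show ?thesis by simp
qed

lemma cancel_middle': "a * b = 1 \<Longrightarrow> x * (y * a) * (b * c) = x * (y * c)" for a b c x :: "'a :: comm_ring_1"
  using cancel_middle[of a b "x * y" c] by (simp only: mult.assoc)

text \<open>This puts a block into the division-free form asked for by
  \<open>partial_fractions\<close>. A block without a pole at \<open>- k\<close> receives the factor
  \<open>t + k\<close>, which is \<open>fps_X\<close>, so that every block can be treated as if it
  had a simple pole at each \<open>- k\<close>.\<close>

lemma block_fps_mult:
  assumes "\<beta> \<le> n" "k \<le> n"
  shows "block_fps \<alpha> \<beta> k * (\<Prod>j\<in>{..n}-{k}. linear_fps (real j - real k)) =
    fps_const (fact (\<beta> - \<alpha>)) * (\<Prod>j\<in>{..n}-{\<alpha>..\<beta>}. linear_fps (real j - real k))"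
proof (cases "k \<in> {\<alpha>..\<beta>}")
  case True
  have "{..n}-{k} = ({\<alpha>..\<beta>}-{k}) \<union> ({..n}-{\<alpha>..\<beta>})" using assms True by auto
  hence "(\<Prod>j\<in>{..n}-{k}. linear_fps (real j - real k)) =
    (\<Prod>j\<in>{\<alpha>..\<beta>}-{k}. linear_fps (real j - real k)) * (\<Prod>j\<in>{..n}-{\<alpha>..\<beta>}. linear_fps (real j - real k))"
    by (simp only:) (rule prod.union_disjoint, auto)
  moreover have "(\<Prod>j\<in>{\<alpha>..\<beta>}-{k}. inv_linear_fps (of_int (int j - int k))) * (\<Prod>j\<in>{\<alpha>..\<beta>}-{k}. linear_fps (real j - real k)) = 1"
    unfolding prod.distrib[symmetric] by (rule prod.neutral) (auto simp: inv_linear_fps_linear_fps)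
  ultimately show ?thesis unfolding block_fps_def if_P[OF True] by (simp only: cancel_middle)
next
  case False
  have "{..n}-{k} = {\<alpha>..\<beta>} \<union> ({..n}-{\<alpha>..\<beta>}-{k})" using assms False by auto
  hence "(\<Prod>j\<in>{..n}-{k}. linear_fps (real j - real k)) =
    (\<Prod>j\<in>{\<alpha>..\<beta>}. linear_fps (real j - real k)) * (\<Prod>j\<in>{..n}-{\<alpha>..\<beta>}-{k}. linear_fps (real j - real k))"
    by (simp only:) (rule prod.union_disjoint, auto)
  moreover have "(\<Prod>j\<in>{\<alpha>..\<beta>}. inv_linear_fps (of_int (int j - int k))) * (\<Prod>j\<in>{\<alpha>..\<beta>}. linear_fps (real j - real k)) = 1"
    unfolding prod.distrib[symmetric] by (rule prod.neutral) (use False in \<open>auto simp: inv_linear_fps_linear_fps\<close>)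
  moreover have "(\<Prod>j\<in>{..n}-{\<alpha>..\<beta>}. linear_fps (real j - real k)) = fps_X * (\<Prod>j\<in>{..n}-{\<alpha>..\<beta>}-{k}. linear_fps (real j - real k))"
    by (subst prod.remove[of _ k]) (use assms False in \<open>auto simp: linear_fps_def\<close>)
  ultimately show ?thesis unfolding block_fps_def if_not_P[OF False] by (simp only: cancel_middle')
qed

text \<open>The substitution of \<open>- X\<close>. The reflection
  \<open>t \<mapsto> - n - t\<close> exchanges the poles \<open>- k\<close> and
  \<open>- (n - k)\<close> and reverses the sign of the local parameter.\<close>

definition fps_reflect :: "real fps \<Rightarrow> real fps" where "fps_reflect f = Abs_fps (\<lambda>l. (-1) ^ l * f $ l)"

lemma fps_reflect_mult: "fps_reflect (f * g) = fps_reflect f * fps_reflect g"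
proof (rule fps_ext)
  fix l
  have "(fps_reflect (f * g)) $ l = (\<Sum>i\<in>{0..l}. (-1) ^ l * (f $ i * g $ (l - i)))"
    by (simp add: fps_reflect_def fps_mult_nth sum_distrib_left)
  also have "\<dots> = (\<Sum>i\<in>{0..l}. ((-1) ^ i * f $ i) * ((-1) ^ (l - i) * g $ (l - i)))"
  proof (intro sum.cong refl)
    fix i assume "i \<in> {0..l}"
    hence "(-1::real) ^ l = (-1) ^ i * (-1) ^ (l - i)" by (simp flip: power_add)
    thus "(-1) ^ l * (f $ i * g $ (l - i)) = ((-1) ^ i * f $ i) * ((-1) ^ (l - i) * g $ (l - i))" by simp
  qed
  also have "\<dots> = (fps_reflect f * fps_reflect g) $ l" by (simp add: fps_reflect_def fps_mult_nth)
  finally show "fps_reflect (f * g) $ l = (fps_reflect f * fps_reflect g) $ l" .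
qed

lemma fps_reflect_1: "fps_reflect 1 = 1" by (rule fps_ext) (simp add: fps_reflect_def)

lemma fps_reflect_prod: "fps_reflect (prod f S) = (\<Prod>i\<in>S. fps_reflect (f i))"
  by (induction S rule: infinite_finite_induct) (simp_all add: fps_reflect_mult fps_reflect_1)

lemma fps_reflect_power: "fps_reflect (f ^ m) = fps_reflect f ^ m"
  by (induction m) (simp_all add: fps_reflect_mult fps_reflect_1)

lemma fps_reflect_const: "fps_reflect (fps_const c) = fps_const c" by (rule fps_ext) (simp add: fps_reflect_def)

lemma fps_reflect_X: "fps_reflect fps_X = - fps_X" by (rule fps_ext) (simp add: fps_reflect_def)

lemma fps_reflect_linear_fps: "fps_reflect (linear_fps c) = - linear_fps (- c)"
  by (rule fps_ext) (simp add: fps_reflect_def linear_fps_nth)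

lemma fps_reflect_inv_linear_fps: "fps_reflect (inv_linear_fps c) = - inv_linear_fps (- c)"
proof (rule fps_ext)
  fix l
  show "fps_reflect (inv_linear_fps c) $ l = (- inv_linear_fps (- c)) $ l"
    by (cases "even l") (simp_all add: fps_reflect_def inv_linear_fps_def uminus_power_if)
qed

text \<open>If \<open>k\<close> lies in the block there are \<open>\<beta> - \<alpha>\<close> sign
  changes; otherwise there are \<open>\<beta> - \<alpha> + 1\<close>, and \<open>fps_X\<close> adds
  one more. Both numbers are even.\<close>

lemma fps_reflect_block_fps:
  assumes "\<alpha> + \<beta> = n" "k \<le> n" "even (\<beta> - \<alpha>)" "\<alpha> \<le> \<beta>"
  shows "fps_reflect (block_fps \<alpha> \<beta> k) = block_fps \<alpha> \<beta> (n - k)"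
proof (cases "k \<in> {\<alpha>..\<beta>}")
  case True
  have "(\<Prod>j\<in>{\<alpha>..\<beta>}-{k}. fps_reflect (inv_linear_fps (of_int (int j - int k)))) =
      (\<Prod>j\<in>{\<alpha>..\<beta>}-{k}. (-1) * inv_linear_fps (of_int (int (n - j) - int (n - k))))"
    unfolding fps_reflect_inv_linear_fps by (intro prod.cong refl) (use assms in \<open>auto simp: of_nat_diff algebra_simps\<close>)
  also have "\<dots> = (-1) ^ card ({\<alpha>..\<beta>}-{k}) * (\<Prod>j\<in>{\<alpha>..\<beta>}-{k}. inv_linear_fps (of_int (int (n - j) - int (n - k))))"
    by (simp only: prod.distrib prod_constant)
  also have "card ({\<alpha>..\<beta>}-{k}) = \<beta> - \<alpha>" using True by simp
  also have "(\<Prod>j\<in>{\<alpha>..\<beta>}-{k}. inv_linear_fps (of_int (int (n - j) - int (n - k)))) = (\<Prod>j\<in>{\<alpha>..\<beta>}-{n - k}. inv_linear_fps (of_int (int j - int (n - k))))"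
    by (rule prod.reindex_bij_witness[of _ "\<lambda>j. n - j" "\<lambda>j. n - j"]) (use assms True in auto)
  finally have "(\<Prod>j\<in>{\<alpha>..\<beta>}-{k}. fps_reflect (inv_linear_fps (of_int (int j - int k)))) = (\<Prod>j\<in>{\<alpha>..\<beta>}-{n - k}. inv_linear_fps (of_int (int j - int (n - k))))"
    using assms by simp
  moreover have T: "n - k \<in> {\<alpha>..\<beta>}" using True assms by auto
  ultimately show ?thesis unfolding block_fps_def fps_reflect_mult fps_reflect_const if_P[OF True] if_P[OF T] fps_reflect_prod by simp
next
  case False
  have "(\<Prod>j\<in>{\<alpha>..\<beta>}. fps_reflect (inv_linear_fps (of_int (int j - int k)))) =
      (\<Prod>j\<in>{\<alpha>..\<beta>}. (-1) * inv_linear_fps (of_int (int (n - j) - int (n - k))))"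
    unfolding fps_reflect_inv_linear_fps by (intro prod.cong refl) (use assms in \<open>auto simp: of_nat_diff algebra_simps\<close>)
  also have "\<dots> = (-1) ^ card {\<alpha>..\<beta>} * (\<Prod>j\<in>{\<alpha>..\<beta>}. inv_linear_fps (of_int (int (n - j) - int (n - k))))"
    by (simp only: prod.distrib prod_constant)
  also have "card {\<alpha>..\<beta>} = Suc (\<beta> - \<alpha>)" using assms by simp
  also have "(\<Prod>j\<in>{\<alpha>..\<beta>}. inv_linear_fps (of_int (int (n - j) - int (n - k)))) = (\<Prod>j\<in>{\<alpha>..\<beta>}. inv_linear_fps (of_int (int j - int (n - k))))"
    by (rule prod.reindex_bij_witness[of _ "\<lambda>j. n - j" "\<lambda>j. n - j"]) (use assms in auto)
  finally have "(\<Prod>j\<in>{\<alpha>..\<beta>}. fps_reflect (inv_linear_fps (of_int (int j - int k)))) = - (\<Prod>j\<in>{\<alpha>..\<beta>}. inv_linear_fps (of_int (int j - int (n - k))))"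
    using assms by simp
  moreover have F: "n - k \<notin> {\<alpha>..\<beta>}" using False assms by auto
  ultimately show ?thesis
    unfolding block_fps_def fps_reflect_mult fps_reflect_const if_not_P[OF False] if_not_P[OF F] fps_reflect_X fps_reflect_prod by simp
qed

text \<open>The contribution of \<open>P = p ^ h\<close> to the valuation of a block. For
  \<open>k\<close> inside the block it is that of the binomial coefficient of
  \<open>\<beta> - \<alpha>\<close> over \<open>k - \<alpha>\<close>. Outside, one of the subtracted
  quotients is negative.\<close>

definition block_val :: "nat \<Rightarrow> nat \<Rightarrow> nat \<Rightarrow> int \<Rightarrow> int" where
  "block_val \<alpha> \<beta> k P = (int \<beta> - int \<alpha>) div P - (int k - int \<alpha>) div P - (int \<beta> - int k) div P"

lemma div_add_le: "(x::int) div P + y div P \<le> (x + y) div P" if "P > 0" for x y P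
proof -
  have "(x div P + y div P) * P \<le> x + y"
    unfolding distrib_right
    using div_mult_mod_eq[of x P] div_mult_mod_eq[of y P] pos_mod_sign[OF that, of x] pos_mod_sign[OF that, of y]
    by linarith
  from zdiv_mono1[OF this that] show ?thesis using that by simp
qed

lemma int_div_less: "z div P < x" if "P > 0" "z < x * P" for x z P :: int
proof -
  have "(z div P) * P < x * P"
    using div_mult_mod_eq[of z P] pos_mod_sign[OF that(1), of z] that(2) by linarith
  thus ?thesis using that(1) by (simp add: mult_less_cancel_right)
qed

lemma block_val_nonneg: "P > 0 \<Longrightarrow> block_val \<alpha> \<beta> k P \<ge> 0"
  using div_add_le[of P "int k - int \<alpha>" "int \<beta> - int k"] by (simp add: block_val_def)

lemma neg_div: "(- x - 1) div P = - (x div P) - 1" if "P > 0" for x P :: int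
proof (rule int_div_pos_eq[of _ _ _ "P - 1 - x mod P"])
  show "- x - 1 = P * (- (x div P) - 1) + (P - 1 - x mod P)"
    using mult_div_mod_eq[of P x] by (simp add: algebra_simps)
qed (use that pos_mod_bound[OF that, of x] pos_mod_sign[OF that, of x] in linarith)+

context
  fixes p :: nat assumes p: "prime p"
begin

lemma val_bounded_fact: "val_bounded p e (\<Sum>c\<in>{1..int m}. int (val_upto p e c)) (fps_const (fact m))"
proof -
  have "(fact m :: real) = (\<Prod>c\<in>{1..int m}. of_int c)"
    unfolding fact_prod by (subst of_nat_prod) (rule prod.reindex_bij_witness[of _ nat int], auto)
  hence "fps_const (fact m :: real) = (\<Prod>c\<in>{1..int m}. fps_const (of_int c))"
    by (simp only: fps_const_prod)
  thus ?thesis by (simp only:) (rule val_bounded_prod[OF p val_bounded_const_int[OF p]])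
qed

lemma val_bounded_inv_fact:
  assumes "int m < int p ^ Suc e"
  shows "val_bounded p e (- (\<Sum>c\<in>{1..int m}. int (val_upto p e c))) (fps_const (1 / fact m))"
proof -
  have "(1 / fact m :: real) = (\<Prod>c\<in>{1..int m}. 1 / of_int c)"
    unfolding fact_prod prod_dividef by (subst of_nat_prod) (simp, rule prod.reindex_bij_witness[of _ nat int], auto)
  hence "fps_const (1 / fact m :: real) = (\<Prod>c\<in>{1..int m}. fps_const (1 / of_int c))"
    by (simp only: fps_const_prod)
  thus ?thesis unfolding sum_negf[symmetric]
    by (simp only:) (rule val_bounded_prod[OF p val_bounded_const_inv[OF p]], use assms in auto)
qed

lemma val_bounded_X: "val_bounded p e (int e) fps_X"
  using val_bounded_linear_fps[OF p, of e 0] by (simp add: linear_fps_def val_upto_0[OF p])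

text \<open>The factorial contributes the quotients of Legendre's formula, and the inverse linear
  factors lose \<open>s\<close>. In \<open>int e - s\<close> the summand \<open>e\<close> makes up
  for the term \<open>j = k\<close> of \<open>s\<close>, where the truncated valuation of 0 is
  \<open>e\<close>, if \<open>k\<close> lies in the block; otherwise it is the valuation of
  \<open>fps_X\<close>.\<close>

lemma val_bounded_block_fps:
  assumes "\<beta> \<le> n" "k \<le> n" "int n < int p ^ Suc e" "\<alpha> \<le> \<beta>"
  shows "val_bounded p e (\<Sum>h\<in>{1..e}. block_val \<alpha> \<beta> k (int p ^ h)) (block_fps \<alpha> \<beta> k)"
proof -
  define s where "s = (\<Sum>j\<in>{\<alpha>..\<beta>}. int (val_upto p e (int j - int k)))"
  have fin: "val_bounded p e (- int (val_upto p e (int j - int k))) (inv_linear_fps (of_int (int j - int k)))"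
    if "j \<in> {\<alpha>..\<beta>}" "j \<noteq> k" for j
    by (rule val_bounded_inv_linear_fps[OF p]) (use that assms in auto)
  have 1: "val_bounded p e (int e - s) (if k \<in> {\<alpha>..\<beta>} then \<Prod>j\<in>{\<alpha>..\<beta>}-{k}. inv_linear_fps (of_int (int j - int k))
      else fps_X * (\<Prod>j\<in>{\<alpha>..\<beta>}. inv_linear_fps (of_int (int j - int k))))"
  proof (cases "k \<in> {\<alpha>..\<beta>}")
    case True
    have "val_bounded p e (\<Sum>j\<in>{\<alpha>..\<beta>}-{k}. - int (val_upto p e (int j - int k))) (\<Prod>j\<in>{\<alpha>..\<beta>}-{k}. inv_linear_fps (of_int (int j - int k)))"
      by (rule val_bounded_prod[OF p]) (use fin in auto)
    moreover have "s = int e + (\<Sum>j\<in>{\<alpha>..\<beta>}-{k}. int (val_upto p e (int j - int k)))"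
      unfolding s_def by (subst sum.remove[of _ k]) (use True in \<open>auto simp: val_upto_0[OF p]\<close>)
    ultimately show ?thesis unfolding if_P[OF True] by (simp add: sum_negf)
  next
    case False
    have "val_bounded p e (int e + (\<Sum>j\<in>{\<alpha>..\<beta>}. - int (val_upto p e (int j - int k)))) (fps_X * (\<Prod>j\<in>{\<alpha>..\<beta>}. inv_linear_fps (of_int (int j - int k))))"
      by (intro val_bounded_mult[OF p] val_bounded_X val_bounded_prod[OF p]) (use fin False in auto)
    thus ?thesis unfolding if_not_P[OF False] by (simp add: sum_negf s_def)
  qed
  have "s = (\<Sum>c\<in>{int \<alpha> - int k..int \<beta> - int k}. int (val_upto p e c))"
    unfolding s_def by (rule sum.reindex_bij_witness[of _ "\<lambda>c. nat (c + int k)" "\<lambda>j. int j - int k"]) auto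
  also have "\<dots> = (\<Sum>h\<in>{1..e}. (int \<beta> - int k) div int p ^ h - (int \<alpha> - int k - 1) div int p ^ h)"
    by (rule sum_val_upto_interval[OF p]) (use assms in auto)
  also have "\<dots> = (\<Sum>h\<in>{1..e}. (int \<beta> - int k) div int p ^ h + (int k - int \<alpha>) div int p ^ h + 1)"
  proof (intro sum.cong refl)
    fix h
    have "int p ^ h > 0" using p by (auto dest: prime_gt_0_nat)
    from neg_div[OF this, of "int k - int \<alpha>"]
    show "(int \<beta> - int k) div int p ^ h - (int \<alpha> - int k - 1) div int p ^ h = (int \<beta> - int k) div int p ^ h + (int k - int \<alpha>) div int p ^ h + 1"
      by simp
  qed
  finally have s: "s = (\<Sum>h\<in>{1..e}. (int \<beta> - int k) div int p ^ h + (int k - int \<alpha>) div int p ^ h + 1)" .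
  have f: "(\<Sum>c\<in>{1..int (\<beta> - \<alpha>)}. int (val_upto p e c)) = (\<Sum>h\<in>{1..e}. (int \<beta> - int \<alpha>) div int p ^ h)"
    by (subst sum_val_upto_interval[OF p]) (use assms in \<open>auto simp: of_nat_diff\<close>)
  have "(\<Sum>c\<in>{1..int (\<beta> - \<alpha>)}. int (val_upto p e c)) + (int e - s) = (\<Sum>h\<in>{1..e}. block_val \<alpha> \<beta> k (int p ^ h))"
    unfolding f s block_val_def by (simp add: sum.distrib sum_subtractf)
  moreover have "val_bounded p e ((\<Sum>c\<in>{1..int (\<beta> - \<alpha>)}. int (val_upto p e c)) + (int e - s)) (block_fps \<alpha> \<beta> k)"
    unfolding block_fps_def by (rule val_bounded_mult[OF p val_bounded_fact 1])
  ultimately show ?thesis by simp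
qed

text \<open>Among \<open>n\<close> consecutive integers at least \<open>n div p ^ h\<close> are
  multiples of \<open>p ^ h\<close>, so the valuations of the product make up for those of
  \<open>n!\<close>, also in the presence of the variable.\<close>

lemma val_bounded_consecutive:
  assumes "int n < int p ^ Suc e" "B = A + int n - 1"
  shows "val_bounded p e 0 (fps_const (1 / fact n) * (\<Prod>c\<in>{A..B}. linear_fps (of_int c)))"
proof -
  have "val_bounded p e (- (\<Sum>c\<in>{1..int n}. int (val_upto p e c)) + (\<Sum>c\<in>{A..B}. int (val_upto p e c)))
      (fps_const (1 / fact n) * (\<Prod>c\<in>{A..B}. linear_fps (of_int c)))"
    by (intro val_bounded_mult[OF p] val_bounded_inv_fact[OF assms(1)] val_bounded_prod[OF p] val_bounded_linear_fps[OF p])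
  moreover have "(\<Sum>c\<in>{1..int n}. int (val_upto p e c)) \<le> (\<Sum>c\<in>{A..B}. int (val_upto p e c))"
  proof -
    have "(\<Sum>c\<in>{1..int n}. int (val_upto p e c)) = (\<Sum>h\<in>{1..e}. int n div int p ^ h - (1 - 1) div int p ^ h)"
      by (rule sum_val_upto_interval[OF p]) auto
    also have "\<dots> \<le> (\<Sum>h\<in>{1..e}. B div int p ^ h - (A - 1) div int p ^ h)"
    proof (rule sum_mono)
      fix h
      have "int p ^ h > 0" using p by (auto dest: prime_gt_0_nat)
      from div_add_le[OF this, of "A - 1" "int n"]
      show "int n div int p ^ h - (1 - 1) div int p ^ h \<le> B div int p ^ h - (A - 1) div int p ^ h"
        unfolding assms(2) by (simp add: algebra_simps)
    qed
    also have "\<dots> = (\<Sum>c\<in>{A..B}. int (val_upto p e c))"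
      by (rule sum_val_upto_interval[OF p, symmetric]) (use assms in auto)
    finally show ?thesis .
  qed
  ultimately show ?thesis by (elim val_bounded_mono[OF p]) simp
qed

end

text \<open>This is where the primes just below \<open>20 \<nu> / m\<close> save a factor: the blocks \<open>[0, 20 \<nu>]\<close>
  and \<open>[\<nu>, 19 \<nu>]\<close> cannot both have a \<open>p\<close>-free coefficient at the same place.\<close>
lemma block_val_saving:
  assumes "1 \<le> m" "m \<le> 10" "m * p \<le> 20 * \<nu>" "19 * \<nu> < m * p"
  shows "block_val 0 (20 * \<nu>) k (int p) + block_val \<nu> (19 * \<nu>) k (int p) \<ge> 1"
proof (cases "block_val 0 (20 * \<nu>) k (int p) \<ge> 1")
  case True
  have "p > 0" using assms by (cases p) auto
  thus ?thesis using True block_val_nonneg[of "int p" \<nu> "19 * \<nu>" k] by simp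
next
  case False
  define P where "P = int p"
  define v where "v = int \<nu>"
  define M where "M = int m"
  define K where "K = int k"
  have P: "P > 0" using assms by (cases p) (auto simp: P_def)
  have M: "1 \<le> M" "M \<le> 10" "M * P \<le> 20 * v" "19 * v < M * P"
    using assms by (auto simp: M_def P_def v_def simp flip: of_nat_mult)
  \<comment> \<open>As \<open>19 * v < M * P\<close>, it suffices that
    \<open>20 * M \<le> 19 * (M + 1)\<close>, that is \<open>M \<le> 19\<close>.\<close>
  have "20 * v < (M + 1) * P"
  proof -
    have "19 * (20 * v) < 20 * (M * P)" using M(4) by simp
    also have "20 * (M * P) \<le> 19 * ((M + 1) * P)"
    proof -
      have "M * P \<le> 19 * P" using M(2) P by (intro mult_right_mono) auto
      thus ?thesis by (simp add: algebra_simps)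
    qed
    finally show ?thesis by linarith
  qed
  hence d20: "(20 * v) div P = M"
    using M(3) by (intro int_div_pos_eq[of _ _ _ "20 * v - M * P"]) (auto simp: algebra_simps)
  define x where "x = K div P"
  define y where "y = (20 * v - K) div P"
  have xr: "x * P \<le> K" unfolding x_def using div_mult_mod_eq[of K P] pos_mod_sign[OF P, of K] by linarith
  have yr: "y * P \<le> 20 * v - K" unfolding y_def using div_mult_mod_eq[of "20 * v - K" P] pos_mod_sign[OF P, of "20 * v - K"] by linarith
  have "block_val 0 (20 * \<nu>) k (int p) \<ge> 0" by (rule block_val_nonneg) (use P in \<open>simp add: P_def\<close>)
  hence "block_val 0 (20 * \<nu>) k (int p) = 0" using False by simp
  hence xy: "x + y = M" using d20 by (simp add: block_val_def x_def y_def P_def v_def K_def)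
  hence xyP: "x * P + y * P = M * P" by (simp flip: distrib_right)
  \<comment> \<open>Without a saving in the full block, \<open>x * P + y * P = M * P\<close> exceeds
    \<open>19 * v\<close>. Shortening by \<open>v\<close> at either end then lowers both quotients
    \<open>x\<close> and \<open>y\<close>, whereas the quotient of the total length drops by at most
    one.\<close>
  have "K - v < x * P" using yr xyP M(4) by linarith
  hence "(K - v) div P < x" by (rule int_div_less[OF P])
  moreover have "19 * v - K < y * P" using xr xyP M(4) by linarith
  hence "(19 * v - K) div P < y" by (rule int_div_less[OF P])
  \<comment> \<open>The origin of the bound 10: the step needs
    \<open>(M - 1) * 20 \<le> 18 * M\<close>, which is \<open>M \<le> 10\<close>.\<close>
  moreover have "M - 1 \<le> (18 * v) div P"
  proof -
    have "M * ((M - 1) * P) = (M - 1) * (M * P)" by simp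
    also have "\<dots> \<le> (M - 1) * (20 * v)" using M by (intro mult_left_mono) auto
    also have "\<dots> \<le> M * (18 * v)"
    proof -
      have "M * v \<le> 10 * v" using M by (intro mult_right_mono) (auto simp: v_def)
      thus ?thesis by (simp add: algebra_simps)
    qed
    finally have "(M - 1) * P \<le> 18 * v" using M by simp
    from zdiv_mono1[OF this P] show ?thesis using P by simp
  qed
  ultimately have "(18 * v) div P - (K - v) div P - (19 * v - K) div P \<ge> 1" using xy by linarith
  moreover have "block_val \<nu> (19 * \<nu>) k (int p) = (18 * v) div P - (K - v) div P - (19 * v - K) div P"
    by (simp add: block_val_def v_def P_def K_def)
  moreover have "block_val 0 (20 * \<nu>) k (int p) \<ge> 0" by (rule block_val_nonneg) (use P in \<open>simp add: P_def\<close>)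
  ultimately show ?thesis by linarith
qed

section \<open>Absolute size of the coefficients\<close>

definition weighted_norm :: "nat \<Rightarrow> real fps \<Rightarrow> real" where
  "weighted_norm A f = (\<Sum>l\<le>A. \<bar>f $ l\<bar> / 2 ^ l)"

lemma weighted_norm_nonneg: "weighted_norm A f \<ge> 0" unfolding weighted_norm_def by (intro sum_nonneg) auto

lemma weighted_norm_coeff: "l \<le> A \<Longrightarrow> \<bar>f $ l\<bar> \<le> 2 ^ l * weighted_norm A f"
proof -
  assume "l \<le> A"
  hence "\<bar>f $ l\<bar> / 2 ^ l \<le> weighted_norm A f" unfolding weighted_norm_def
    by (intro member_le_sum[of l "{..A}" "\<lambda>l. \<bar>f $ l\<bar> / 2 ^ l"]) auto
  thus ?thesis by (simp add: field_simps)
qed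

text \<open>The norm sums absolute values at radius 1/2, truncated at \<open>A\<close>. The Cauchy
  product runs over \<open>i + j \<le> A\<close>; completing this triangle to a square only adds
  nonnegative terms.\<close>

lemma weighted_norm_mult: "weighted_norm A (f * g) \<le> weighted_norm A f * weighted_norm A g"
proof -
  have "weighted_norm A (f * g) \<le> (\<Sum>l\<le>A. \<Sum>i\<in>{0..l}. (\<bar>f $ i\<bar> / 2 ^ i) * (\<bar>g $ (l - i)\<bar> / 2 ^ (l - i)))"
    unfolding weighted_norm_def
  proof (rule sum_mono)
    fix l
    have "\<bar>(f * g) $ l\<bar> / 2 ^ l \<le> (\<Sum>i\<in>{0..l}. \<bar>f $ i * g $ (l - i)\<bar>) / 2 ^ l"
      unfolding fps_mult_nth by (intro divide_right_mono sum_abs) auto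
    also have "\<dots> = (\<Sum>i\<in>{0..l}. (\<bar>f $ i\<bar> / 2 ^ i) * (\<bar>g $ (l - i)\<bar> / 2 ^ (l - i)))"
      unfolding sum_divide_distrib
    proof (intro sum.cong refl)
      fix i assume "i \<in> {0..l}"
      hence "(2::real) ^ l = 2 ^ i * 2 ^ (l - i)" by (simp flip: power_add)
      thus "\<bar>f $ i * g $ (l - i)\<bar> / 2 ^ l = (\<bar>f $ i\<bar> / 2 ^ i) * (\<bar>g $ (l - i)\<bar> / 2 ^ (l - i))"
        by (simp add: abs_mult)
    qed
    finally show "\<bar>(f * g) $ l\<bar> / 2 ^ l \<le> (\<Sum>i\<in>{0..l}. (\<bar>f $ i\<bar> / 2 ^ i) * (\<bar>g $ (l - i)\<bar> / 2 ^ (l - i)))" .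
  qed
  also have "\<dots> = (\<Sum>(l,i)\<in>Sigma {..A} (\<lambda>l. {0..l}). (\<bar>f $ i\<bar> / 2 ^ i) * (\<bar>g $ (l - i)\<bar> / 2 ^ (l - i)))"
    by (rule sum.Sigma) auto
  also have "\<dots> = (\<Sum>(i,j)\<in>{(i,j). i + j \<le> A}. (\<bar>f $ i\<bar> / 2 ^ i) * (\<bar>g $ j\<bar> / 2 ^ j))"
    by (rule sum.reindex_bij_witness[of _ "\<lambda>(i,j). (i + j, i)" "\<lambda>(l,i). (i, l - i)"]) auto
  also have "\<dots> \<le> (\<Sum>(i,j)\<in>{..A} \<times> {..A}. (\<bar>f $ i\<bar> / 2 ^ i) * (\<bar>g $ j\<bar> / 2 ^ j))"
    by (rule sum_mono2) auto
  also have "\<dots> = weighted_norm A f * weighted_norm A g"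
    unfolding weighted_norm_def sum_product sum.cartesian_product by simp
  finally show ?thesis .
qed

lemma weighted_norm_const: "weighted_norm A (fps_const c) = \<bar>c\<bar>"
  unfolding weighted_norm_def by (subst sum.mono_neutral_right[of _ "{0}"]) auto

lemma weighted_norm_X: "weighted_norm A fps_X \<le> 1 / 2"
proof -
  have "weighted_norm A fps_X \<le> (\<Sum>l\<in>{1::nat}. 1 / 2)"
    unfolding weighted_norm_def
  proof (cases "A \<ge> 1")
    case True thus "(\<Sum>l\<le>A. \<bar>(fps_X :: real fps) $ l\<bar> / 2 ^ l) \<le> (\<Sum>l\<in>{1::nat}. 1 / 2)"
      by (subst sum.mono_neutral_right[of _ "{1}"]) (auto simp: fps_X_nth)
  qed (auto simp: fps_X_nth not_le)
  thus ?thesis by simp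
qed

lemma weighted_norm_add: "weighted_norm A (f + g) \<le> weighted_norm A f + weighted_norm A g"
  unfolding weighted_norm_def sum.distrib[symmetric] add_divide_distrib[symmetric]
  by (intro sum_mono divide_right_mono) (auto simp: abs_triangle_ineq)

lemma weighted_norm_linear_fps: "weighted_norm A (linear_fps c) \<le> \<bar>c\<bar> + 1 / 2"
  unfolding linear_fps_def using weighted_norm_add[of A "fps_const c" fps_X] weighted_norm_X[of A] by (simp add: weighted_norm_const)

text \<open>A geometric series at radius 1/2. The radius stays below the distance 1 between
  neighbouring poles, so \<open>\<bar>c\<bar> - 1 / 2\<close> is positive for every integer
  \<open>c\<close> other than 0.\<close>

lemma weighted_norm_inv_linear_fps: assumes c: "\<bar>c\<bar> \<ge> 1" shows "weighted_norm A (inv_linear_fps c) \<le> 1 / (\<bar>c\<bar> - 1 / 2)"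
proof -
  define x where "x = 1 / (2 * \<bar>c\<bar>)"
  have x: "0 < x" "x < 1" using c by (auto simp: x_def field_simps)
  have "weighted_norm A (inv_linear_fps c) = (\<Sum>l\<le>A. (1 / \<bar>c\<bar>) * x ^ l)"
    unfolding weighted_norm_def inv_linear_fps_def x_def
    by (intro sum.cong refl) (simp add: power_abs abs_mult power_mult_distrib power_divide field_simps)
  also have "\<dots> = (1 / \<bar>c\<bar>) * (\<Sum>l<Suc A. x ^ l)" by (simp add: sum_distrib_left lessThan_Suc_atMost)
  also have "(\<Sum>l<Suc A. x ^ l) = (1 - x ^ Suc A) / (1 - x)" using x by (subst geometric_sum) (auto simp: field_simps)
  also have "\<dots> \<le> 1 / (1 - x)" using x by (intro divide_right_mono) auto
  hence "(1 / \<bar>c\<bar>) * ((1 - x ^ Suc A) / (1 - x)) \<le> (1 / \<bar>c\<bar>) * (1 / (1 - x))" by (intro mult_left_mono) auto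
  also have "(1 / \<bar>c\<bar>) * (1 / (1 - x)) = 1 / (\<bar>c\<bar> - 1 / 2)" using c by (simp add: x_def field_simps)
  finally show ?thesis .
qed

lemma weighted_norm_1: "weighted_norm A 1 = 1" using weighted_norm_const[of A 1] by simp

lemma weighted_norm_prod: "weighted_norm A (prod f S) \<le> (\<Prod>i\<in>S. weighted_norm A (f i))"
proof (induction S rule: infinite_finite_induct)
  case (insert x S)
  have "weighted_norm A (prod f (insert x S)) \<le> weighted_norm A (f x) * weighted_norm A (prod f S)"
    using insert.hyps by (simp add: weighted_norm_mult)
  also have "\<dots> \<le> weighted_norm A (f x) * (\<Prod>i\<in>S. weighted_norm A (f i))"
    by (intro mult_left_mono insert.IH weighted_norm_nonneg)
  finally show ?case using insert.hyps by simp
qed (simp_all add: weighted_norm_1)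

lemma weighted_norm_power: "weighted_norm A (f ^ m) \<le> weighted_norm A f ^ m"
proof (induction m)
  case (Suc m)
  have "weighted_norm A (f ^ Suc m) \<le> weighted_norm A f * weighted_norm A (f ^ m)" by (simp add: weighted_norm_mult)
  also have "\<dots> \<le> weighted_norm A f * weighted_norm A f ^ m" by (intro mult_left_mono Suc.IH weighted_norm_nonneg)
  finally show ?case by simp
qed (simp add: weighted_norm_1)

text \<open>Moving the factors by 1/2 changes the factorial only by a factor linear in
  \<open>m\<close>, which is invisible at the exponential scale.\<close>

lemma prod_half_ge: "(\<Prod>c\<in>{1..m}. real c - 1 / 2) \<ge> fact m / (2 * real (m + 1))"
proof (induction m)
  case (Suc m)
  have "fact (Suc m) / (2 * real (Suc m + 1)) = fact m / (2 * real (m + 1)) * (real (Suc m) * real (m + 1) / real (m + 2))"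
    by (simp add: field_simps del: of_nat_Suc)
  also have "\<dots> \<le> fact m / (2 * real (m + 1)) * (real (Suc m) - 1 / 2)"
    by (intro mult_left_mono) (auto simp: field_simps)
  also have "\<dots> \<le> (\<Prod>c\<in>{1..m}. real c - 1 / 2) * (real (Suc m) - 1 / 2)"
    by (intro mult_right_mono Suc.IH) auto
  finally show ?case by simp
qed simp

lemma prod_shift_half_ge: "(\<Prod>c\<in>{u+1..u+m+1}. real c - 1 / 2) \<ge> fact m / 2"
proof -
  have "(\<Prod>c\<in>{u+1..u+m+1}. real c - 1 / 2) = (\<Prod>c\<in>{1..m+1}. real (c + u) - 1 / 2)"
    by (rule prod.reindex_bij_witness[of _ "\<lambda>c. c + u" "\<lambda>c. c - u"]) auto
  also have "\<dots> \<ge> (\<Prod>c\<in>{1..m+1}. real c - 1 / 2)"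
    by (rule prod_mono) auto
  also have "(\<Prod>c\<in>{1..m+1}. real c - 1 / 2) \<ge> fact m / 2"
  proof (induction m)
    case (Suc m)
    have "fact (Suc m) / 2 \<le> fact m / 2 * (real (m + 2) - 1 / 2)" by (simp add: field_simps)
    also have "\<dots> \<le> (\<Prod>c\<in>{1..m+1}. real c - 1 / 2) * (real (m + 2) - 1 / 2)"
      by (intro mult_right_mono Suc.IH) auto
    finally show ?case by simp
  qed simp
  finally show ?thesis .
qed

text \<open>Inside the block the norm is, up to a polynomial factor, the binomial coefficient of
  \<open>\<beta> - \<alpha>\<close> over \<open>k - \<alpha>\<close>, hence at most
  \<open>2 ^ (\<beta> - \<alpha>)\<close>; these powers of 2 are the source of the
  \<open>ln 2\<close> in the final bound. Outside the block the norm is at most 1.\<close>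

lemma weighted_norm_block_fps:
  assumes "\<alpha> \<le> \<beta>" "\<beta> \<le> n" "k \<le> n"
  shows "weighted_norm A (block_fps \<alpha> \<beta> k) \<le> 4 * real (n + 1) ^ 2 * 2 ^ (\<beta> - \<alpha>)"
proof -
  define m where "m = \<beta> - \<alpha>"
  have fin: "weighted_norm A (inv_linear_fps (of_int (int j - int k))) \<le> 1 / (\<bar>real j - real k\<bar> - 1 / 2)" if "j \<noteq> k" for j
  proof -
    have "\<bar>real_of_int (int j - int k)\<bar> \<ge> 1" using that by linarith
    from weighted_norm_inv_linear_fps[OF this, of A] show ?thesis by simp
  qed
  have pr: "weighted_norm A (\<Prod>j\<in>J. inv_linear_fps (of_int (int j - int k))) \<le> 1 / (\<Prod>j\<in>J. \<bar>real j - real k\<bar> - 1 / 2)"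
    if "k \<notin> J" for J
  proof -
    have "weighted_norm A (\<Prod>j\<in>J. inv_linear_fps (of_int (int j - int k))) \<le> (\<Prod>j\<in>J. weighted_norm A (inv_linear_fps (of_int (int j - int k))))"
      by (rule weighted_norm_prod)
    also have "\<dots> \<le> (\<Prod>j\<in>J. 1 / (\<bar>real j - real k\<bar> - 1 / 2))"
      by (rule prod_mono) (use that fin weighted_norm_nonneg in metis)
    finally show ?thesis by (simp add: prod_dividef)
  qed
  show ?thesis
  proof (cases "k \<in> {\<alpha>..\<beta>}")
    case True
    define x where "x = k - \<alpha>"
    define y where "y = \<beta> - k"
    have xy: "x + y = m" "x \<le> n" "y \<le> n" using True assms by (auto simp: x_def y_def m_def)
    have "(\<Prod>j\<in>{\<alpha>..\<beta>}-{k}. \<bar>real j - real k\<bar> - 1 / 2) =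
       (\<Prod>j\<in>{\<alpha>..<k}. \<bar>real j - real k\<bar> - 1 / 2) * (\<Prod>j\<in>{k<..\<beta>}. \<bar>real j - real k\<bar> - 1 / 2)"
      by (subst prod.union_disjoint[symmetric]) (use True in \<open>auto intro!: prod.cong\<close>)
    also have "(\<Prod>j\<in>{\<alpha>..<k}. \<bar>real j - real k\<bar> - 1 / 2) = (\<Prod>c\<in>{1..x}. real c - 1 / 2)"
      by (rule prod.reindex_bij_witness[of _ "\<lambda>c. k - c" "\<lambda>j. k - j"]) (use True in \<open>auto simp: x_def of_nat_diff\<close>)
    also have "(\<Prod>j\<in>{k<..\<beta>}. \<bar>real j - real k\<bar> - 1 / 2) = (\<Prod>c\<in>{1..y}. real c - 1 / 2)"
      by (rule prod.reindex_bij_witness[of _ "\<lambda>c. k + c" "\<lambda>j. j - k"]) (use True in \<open>auto simp: y_def of_nat_diff\<close>)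
    finally have eq: "(\<Prod>j\<in>{\<alpha>..\<beta>}-{k}. \<bar>real j - real k\<bar> - 1 / 2) = (\<Prod>c\<in>{1..x}. real c - 1 / 2) * (\<Prod>c\<in>{1..y}. real c - 1 / 2)" .
    have lb: "fact x / (2 * real (n + 1)) * (fact y / (2 * real (n + 1))) \<le> (\<Prod>j\<in>{\<alpha>..\<beta>}-{k}. \<bar>real j - real k\<bar> - 1 / 2)"
      unfolding eq
    proof (intro mult_mono)
      have "fact x / (2 * real (n + 1)) \<le> fact x / (2 * real (x + 1))" using xy by (intro divide_left_mono) auto
      thus "fact x / (2 * real (n + 1)) \<le> (\<Prod>c\<in>{1..x}. real c - 1 / 2)" using prod_half_ge[of x] by linarith
      have "fact y / (2 * real (n + 1)) \<le> fact y / (2 * real (y + 1))" using xy by (intro divide_left_mono) auto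
      thus "fact y / (2 * real (n + 1)) \<le> (\<Prod>c\<in>{1..y}. real c - 1 / 2)" using prod_half_ge[of y] by linarith
    qed (auto intro!: prod_nonneg)
    have "weighted_norm A (block_fps \<alpha> \<beta> k) \<le> fact m * weighted_norm A (\<Prod>j\<in>{\<alpha>..\<beta>}-{k}. inv_linear_fps (of_int (int j - int k)))"
      using weighted_norm_mult[of A "fps_const (fact m)"] True by (simp add: block_fps_def weighted_norm_const m_def)
    also have "\<dots> \<le> fact m * (1 / (\<Prod>j\<in>{\<alpha>..\<beta>}-{k}. \<bar>real j - real k\<bar> - 1 / 2))"
      by (intro mult_left_mono pr) auto
    also have "\<dots> \<le> fact m * (1 / (fact x / (2 * real (n + 1)) * (fact y / (2 * real (n + 1)))))"
    proof -
      have pos: "0 < fact x / (2 * real (n + 1)) * (fact y / (2 * real (n + 1)) :: real)"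
        by (intro mult_pos_pos divide_pos_pos) auto
      show ?thesis
        by (intro mult_left_mono divide_left_mono lb mult_pos_pos[OF order.strict_trans2[OF pos lb] pos]) auto
    qed
    also have "\<dots> = 4 * real (n + 1) ^ 2 * (fact m / (fact x * fact y))"
      by (simp add: field_simps power2_eq_square)
    also have "fact m / (fact x * fact y) = real (m choose x)"
    proof -
      have "m - x = y" "x \<le> m" using xy by simp_all
      thus ?thesis using binomial_fact[of x m, where 'a = real] by simp
    qed
    also have "4 * real (n + 1) ^ 2 * real (m choose x) \<le> 4 * real (n + 1) ^ 2 * 2 ^ m"
      using of_nat_mono[OF binomial_le_pow2[of m x], where 'a = real] by (intro mult_left_mono) auto
    finally show ?thesis by (simp add: m_def)
  next
    case False
    have lb: "fact m / 2 \<le> (\<Prod>j\<in>{\<alpha>..\<beta>}. \<bar>real j - real k\<bar> - 1 / 2)"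
    proof (cases "k < \<alpha>")
      case True
      have "(\<Prod>j\<in>{\<alpha>..\<beta>}. \<bar>real j - real k\<bar> - 1 / 2) = (\<Prod>c\<in>{(\<alpha>-k-1)+1..(\<alpha>-k-1)+m+1}. real c - 1 / 2)"
        by (rule prod.reindex_bij_witness[of _ "\<lambda>c. k + c" "\<lambda>j. j - k"]) (use True assms in \<open>auto simp: m_def of_nat_diff\<close>)
      thus ?thesis using prod_shift_half_ge[of m "\<alpha>-k-1"] by simp
    next
      case k: False
      hence "k > \<beta>" using False by auto
      have "(\<Prod>j\<in>{\<alpha>..\<beta>}. \<bar>real j - real k\<bar> - 1 / 2) = (\<Prod>c\<in>{(k-\<beta>-1)+1..(k-\<beta>-1)+m+1}. real c - 1 / 2)"
        by (rule prod.reindex_bij_witness[of _ "\<lambda>c. k - c" "\<lambda>j. k - j"]) (use \<open>k > \<beta>\<close> assms in \<open>auto simp: m_def of_nat_diff\<close>)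
      thus ?thesis using prod_shift_half_ge[of m "k-\<beta>-1"] by simp
    qed
    have "weighted_norm A (block_fps \<alpha> \<beta> k) \<le> fact m * weighted_norm A (fps_X * (\<Prod>j\<in>{\<alpha>..\<beta>}. inv_linear_fps (of_int (int j - int k))))"
      using weighted_norm_mult[of A "fps_const (fact m)" "fps_X * (\<Prod>j\<in>{\<alpha>..\<beta>}. inv_linear_fps (of_int (int j - int k)))"]
      unfolding block_fps_def if_not_P[OF False] weighted_norm_const m_def by simp
    also have "\<dots> \<le> fact m * (weighted_norm A fps_X * weighted_norm A (\<Prod>j\<in>{\<alpha>..\<beta>}. inv_linear_fps (of_int (int j - int k))))"
      by (intro mult_left_mono weighted_norm_mult) auto
    also have "\<dots> \<le> fact m * (1 / 2 * (1 / (\<Prod>j\<in>{\<alpha>..\<beta>}. \<bar>real j - real k\<bar> - 1 / 2)))"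
      by (intro mult_left_mono mult_mono pr weighted_norm_X weighted_norm_nonneg) (use False in auto)
    also have "\<dots> \<le> fact m * (1 / 2 * (1 / (fact m / 2)))"
    proof -
      have pos: "0 < fact m / (2::real)" by simp
      show ?thesis
        by (intro mult_left_mono divide_left_mono lb mult_pos_pos[OF order.strict_trans2[OF pos lb] pos]) auto
    qed
    also have "\<dots> = 1" by simp
    also have "1 \<le> 4 * real (n + 1) ^ 2 * 2 ^ (\<beta> - \<alpha>)"
    proof -
      have "1 * 1 * 1 \<le> 4 * real (n + 1) ^ 2 * (2::real) ^ (\<beta> - \<alpha>)"
        by (intro mult_mono one_le_power) auto
      thus ?thesis by simp
    qed
    finally show ?thesis .
  qed
qed

section \<open>The linear forms\<close>

text \<open>The expansion of \<open>R(t) * (t + k) ^ a\<close> at \<open>t = - k\<close> is \<open>G k\<close>.\<close>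
locale zudilin_form =
  fixes nu q r :: nat
  assumes nu: "nu > 0" and r: "r > 0" and rq: "2 * r \<le> q"
begin

definition n :: nat where "n = 20 * nu"
definition a :: nat where "a = 2 * q + 1"

text \<open>The numerator is split into runs of \<open>n\<close> consecutive integers, each divided
  by \<open>n!\<close>, so that every piece is integral in the sense of
  \<open>val_bounded_consecutive\<close>.\<close>

definition num_fps :: "nat \<Rightarrow> real fps" where
  "num_fps k = (\<Prod>i<r. (fps_const (1 / fact n) * (\<Prod>c\<in>{i*n+1..(i+1)*n}. linear_fps (of_int (- int k - int c)))) *
                   (fps_const (1 / fact n) * (\<Prod>c\<in>{i*n+1..(i+1)*n}. linear_fps (of_int (int n + int c - int k)))))"

definition G :: "nat \<Rightarrow> real fps" where
  "G k = num_fps k * block_fps 0 n k ^ (q + 1) * block_fps nu (19 * nu) k ^ q"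

definition num_poly :: "real poly" where
  "num_poly = (\<Prod>i<r. smult (1 / fact n) (\<Prod>c\<in>{i*n+1..(i+1)*n}. [:- real c, 1:]) *
                  smult (1 / fact n) (\<Prod>c\<in>{i*n+1..(i+1)*n}. [:real n + real c, 1:]))"

text \<open>The numerator of the rational function over the common denominator
  \<open>(\<Prod>j\<le>n. t + j) ^ a\<close>: the factors that the short block lacks move into the
  numerator.\<close>

definition P :: "real poly" where
  "P = num_poly * [:fact n:] ^ (q + 1) * (smult (fact (18 * nu)) (\<Prod>j\<in>{..n}-{nu..19*nu}. [:real j, 1:])) ^ q"

definition R :: "real \<Rightarrow> real" where
  "R t = poly P t / (\<Prod>j\<le>n. t + real j) ^ a"

lemma G_P:
  assumes "k \<le> n"
  shows "fps_of_poly (P \<circ>\<^sub>p [:- real k, 1:]) = G k * (\<Prod>j\<in>{..n}-{k}. linear_fps (real j - real k)) ^ a"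
proof -
  define M where "M = (\<Prod>j\<in>{..n}-{k}. linear_fps (real j - real k))"
  have 1: "fps_of_poly (num_poly \<circ>\<^sub>p [:- real k, 1:]) = num_fps k"
    unfolding num_poly_def num_fps_def pcompose_prod fps_of_poly_prod
  proof (intro prod.cong refl)
    fix i
    have e: "- real c - real k = of_int (- int k - int c)" "real n + real c - real k = of_int (int n + int c - int k)" for c
      by simp_all
    show "fps_of_poly ((smult (1 / fact n) (\<Prod>c\<in>{i*n+1..(i+1)*n}. [:- real c, 1:]) *
        smult (1 / fact n) (\<Prod>c\<in>{i*n+1..(i+1)*n}. [:real n + real c, 1:])) \<circ>\<^sub>p [:- real k, 1:]) =
      (fps_const (1 / fact n) * (\<Prod>c\<in>{i*n+1..(i+1)*n}. linear_fps (of_int (- int k - int c)))) *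
      (fps_const (1 / fact n) * (\<Prod>c\<in>{i*n+1..(i+1)*n}. linear_fps (of_int (int n + int c - int k))))"
      unfolding pcompose_mult pcompose_smult fps_of_poly_mult fps_of_poly_smult pcompose_prod fps_of_poly_prod
        fps_of_poly_linear_pcompose e ..
  qed
  have "P \<circ>\<^sub>p [:- real k, 1:] = (num_poly \<circ>\<^sub>p [:- real k, 1:]) * [:fact n:] ^ (q + 1) *
      (smult (fact (18 * nu)) ((\<Prod>j\<in>{..n}-{nu..19*nu}. [:real j, 1:] \<circ>\<^sub>p [:- real k, 1:]))) ^ q"
    by (simp only: P_def pcompose_mult pcompose_power pcompose_smult pcompose_prod pcompose_const)
  hence "fps_of_poly (P \<circ>\<^sub>p [:- real k, 1:]) = num_fps k * fps_const (fact n) ^ (q + 1) *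
      (fps_const (fact (18 * nu)) * (\<Prod>j\<in>{..n}-{nu..19*nu}. linear_fps (real j - real k))) ^ q"
    by (simp only: fps_of_poly_mult fps_of_poly_power fps_of_poly_smult fps_of_poly_prod fps_of_poly_const
          fps_of_poly_linear_pcompose 1)
  also have "fps_const (fact n) = block_fps 0 n k * M"
  proof -
    have e: "{..n} - {0..n} = {}" by auto
    show ?thesis using block_fps_mult[of n n k 0, unfolded e] assms unfolding M_def by simp
  qed
  also have "fps_const (fact (18 * nu)) * (\<Prod>j\<in>{..n}-{nu..19*nu}. linear_fps (real j - real k)) = block_fps nu (19 * nu) k * M"
    using block_fps_mult[of "19 * nu" n k nu] assms unfolding M_def by (simp add: n_def)
  also have "num_fps k * (block_fps 0 n k * M) ^ (q + 1) * (block_fps nu (19 * nu) k * M) ^ q = G k * M ^ a"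
  proof -
    have "M ^ a = M ^ (q + 1) * M ^ q" unfolding a_def by (simp flip: power_add mult_2)
    thus ?thesis unfolding G_def power_mult_distrib by (simp only: mult_ac)
  qed
  finally show ?thesis unfolding M_def .
qed

lemma n_pos: "n > 0" using nu by (simp add: n_def)

lemma ex_bound: "40 * r * nu \<le> 20 * q * nu"
proof -
  have "20 * nu * (2 * r) \<le> 20 * nu * q" using rq by (intro mult_left_mono) auto
  thus ?thesis by (simp add: mult_ac)
qed

text \<open>The numerator has degree at most \<open>2 * r * n + 2 * \<nu> * q\<close>, where the
  last part comes from the short blocks; \<open>2 * r \<le> q\<close> keeps the first part below
  half of \<open>a * n\<close>.\<close>

lemma degree_P: "degree P < a * (n + 1)"
proof -
  define f where "f = (\<lambda>i. smult (1 / fact n) (\<Prod>c\<in>{i*n+1..(i+1)*n}. [:- real c, 1:]) *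
                  smult (1 / fact n) (\<Prod>c\<in>{i*n+1..(i+1)*n}. [:real n + real c, 1:]))"
  have "degree num_poly \<le> sum (degree \<circ> f) {..<r}"
    unfolding num_poly_def f_def by (rule degree_prod_sum_le) simp
  also have "\<dots> \<le> (\<Sum>i<r. n + n)"
  proof (rule sum_mono)
    fix i
    have card: "card {i*n+1..(i+1)*n} = n" by simp
    have "degree (\<Prod>c\<in>{i*n+1..(i+1)*n}. [:- real c, 1:]) \<le> n"
      using degree_prod_sum_le[of "{i*n+1..(i+1)*n}" "\<lambda>c. [:- real c, 1:]"] by simp
    moreover have "degree (\<Prod>c\<in>{i*n+1..(i+1)*n}. [:real n + real c, 1:]) \<le> n"
      using degree_prod_sum_le[of "{i*n+1..(i+1)*n}" "\<lambda>c. [:real n + real c, 1:]"] by simp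
    ultimately show "(degree \<circ> f) i \<le> n + n" unfolding f_def o_def
      by (intro order_trans[OF degree_mult_le] add_mono) auto
  qed
  finally have "degree num_poly \<le> (\<Sum>i<r. n + n)" .
  moreover have "degree ([:fact n:] ^ (q + 1) :: real poly) = 0"
    using degree_power_le[of "[:fact n:] :: real poly" "q + 1"] by simp
  moreover have "degree ((smult (fact (18 * nu)) (\<Prod>j\<in>{..n}-{nu..19*nu}. [:real j, 1:])) ^ q) \<le> 2 * nu * q"
  proof -
    have "card ({..n}-{nu..19*nu}) = 2 * nu"
      by (subst card_Diff_subset) (auto simp: n_def)
    hence "degree (\<Prod>j\<in>{..n}-{nu..19*nu}. [:real j, 1:]) \<le> 2 * nu"
      using degree_prod_sum_le[of "{..n}-{nu..19*nu}" "\<lambda>j. [:real j, 1:]"] by simp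
    hence "degree (smult (fact (18 * nu)) (\<Prod>j\<in>{..n}-{nu..19*nu}. [:real j, 1:])) \<le> 2 * nu" by simp
    thus ?thesis by (intro order_trans[OF degree_power_le] mult_right_mono) auto
  qed
  ultimately have "degree P \<le> r * (n + n) + 0 + 2 * nu * q"
    unfolding P_def by (intro order_trans[OF degree_mult_le] add_mono) auto
  also have "\<dots> < a * (n + 1)"
  proof -
    have "r * (n + n) + 0 + 2 * nu * q = 40 * r * nu + 2 * (q * nu)" by (simp add: n_def)
    moreover have "a * (n + 1) = 40 * (q * nu) + 20 * nu + 2 * q + 1" by (simp add: a_def n_def algebra_simps)
    moreover have "40 * r * nu \<le> 20 * (q * nu)" using ex_bound by (simp only: mult.assoc)
    ultimately show ?thesis using nu by linarith
  qed
  finally show ?thesis .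
qed

lemma R_partial_fractions:
  assumes "t > 0"
  shows "R t = (\<Sum>k\<le>n. \<Sum>l<a. G k $ l / (t + real k) ^ (a - l))"
  unfolding R_def by (rule partial_fractions[OF degree_P G_P]) (use assms in auto)

text \<open>The local form of the antisymmetry of \<open>R\<close>: the sign of \<open>R\<close>
  cancels against \<open>(-1) ^ a\<close>, because \<open>a\<close> is odd. All remaining products
  have evenly many factors, as \<open>n\<close> and \<open>18 * \<nu>\<close> are even.\<close>

lemma fps_reflect_G:
  assumes k: "k \<le> n" shows "fps_reflect (G k) = G (n - k)"
proof -
  have "even n" by (simp add: n_def)
  have e: "(\<Prod>c\<in>S. - f c) = (\<Prod>c\<in>S. f c)" if "even (card S)" for S and f :: "nat \<Rightarrow> real fps"
    using that by (simp add: prod_uminus)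
  have "fps_reflect (num_fps k) = num_fps (n - k)"
    unfolding num_fps_def fps_reflect_prod
  proof (intro prod.cong refl)
    fix i
    let ?C = "{i*n+1..(i+1)*n}"
    have card: "even (card ?C)" using \<open>even n\<close> by simp
    have 1: "(\<Prod>c\<in>?C. fps_reflect (linear_fps (of_int (- int k - int c)))) = (\<Prod>c\<in>?C. linear_fps (of_int (int n + int c - int (n - k))))"
      unfolding fps_reflect_linear_fps e[OF card] by (intro prod.cong refl arg_cong[where f = linear_fps]) (use k in \<open>simp add: of_nat_diff\<close>)
    have 2: "(\<Prod>c\<in>?C. fps_reflect (linear_fps (of_int (int n + int c - int k)))) = (\<Prod>c\<in>?C. linear_fps (of_int (- int (n - k) - int c)))"
      unfolding fps_reflect_linear_fps e[OF card] by (intro prod.cong refl arg_cong[where f = linear_fps]) (use k in \<open>simp add: of_nat_diff\<close>)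
    show "fps_reflect ((fps_const (1 / fact n) * (\<Prod>c\<in>?C. linear_fps (of_int (- int k - int c)))) *
                   (fps_const (1 / fact n) * (\<Prod>c\<in>?C. linear_fps (of_int (int n + int c - int k))))) =
       (fps_const (1 / fact n) * (\<Prod>c\<in>?C. linear_fps (of_int (- int (n - k) - int c)))) *
                   (fps_const (1 / fact n) * (\<Prod>c\<in>?C. linear_fps (of_int (int n + int c - int (n - k)))))"
      unfolding fps_reflect_mult fps_reflect_const fps_reflect_prod 1 2 by (simp only: mult_ac)
  qed
  moreover have "fps_reflect (block_fps 0 n k) = block_fps 0 n (n - k)"
    by (rule fps_reflect_block_fps) (use k \<open>even n\<close> in auto)
  moreover have "fps_reflect (block_fps nu (19 * nu) k) = block_fps nu (19 * nu) (n - k)"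
    by (rule fps_reflect_block_fps) (use k in \<open>auto simp: n_def\<close>)
  ultimately show ?thesis unfolding G_def fps_reflect_mult fps_reflect_power by simp
qed

text \<open>Index \<open>a - i\<close> belongs to the summand with \<open>(t + k) ^ i\<close> in the
  denominator, so \<open>rho i\<close> is the coefficient of \<open>\<zeta>(i)\<close> after
  summation over \<open>t\<close>.\<close>

definition rho :: "nat \<Rightarrow> real" where "rho i = (\<Sum>k\<le>n. G k $ (a - i))"

text \<open>For even \<open>i\<close> the index \<open>a - i\<close> is odd, so the coefficients at
  \<open>k\<close> and \<open>n - k\<close> are opposite.\<close>

lemma rho_even:
  assumes "even i" "i \<le> a" shows "rho i = 0"
proof -
  have "odd (a - i)" using assms by (simp add: a_def)
  have "G (n - k) $ (a - i) = - G k $ (a - i)" if "k \<le> n" for k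
    unfolding fps_reflect_G[OF that, symmetric] using \<open>odd (a - i)\<close> by (simp add: fps_reflect_def)
  hence "(\<Sum>k\<le>n. G (n - k) $ (a - i)) = - rho i"
    unfolding rho_def sum_negf[symmetric] by (intro sum.cong) auto
  moreover have "(\<Sum>k\<le>n. G (n - k) $ (a - i)) = rho i"
    unfolding rho_def by (rule sum.reindex_bij_witness[of _ "\<lambda>k. n - k" "\<lambda>k. n - k"]) auto
  ultimately show ?thesis by simp
qed

lemma val_bounded_G:
  assumes p: "prime p" "int n < int p ^ Suc e" and k: "k \<le> n"
  shows "val_bounded p e (int (q + 1) * (\<Sum>h\<in>{1..e}. block_val 0 n k (int p ^ h)) + int q * (\<Sum>h\<in>{1..e}. block_val nu (19 * nu) k (int p ^ h))) (G k)"
proof -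
  have "val_bounded p e (\<Sum>i<r. 0 + 0) (num_fps k)" unfolding num_fps_def
  proof (intro val_bounded_prod[OF p(1)] val_bounded_mult[OF p(1)])
    fix i
    have "(\<Prod>c\<in>{A..B}. linear_fps (of_int (- int k - int c))) = (\<Prod>c\<in>{- int k - int B..- int k - int A}. linear_fps (of_int c))" for A B
      by (rule prod.reindex_bij_witness[of _ "\<lambda>c. nat (- int k - c)" "\<lambda>c. - int k - int c"]) auto
    thus "val_bounded p e 0 (fps_const (1 / fact n) * (\<Prod>c\<in>{i*n+1..(i+1)*n}. linear_fps (of_int (- int k - int c))))"
      by (simp only:) (rule val_bounded_consecutive[OF p], simp add: algebra_simps)
    have "(\<Prod>c\<in>{A..B}. linear_fps (of_int (int n + int c - int k))) = (\<Prod>c\<in>{int n + int A - int k..int n + int B - int k}. linear_fps (of_int c))" for A B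
      by (rule prod.reindex_bij_witness[of _ "\<lambda>c. nat (c - int n + int k)" "\<lambda>c. int n + int c - int k"]) auto
    thus "val_bounded p e 0 (fps_const (1 / fact n) * (\<Prod>c\<in>{i*n+1..(i+1)*n}. linear_fps (of_int (int n + int c - int k))))"
      by (simp only:) (rule val_bounded_consecutive[OF p], simp add: algebra_simps)
  qed
  hence "val_bounded p e (0 + int (q + 1) * (\<Sum>h\<in>{1..e}. block_val 0 n k (int p ^ h)) + int q * (\<Sum>h\<in>{1..e}. block_val nu (19 * nu) k (int p ^ h))) (G k)"
    unfolding G_def
    by (intro val_bounded_mult[OF p(1)] val_bounded_power[OF p(1)] val_bounded_block_fps[OF p(1) _ k p(2)]) (simp_all add: n_def)
  thus ?thesis by simp
qed

definition special :: "nat \<Rightarrow> bool" where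
  "special p \<longleftrightarrow> (\<exists>m. 1 \<le> m \<and> m \<le> 10 \<and> m * p \<le> 20 * nu \<and> 19 * nu < m * p)"

definition gain :: "nat \<Rightarrow> nat" where "gain p = (if special p then q else 0)"

text \<open>For a special prime the terms with \<open>h = 1\<close> already give total valuation 1
  to a pair of one full and one short block, and \<open>q\<close> such pairs occur in
  \<open>G k\<close>. The range contains \<open>h = 1\<close> because a special prime is at most
  \<open>n\<close>.\<close>

lemma val_bounded_gain:
  assumes p: "prime p" "int p ^ e \<le> int n" "int n < int p ^ Suc e" and k: "k \<le> n"
  shows "val_bounded p e (int (gain p)) (G k)"
proof (rule val_bounded_mono[OF p(1) val_bounded_G[OF p(1,3) k]])
  have pos: "int p ^ h > 0" for h using p(1) by (auto dest: prime_gt_0_nat)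
  define S0 where "S0 = (\<Sum>h\<in>{1..e}. block_val 0 n k (int p ^ h))"
  define S1 where "S1 = (\<Sum>h\<in>{1..e}. block_val nu (19 * nu) k (int p ^ h))"
  have S: "S0 \<ge> 0" "S1 \<ge> 0" unfolding S0_def S1_def by (auto intro!: sum_nonneg block_val_nonneg pos)
  have "int (gain p) \<le> int q * (S0 + S1)"
  proof (cases "special p")
    case True
    then obtain m where m: "1 \<le> m" "m \<le> 10" "m * p \<le> 20 * nu" "19 * nu < m * p" by (auto simp: special_def)
    have "e \<ge> 1"
    proof (rule ccontr)
      assume "\<not> e \<ge> 1"
      hence "e = 0" by simp
      hence "n < p" using p(3) by simp
      moreover have "1 * p \<le> m * p" using m(1) by (rule mult_right_mono) simp
      ultimately show False using m(3) by (simp add: n_def)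
    qed
    hence in1: "1 \<in> {1..e}" by simp
    have "block_val 0 n k (int p ^ 1) \<le> S0" unfolding S0_def
      by (rule member_le_sum[OF in1]) (auto intro!: block_val_nonneg pos)
    moreover have "block_val nu (19 * nu) k (int p ^ 1) \<le> S1" unfolding S1_def
      by (rule member_le_sum[OF in1]) (auto intro!: block_val_nonneg pos)
    ultimately have "1 \<le> S0 + S1" using block_val_saving[OF m, of k] by (simp add: n_def)
    hence "int q * 1 \<le> int q * (S0 + S1)" by (intro mult_left_mono) auto
    thus ?thesis using True by (simp add: gain_def)
  qed (use S in \<open>simp add: gain_def\<close>)
  also have "\<dots> \<le> int (q + 1) * S0 + int q * S1" using S by (simp add: algebra_simps)
  finally show "int (gain p) \<le> int (q + 1) * (\<Sum>h\<in>{1..e}. block_val 0 n k (int p ^ h)) + int q * (\<Sum>h\<in>{1..e}. block_val nu (19 * nu) k (int p ^ h))"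
    unfolding S0_def S1_def .
qed

definition G_bound :: real where
  "G_bound = ((real ((r + 2) * n) ^ n / fact n) * (real ((r + 2) * n) ^ n / fact n)) ^ r *
      (4 * real (n + 1) ^ 2 * 2 ^ n) ^ (q + 1) * (4 * real (n + 1) ^ 2 * 2 ^ (18 * nu)) ^ q"

lemma weighted_norm_G: assumes k: "k \<le> n" shows "weighted_norm A (G k) \<le> G_bound"
proof -
  have c: "real c \<le> real (r * n)" if "c \<in> {i*n+1..(i+1)*n}" "i < r" for c i
  proof -
    have "c \<le> (i + 1) * n" using that by simp
    also have "\<dots> \<le> r * n" using that by (intro mult_right_mono) auto
    finally show ?thesis by (simp only: of_nat_le_iff)
  qed
  have n1: "real n \<ge> 1" using n_pos by simp
  have kn: "real k \<le> real n" using k by simp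
  have w: "weighted_norm A (fps_const (1 / fact n) * (\<Prod>c\<in>{i*n+1..(i+1)*n}. linear_fps (f c))) \<le> real ((r + 2) * n) ^ n / fact n"
    if f: "\<And>c. c \<in> {i*n+1..(i+1)*n} \<Longrightarrow> \<bar>f c\<bar> + 1 / 2 \<le> real ((r + 2) * n)" for i f
  proof -
    have "weighted_norm A (\<Prod>c\<in>{i*n+1..(i+1)*n}. linear_fps (f c)) \<le> (\<Prod>c\<in>{i*n+1..(i+1)*n}. weighted_norm A (linear_fps (f c)))"
      by (rule weighted_norm_prod)
    also have "\<dots> \<le> (\<Prod>c\<in>{i*n+1..(i+1)*n}. real ((r + 2) * n))"
      by (rule prod_mono) (use f weighted_norm_linear_fps weighted_norm_nonneg order_trans in metis)
    also have "\<dots> = real ((r + 2) * n) ^ n" by simp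
    finally have "1 / fact n * weighted_norm A (\<Prod>c\<in>{i*n+1..(i+1)*n}. linear_fps (f c)) \<le> 1 / fact n * real ((r + 2) * n) ^ n"
      by (intro mult_left_mono) auto
    thus ?thesis using weighted_norm_mult[of A "fps_const (1 / fact n)" "\<Prod>c\<in>{i*n+1..(i+1)*n}. linear_fps (f c)"]
      by (simp add: weighted_norm_const)
  qed
  have "weighted_norm A (num_fps k) \<le> (\<Prod>i<r. (real ((r + 2) * n) ^ n / fact n) * (real ((r + 2) * n) ^ n / fact n))"
    unfolding num_fps_def
  proof (rule order_trans[OF weighted_norm_prod], rule prod_mono, rule conjI, rule weighted_norm_nonneg)
    fix i assume i: "i \<in> {..<r}"
    show "weighted_norm A ((fps_const (1 / fact n) * (\<Prod>c\<in>{i*n+1..(i+1)*n}. linear_fps (of_int (- int k - int c)))) *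
                   (fps_const (1 / fact n) * (\<Prod>c\<in>{i*n+1..(i+1)*n}. linear_fps (of_int (int n + int c - int k)))))
       \<le> (real ((r + 2) * n) ^ n / fact n) * (real ((r + 2) * n) ^ n / fact n)"
    proof (rule order_trans[OF weighted_norm_mult], rule mult_mono)
      show "weighted_norm A (fps_const (1 / fact n) * (\<Prod>c\<in>{i*n+1..(i+1)*n}. linear_fps (of_int (- int k - int c)))) \<le> real ((r + 2) * n) ^ n / fact n"
      proof (rule w)
        fix c' assume c': "c' \<in> {i*n+1..(i+1)*n}"
        have "real c' \<le> real r * real n" using c[OF c'] i by simp
        thus "\<bar>real_of_int (- int k - int c')\<bar> + 1 / 2 \<le> real ((r + 2) * n)" using kn n1 by (simp add: algebra_simps)
      qed
      show "weighted_norm A (fps_const (1 / fact n) * (\<Prod>c\<in>{i*n+1..(i+1)*n}. linear_fps (of_int (int n + int c - int k)))) \<le> real ((r + 2) * n) ^ n / fact n"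
      proof (rule w)
        fix c' assume c': "c' \<in> {i*n+1..(i+1)*n}"
        have "real c' \<le> real r * real n" using c[OF c'] i by simp
        thus "\<bar>real_of_int (int n + int c' - int k)\<bar> + 1 / 2 \<le> real ((r + 2) * n)" using kn n1 by (simp add: algebra_simps)
      qed
    qed (auto simp: weighted_norm_nonneg)
  qed
  hence N: "weighted_norm A (num_fps k) \<le> ((real ((r + 2) * n) ^ n / fact n) * (real ((r + 2) * n) ^ n / fact n)) ^ r" by simp
  have B0: "weighted_norm A (block_fps 0 n k ^ (q + 1)) \<le> (4 * real (n + 1) ^ 2 * 2 ^ n) ^ (q + 1)"
    by (rule order_trans[OF weighted_norm_power], rule power_mono[OF _ weighted_norm_nonneg])
       (use weighted_norm_block_fps[of 0 n n k A] k in simp)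
  have "weighted_norm A (block_fps nu (19 * nu) k) \<le> 4 * real (n + 1) ^ 2 * 2 ^ (19 * nu - nu)"
    by (rule weighted_norm_block_fps) (use k in \<open>auto simp: n_def\<close>)
  also have "19 * nu - nu = 18 * nu" by simp
  finally have B1: "weighted_norm A (block_fps nu (19 * nu) k ^ q) \<le> (4 * real (n + 1) ^ 2 * 2 ^ (18 * nu)) ^ q"
    by (intro order_trans[OF weighted_norm_power] power_mono weighted_norm_nonneg)
  show ?thesis unfolding G_def G_bound_def
    by (intro order_trans[OF weighted_norm_mult] mult_mono N B0 B1 weighted_norm_nonneg) auto
qed

lemma G_coeff_bound: assumes "k \<le> n" "l \<le> a" shows "\<bar>G k $ l\<bar> \<le> 2 ^ a * G_bound"
proof -
  have "\<bar>G k $ l\<bar> \<le> 2 ^ l * weighted_norm l (G k)" by (rule weighted_norm_coeff) simp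
  also have "\<dots> \<le> 2 ^ a * G_bound"
    by (intro mult_mono power_increasing weighted_norm_G assms weighted_norm_nonneg) (use assms in auto)
  finally show ?thesis .
qed

end

section \<open>Size of the rational function at positive integers\<close>

context zudilin_form
begin

abbreviation chunk :: "nat \<Rightarrow> nat set" where "chunk i \<equiv> {i*n+1..(i+1)*n}"

lemma chunk_le: "c \<in> chunk i \<Longrightarrow> i < r \<Longrightarrow> c \<le> r * n"
proof -
  assume "c \<in> chunk i" "i < r"
  hence "c \<le> (i + 1) * n" by simp
  also have "\<dots> \<le> r * n" using \<open>i < r\<close> by (intro mult_right_mono) auto
  finally show "c \<le> r * n" .
qed

lemma R_explicit:
  assumes t: "t > 0"
  shows "R t = (\<Prod>i<r. ((\<Prod>c\<in>chunk i. t - real c) / fact n) * ((\<Prod>c\<in>chunk i. t + real n + real c) / fact n)) *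
    (fact n / (\<Prod>j\<le>n. t + real j)) ^ (q + 1) * (fact (18 * nu) / (\<Prod>j\<in>{nu..19*nu}. t + real j)) ^ q"
proof -
  define N where "N = (\<Prod>i<r. ((\<Prod>c\<in>chunk i. t - real c) / fact n) * ((\<Prod>c\<in>chunk i. t + real n + real c) / fact n))"
  define F where "F = (\<Prod>j\<le>n. t + real j)"
  define I where "I = (\<Prod>j\<in>{nu..19*nu}. t + real j)"
  define S where "S = (\<Prod>j\<in>{..n}-{nu..19*nu}. t + real j)"
  have pos: "F > 0" "I > 0" "S > 0" unfolding F_def I_def S_def using t by (auto intro!: prod_pos add_pos_nonneg)
  have F: "F = S * I" unfolding F_def S_def I_def by (rule prod.subset_diff) (auto simp: n_def)
  have "poly num_poly t = N" unfolding num_poly_def N_def poly_prod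
  proof (intro prod.cong refl)
    fix i
    have "poly [:- real c, 1:] t = t - real c" "poly [:real n + real c, 1:] t = t + real n + real c" for c by simp_all
    thus "poly (smult (1 / fact n) (\<Prod>c\<in>chunk i. [:- real c, 1:]) * smult (1 / fact n) (\<Prod>c\<in>chunk i. [:real n + real c, 1:])) t
       = ((\<Prod>c\<in>chunk i. t - real c) / fact n) * ((\<Prod>c\<in>chunk i. t + real n + real c) / fact n)"
      by (simp only: poly_mult poly_smult poly_prod) simp
  qed
  hence "poly P t = N * fact n ^ (q + 1) * (fact (18 * nu) * S) ^ q"
    by (simp add: P_def S_def poly_prod add.commute)
  hence "R t = N * fact n ^ (q + 1) * (fact (18 * nu) * S) ^ q / F ^ a"
    by (simp add: R_def F_def)
  also have "F ^ a = F ^ (q + 1) * F ^ q" unfolding a_def by (simp flip: power_add mult_2)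
  also have "N * fact n ^ (q + 1) * (fact (18 * nu) * S) ^ q / (F ^ (q + 1) * F ^ q) =
     N * (fact n ^ (q + 1) / F ^ (q + 1)) * ((fact (18 * nu) * S) ^ q / F ^ q)" by simp
  also have "(fact (18 * nu) * S) ^ q / F ^ q = (fact (18 * nu) / I) ^ q"
    unfolding power_divide[symmetric] F using pos by simp
  finally show ?thesis unfolding N_def F_def I_def by (simp only: power_divide)
qed

lemma R_zero:
  assumes "1 \<le> t" "t \<le> r * n" shows "R (real t) = 0"
proof -
  define i where "i = (t - 1) div n"
  have i: "i < r" unfolding i_def using assms n_pos by (simp add: div_less_iff_less_mult)
  have "i * n \<le> t - 1" "t - 1 < (i + 1) * n"
    unfolding i_def using div_times_less_eq_dividend[of "t - 1" n] dividend_less_div_times[OF n_pos, of "t - 1"]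
    by (simp_all add: algebra_simps)
  hence t: "t \<in> chunk i" using assms by auto
  have "(\<Prod>c\<in>chunk i. real t - real c) = 0" by (rule prod_zero) (use t in auto)
  hence "(\<Prod>i<r. ((\<Prod>c\<in>chunk i. real t - real c) / fact n) * ((\<Prod>c\<in>chunk i. real t + real n + real c) / fact n)) = 0"
    using i by (intro prod_zero) auto
  thus ?thesis using assms by (subst R_explicit) auto
qed

definition amplitude :: real where "amplitude = fact n ^ (q + 1) * fact (18 * nu) ^ q / fact n ^ (2 * r)"
definition decay_exponent :: nat where "decay_exponent = (n + 1) * (q + 1) + (18 * nu + 1) * q"

lemma decay_exponent_eq: "decay_exponent = 38 * q * nu + 20 * nu + 2 * q + 1"
  by (simp add: decay_exponent_def n_def algebra_simps)

lemma decay_exponent_ge: "2 * (r * n) + 2 \<le> decay_exponent"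
proof -
  have "40 * (r * nu) \<le> 20 * (q * nu)" using ex_bound by (simp only: mult.assoc)
  moreover have "decay_exponent = 38 * (q * nu) + 20 * nu + 2 * q + 1" by (simp add: decay_exponent_eq)
  moreover have "2 * (r * n) = 40 * (r * nu)" by (simp add: n_def)
  ultimately show ?thesis using nu by linarith
qed

lemma amplitude_pos: "amplitude > 0" by (simp add: amplitude_def)

text \<open>Both size estimates replace the factors of the two numerator runs by single numbers
  \<open>x\<close> and \<open>y\<close>, and all factors of the blocks by \<open>z\<close>; the
  powers are collected here once.\<close>

lemma shape:
  fixes x y z :: real
  assumes "z > 0"
  shows "((x ^ n / fact n) * (y ^ n / fact n)) ^ r * (fact n / z ^ (n + 1)) ^ (q + 1) * (fact (18 * nu) / z ^ (18 * nu + 1)) ^ q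
    = amplitude * (x ^ (r * n) * y ^ (r * n)) / z ^ decay_exponent"
proof -
  have "((x ^ n / fact n) * (y ^ n / fact n)) ^ r = x ^ (r * n) * y ^ (r * n) / fact n ^ (2 * r)"
    by (simp add: power_mult_distrib power_divide mult_2 power_add mult.commute[of r n] flip: power_mult)
  moreover have "(fact n / z ^ (n + 1)) ^ (q + 1) = fact n ^ (q + 1) / z ^ ((n + 1) * (q + 1))"
    by (simp only: power_divide power_mult)
  moreover have "(fact (18 * nu) / z ^ (18 * nu + 1)) ^ q = fact (18 * nu) ^ q / z ^ ((18 * nu + 1) * q)"
    by (simp only: power_divide power_mult)
  moreover have "z ^ decay_exponent = z ^ ((n + 1) * (q + 1)) * z ^ ((18 * nu + 1) * q)" unfolding decay_exponent_def by (rule power_add)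
  moreover have "X / F * (A / u) * (B / v) = A * B / F * X / (u * v)" for X F A B u v :: real by (simp add: mult_ac)
  ultimately show ?thesis unfolding amplitude_def by (simp only:)
qed

text \<open>For \<open>t > r * n\<close> every \<open>t - c\<close> lies between 0 and
  \<open>t\<close>, every \<open>t + n + c\<close> is at most \<open>3 * t\<close>, and every
  \<open>t + j\<close> is at least \<open>t\<close>.\<close>

lemma R_upper:
  assumes t: "t > r * n"
  shows "R (real t) \<ge> 0" "R (real t) \<le> amplitude * 3 ^ (r * n) / real t ^ (decay_exponent - 2 * (r * n))"
proof -
  have t0: "real t > 0" using t by simp
  have "1 * n \<le> r * n" using r by (intro mult_right_mono) auto
  hence tn: "n < t" using t by linarith
  have low: "real c \<le> real t" if "c \<in> chunk i" "i < r" for c i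
    using chunk_le[OF that] t by simp
  have N: "0 \<le> ((\<Prod>c\<in>chunk i. real t - real c) / fact n) * ((\<Prod>c\<in>chunk i. real t + real n + real c) / fact n)"
    "((\<Prod>c\<in>chunk i. real t - real c) / fact n) * ((\<Prod>c\<in>chunk i. real t + real n + real c) / fact n)
        \<le> (real t ^ n / fact n) * ((3 * real t) ^ n / fact n)" if i: "i < r" for i
  proof -
    have 1: "0 \<le> (\<Prod>c\<in>chunk i. real t - real c)" by (rule prod_nonneg) (use low i in auto)
    have "(\<Prod>c\<in>chunk i. real t - real c) \<le> (\<Prod>c\<in>chunk i. real t)" by (rule prod_mono) (use low i in auto)
    hence 2: "(\<Prod>c\<in>chunk i. real t - real c) \<le> real t ^ n" by simp
    have 3: "0 \<le> (\<Prod>c\<in>chunk i. real t + real n + real c)" by (rule prod_nonneg) auto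
    have "(\<Prod>c\<in>chunk i. real t + real n + real c) \<le> (\<Prod>c\<in>chunk i. 3 * real t)"
    proof (rule prod_mono)
      fix c assume c: "c \<in> chunk i"
      show "0 \<le> real t + real n + real c \<and> real t + real n + real c \<le> 3 * real t"
        using low[OF c i] tn by simp
    qed
    hence 4: "(\<Prod>c\<in>chunk i. real t + real n + real c) \<le> (3 * real t) ^ n" by simp
    show "0 \<le> ((\<Prod>c\<in>chunk i. real t - real c) / fact n) * ((\<Prod>c\<in>chunk i. real t + real n + real c) / fact n)"
      using 1 3 by simp
    show "((\<Prod>c\<in>chunk i. real t - real c) / fact n) * ((\<Prod>c\<in>chunk i. real t + real n + real c) / fact n)
        \<le> (real t ^ n / fact n) * ((3 * real t) ^ n / fact n)"
      using 1 2 3 4 by (intro mult_mono divide_right_mono) auto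
  qed
  have b1: "real t ^ (n + 1) \<le> (\<Prod>j\<le>n. real t + real j)"
    using prod_mono[of "{..n}" "\<lambda>_. real t" "\<lambda>j. real t + real j"] by simp
  have b2: "real t ^ (18 * nu + 1) \<le> (\<Prod>j\<in>{nu..19*nu}. real t + real j)"
    using prod_mono[of "{nu..19*nu}" "\<lambda>_. real t" "\<lambda>j. real t + real j"] by simp
  have p1: "0 < (\<Prod>j\<le>n. real t + real j)" by (rule prod_pos) (use t0 in auto)
  have p2: "0 < (\<Prod>j\<in>{nu..19*nu}. real t + real j)" by (rule prod_pos) (use t0 in auto)
  show "R (real t) \<ge> 0" unfolding R_explicit[OF t0]
    by (rule mult_nonneg_nonneg[OF mult_nonneg_nonneg[OF prod_nonneg]]) (use N(1) p1 p2 in auto)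
  have "R (real t) \<le> (\<Prod>i<r. (real t ^ n / fact n) * ((3 * real t) ^ n / fact n)) *
    (fact n / real t ^ (n + 1)) ^ (q + 1) * (fact (18 * nu) / real t ^ (18 * nu + 1)) ^ q"
    unfolding R_explicit[OF t0]
  proof (intro mult_mono power_mono)
    show "(\<Prod>i<r. ((\<Prod>c\<in>chunk i. real t - real c) / fact n) * ((\<Prod>c\<in>chunk i. real t + real n + real c) / fact n))
       \<le> (\<Prod>i<r. (real t ^ n / fact n) * ((3 * real t) ^ n / fact n))"
      by (rule prod_mono) (use N in auto)
    show "fact n / (\<Prod>j\<le>n. real t + real j) \<le> fact n / real t ^ (n + 1)"
      by (rule divide_left_mono[OF b1]) (use p1 t0 in auto)
    show "fact (18 * nu) / (\<Prod>j\<in>{nu..19*nu}. real t + real j) \<le> fact (18 * nu) / real t ^ (18 * nu + 1)"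
      by (rule divide_left_mono[OF b2]) (use p2 t0 in auto)
  qed (use p1 p2 t0 in \<open>auto intro!: prod_nonneg mult_nonneg_nonneg\<close>)
  also have "\<dots> = amplitude * (real t ^ (r * n) * (3 * real t) ^ (r * n)) / real t ^ decay_exponent"
    unfolding prod_constant card_lessThan by (rule shape[OF t0])
  also have "real t ^ (r * n) * (3 * real t) ^ (r * n) = 3 ^ (r * n) * real t ^ (2 * (r * n))"
    by (simp add: power_mult_distrib mult_2 power_add)
  also have "real t ^ decay_exponent = real t ^ (decay_exponent - 2 * (r * n)) * real t ^ (2 * (r * n))"
    using decay_exponent_ge by (simp flip: power_add)
  also have "amplitude * (3 ^ (r * n) * real t ^ (2 * (r * n))) / (real t ^ (decay_exponent - 2 * (r * n)) * real t ^ (2 * (r * n)))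
     = amplitude * 3 ^ (r * n) / real t ^ (decay_exponent - 2 * (r * n))" using t0 by simp
  finally show "R (real t) \<le> amplitude * 3 ^ (r * n) / real t ^ (decay_exponent - 2 * (r * n))" .
qed

lemma R_nonneg: "t \<ge> 1 \<Longrightarrow> R (real t) \<ge> 0"
  using R_zero[of t] R_upper(1)[of t] by (cases "t \<le> r * n") auto

text \<open>At \<open>t = (r + 1) * n\<close> the factors \<open>t - c\<close> are at least
  \<open>n\<close>, the factors \<open>t + n + c\<close> at least \<open>r * n\<close>, and the
  factors \<open>t + j\<close> at most \<open>(r + 2) * n\<close>. Since all terms are nonnegative,
  this one term bounds the series from below.\<close>

lemma R_lower:
  "R (real ((r + 1) * n)) \<ge> amplitude * (real n ^ (r * n) * real (r * n) ^ (r * n)) / real ((r + 2) * n) ^ decay_exponent"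
proof -
  define t where "t = (r + 1) * n"
  have "t > 0" using n_pos unfolding t_def by (intro mult_pos_pos) auto
  hence t0: "real t > 0" by simp
  have "(r + 2) * n > 0" using n_pos by (intro mult_pos_pos) auto
  hence z0: "real ((r + 2) * n) > 0" by (simp only: of_nat_0_less_iff)
  have N: "(real n ^ n / fact n) * (real (r * n) ^ n / fact n) \<le>
     ((\<Prod>c\<in>chunk i. real t - real c) / fact n) * ((\<Prod>c\<in>chunk i. real t + real n + real c) / fact n)" if i: "i < r" for i
  proof -
    have "(\<Prod>c\<in>chunk i. real n) \<le> (\<Prod>c\<in>chunk i. real t - real c)"
    proof (rule prod_mono)
      fix c assume c: "c \<in> chunk i"
      have "real c \<le> real (r * n)" using chunk_le[OF c i] by (simp only: of_nat_le_iff)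
      thus "0 \<le> real n \<and> real n \<le> real t - real c" by (simp add: t_def algebra_simps)
    qed
    hence 1: "real n ^ n \<le> (\<Prod>c\<in>chunk i. real t - real c)" by simp
    have "(\<Prod>c\<in>chunk i. real (r * n)) \<le> (\<Prod>c\<in>chunk i. real t + real n + real c)"
      by (rule prod_mono) (simp add: t_def algebra_simps)
    hence 2: "real (r * n) ^ n \<le> (\<Prod>c\<in>chunk i. real t + real n + real c)" by simp
    have 0: "0 \<le> real n ^ n" "0 \<le> real (r * n) ^ n" by simp_all
    have "0 \<le> (\<Prod>c\<in>chunk i. real t - real c) / fact n"
      by (intro divide_nonneg_pos order_trans[OF 0(1) 1]) auto
    thus ?thesis using 0 1 2 by (intro mult_mono divide_right_mono) auto
  qed
  have tj: "real t + real j \<le> real ((r + 2) * n)" if "j \<le> n" for j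
    using that by (simp add: t_def algebra_simps)
  have b1: "(\<Prod>j\<le>n. real t + real j) \<le> real ((r + 2) * n) ^ (n + 1)"
    using prod_mono[of "{..n}" "\<lambda>j. real t + real j" "\<lambda>_. real ((r + 2) * n)"] tj by simp
  have b2: "(\<Prod>j\<in>{nu..19*nu}. real t + real j) \<le> real ((r + 2) * n) ^ (18 * nu + 1)"
    using prod_mono[of "{nu..19*nu}" "\<lambda>j. real t + real j" "\<lambda>_. real ((r + 2) * n)"] tj by (simp add: n_def)
  have p1: "0 < (\<Prod>j\<le>n. real t + real j)" by (rule prod_pos) (use t0 in auto)
  have p2: "0 < (\<Prod>j\<in>{nu..19*nu}. real t + real j)" by (rule prod_pos) (use t0 in auto)
  have "amplitude * (real n ^ (r * n) * real (r * n) ^ (r * n)) / real ((r + 2) * n) ^ decay_exponent =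
     (\<Prod>i<r. (real n ^ n / fact n) * (real (r * n) ^ n / fact n)) *
     (fact n / real ((r + 2) * n) ^ (n + 1)) ^ (q + 1) * (fact (18 * nu) / real ((r + 2) * n) ^ (18 * nu + 1)) ^ q"
    unfolding prod_constant card_lessThan by (rule shape[OF z0, symmetric])
  also have "\<dots> \<le> R (real t)" unfolding R_explicit[OF t0]
  proof (intro mult_mono power_mono)
    show "(\<Prod>i<r. (real n ^ n / fact n) * (real (r * n) ^ n / fact n)) \<le>
      (\<Prod>i<r. ((\<Prod>c\<in>chunk i. real t - real c) / fact n) * ((\<Prod>c\<in>chunk i. real t + real n + real c) / fact n))"
      by (rule prod_mono) (use N in auto)
    show "fact n / real ((r + 2) * n) ^ (n + 1) \<le> fact n / (\<Prod>j\<le>n. real t + real j)"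
      by (rule divide_left_mono[OF b1]) (use p1 z0 in auto)
    show "fact (18 * nu) / real ((r + 2) * n) ^ (18 * nu + 1) \<le> fact (18 * nu) / (\<Prod>j\<in>{nu..19*nu}. real t + real j)"
      by (rule divide_left_mono[OF b2]) (use p2 z0 in auto)
    have "0 \<le> (\<Prod>i<r. (real n ^ n / fact n) * (real (r * n) ^ n / fact n :: real))"
      by (rule prod_nonneg) auto
    also have "\<dots> \<le> (\<Prod>i<r. ((\<Prod>c\<in>chunk i. real t - real c) / fact n) * ((\<Prod>c\<in>chunk i. real t + real n + real c) / fact n))"
      by (rule prod_mono) (use N in auto)
    finally have pn: "0 \<le> (\<Prod>i<r. ((\<Prod>c\<in>chunk i. real t - real c) / fact n) * ((\<Prod>c\<in>chunk i. real t + real n + real c) / fact n))" .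
    show "0 \<le> (\<Prod>i<r. ((\<Prod>c\<in>chunk i. real t - real c) / fact n) * ((\<Prod>c\<in>chunk i. real t + real n + real c) / fact n))"
      by (rule pn)
    show "0 \<le> (\<Prod>i<r. ((\<Prod>c\<in>chunk i. real t - real c) / fact n) * ((\<Prod>c\<in>chunk i. real t + real n + real c) / fact n)) *
      (fact n / (\<Prod>j\<le>n. real t + real j)) ^ (q + 1)"
      by (rule mult_nonneg_nonneg[OF pn]) (use p1 in auto)
  qed (use p1 p2 z0 in auto)
  finally show ?thesis unfolding t_def .
qed

section \<open>The series as a linear form in odd zeta values\<close>

definition Z :: "nat \<Rightarrow> nat \<Rightarrow> real" where "Z i T = (\<Sum>j<T. 1 / real (Suc j) ^ i)"

lemma Z_shift: "(\<Sum>m<T. 1 / (real (Suc m) + real k) ^ i) = Z i (T + k) - Z i k"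
  by (induction T) (simp_all add: Z_def add.commute add.left_commute)

lemma Z_diff_tendsto: assumes "i \<ge> 1" shows "(\<lambda>T. Z i (T + k) - Z i T) \<longlonglongrightarrow> 0"
proof (induction k)
  case (Suc k)
  have "(\<lambda>T. 1 / real (Suc (T + k))) \<longlonglongrightarrow> 0" by real_asymp
  from tendsto_power[OF this, of i] have "(\<lambda>T. 1 / real (Suc (T + k)) ^ i) \<longlonglongrightarrow> 0"
    using assms by (cases i) (auto simp: power_divide)
  from tendsto_add[OF Suc this] show ?case by (simp add: Z_def algebra_simps)
qed simp

lemma R_partial_sum:
  "(\<Sum>m<T. R (real (Suc m))) = (\<Sum>k\<le>n. \<Sum>l<a. G k $ l * (Z (a - l) (T + k) - Z (a - l) k))"
proof -
  have "(\<Sum>m<T. R (real (Suc m))) = (\<Sum>m<T. \<Sum>k\<le>n. \<Sum>l<a. G k $ l / (real (Suc m) + real k) ^ (a - l))"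
    by (intro sum.cong refl R_partial_fractions) simp
  also have "\<dots> = (\<Sum>k\<le>n. \<Sum>m<T. \<Sum>l<a. G k $ l / (real (Suc m) + real k) ^ (a - l))"
    by (rule sum.swap)
  also have "\<dots> = (\<Sum>k\<le>n. \<Sum>l<a. \<Sum>m<T. G k $ l / (real (Suc m) + real k) ^ (a - l))"
    by (intro sum.cong refl sum.swap)
  also have "\<dots> = (\<Sum>k\<le>n. \<Sum>l<a. G k $ l * (Z (a - l) (T + k) - Z (a - l) k))"
    unfolding Z_shift[symmetric] sum_distrib_left by simp
  finally show ?thesis .
qed

text \<open>Two powers of \<open>t\<close> are kept for convergence of the series; in all others
  \<open>t\<close> is replaced by its lower bound \<open>r * n\<close>.\<close>

lemma R_bound_sq:
  assumes t: "t > r * n"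
  shows "R (real t) \<le> amplitude * 3 ^ (r * n) / real (r * n) ^ (decay_exponent - 2 * (r * n) - 2) * (1 / real t ^ 2)"
proof -
  have rn: "r * n > 0" using r n_pos by simp
  define M where "M = decay_exponent - 2 * (r * n) - 2"
  have "decay_exponent - 2 * (r * n) = M + 2" unfolding M_def using decay_exponent_ge by simp
  hence "real t ^ (decay_exponent - 2 * (r * n)) = real t ^ (decay_exponent - 2 * (r * n) - 2) * real t ^ 2"
    unfolding M_def[symmetric] by (simp only: power_add)
  also have "\<dots> \<ge> real (r * n) ^ (decay_exponent - 2 * (r * n) - 2) * real t ^ 2"
    using t by (intro mult_right_mono power_mono) (simp_all only: of_nat_le_iff, auto)
  finally have "amplitude * 3 ^ (r * n) / real t ^ (decay_exponent - 2 * (r * n)) \<le> amplitude * 3 ^ (r * n) / (real (r * n) ^ (decay_exponent - 2 * (r * n) - 2) * real t ^ 2)"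
    using amplitude_pos t rn by (intro divide_left_mono) auto
  thus ?thesis using R_upper(2)[OF t] by simp
qed

text \<open>The limit of \<open>t * R t\<close> as \<open>t\<close> tends to infinity is the sum of
  the coefficients of the simple poles, that is \<open>rho 1\<close>; it is 0 since \<open>R\<close>
  decays at least like \<open>1 / t^2\<close>.\<close>

lemma rho_1: "rho 1 = 0"
proof -
  have a1: "a \<ge> 1" by (simp add: a_def)
  have lim: "(\<lambda>T. real (Suc T) / (real (Suc T) + real k) ^ i) \<longlonglongrightarrow> (if i = 1 then 1 else 0)" if i: "i \<ge> 1" for i k
  proof -
    have "(\<lambda>T. real (Suc T) / (real (Suc T) + real k)) \<longlonglongrightarrow> 1" by real_asymp
    moreover have "(\<lambda>T. 1 / (real (Suc T) + real k)) \<longlonglongrightarrow> 0" by real_asymp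
    ultimately have "(\<lambda>T. real (Suc T) / (real (Suc T) + real k) * (1 / (real (Suc T) + real k)) ^ (i - 1)) \<longlonglongrightarrow> 1 * 0 ^ (i - 1)"
      by (intro tendsto_mult tendsto_power)
    moreover have "real (Suc T) / (real (Suc T) + real k) * (1 / (real (Suc T) + real k)) ^ (i - 1) = real (Suc T) / (real (Suc T) + real k) ^ i" for T
      using i by (cases i) (auto simp: power_divide)
    ultimately show ?thesis using i by (cases "i = 1") (auto simp: power_0_left)
  qed
  have "(\<lambda>T. \<Sum>k\<le>n. \<Sum>l<a. G k $ l * (real (Suc T) / (real (Suc T) + real k) ^ (a - l))) \<longlonglongrightarrow>
     (\<Sum>k\<le>n. \<Sum>l<a. G k $ l * (if a - l = 1 then 1 else 0))"
    by (intro tendsto_sum tendsto_mult tendsto_const lim) auto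
  also have "(\<Sum>k\<le>n. \<Sum>l<a. G k $ l * (if a - l = 1 then 1 else 0)) = rho 1"
    unfolding rho_def
  proof (intro sum.cong refl)
    fix k
    have "(\<Sum>l<a. G k $ l * (if a - l = 1 then 1 else 0)) = (\<Sum>l\<in>{a - 1}. G k $ l)"
      using a1 by (intro sum.mono_neutral_cong_right) auto
    thus "(\<Sum>l<a. G k $ l * (if a - l = 1 then 1 else 0)) = G k $ (a - 1)" by simp
  qed
  also have "(\<lambda>T. \<Sum>k\<le>n. \<Sum>l<a. G k $ l * (real (Suc T) / (real (Suc T) + real k) ^ (a - l))) = (\<lambda>T. real (Suc T) * R (real (Suc T)))"
  proof
    fix T
    show "(\<Sum>k\<le>n. \<Sum>l<a. G k $ l * (real (Suc T) / (real (Suc T) + real k) ^ (a - l))) = real (Suc T) * R (real (Suc T))"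
      by (subst R_partial_fractions) (auto simp: sum_distrib_left mult_ac intro!: sum.cong)
  qed
  finally have l1: "(\<lambda>T. real (Suc T) * R (real (Suc T))) \<longlonglongrightarrow> rho 1" .
  define C where "C = amplitude * 3 ^ (r * n) / real (r * n) ^ (decay_exponent - 2 * (r * n) - 2)"
  have "(\<lambda>T. real (Suc T) * R (real (Suc T))) \<longlonglongrightarrow> 0"
  proof (rule Lim_null_comparison)
    show "eventually (\<lambda>T. norm (real (Suc T) * R (real (Suc T))) \<le> C / real (Suc T)) sequentially"
      using eventually_ge_at_top[of "r * n"]
    proof eventually_elim
      case (elim T)
      have "R (real (Suc T)) \<le> C * (1 / real (Suc T) ^ 2)" unfolding C_def by (rule R_bound_sq) (use elim in simp)
      hence "real (Suc T) * R (real (Suc T)) \<le> real (Suc T) * (C * (1 / real (Suc T) ^ 2))"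
        by (rule mult_left_mono) simp
      also have "\<dots> = C / real (Suc T)" by (simp add: power2_eq_square del: of_nat_Suc)
      finally show ?case using R_nonneg[of "Suc T"] by (simp add: abs_mult del: of_nat_Suc)
    qed
    show "(\<lambda>T. C / real (Suc T)) \<longlonglongrightarrow> 0" by real_asymp
  qed
  thus ?thesis using LIMSEQ_unique[OF l1] by simp
qed

text \<open>The sum over \<open>t \<ge> 1\<close> of \<open>1 / (t + k) ^ i\<close> lacks the first
  \<open>k\<close> terms of the zeta series; \<open>rho0\<close> collects these corrections for all
  exponents, odd or even.\<close>

definition rho0 :: real where "rho0 = - (\<Sum>k\<le>n. \<Sum>l<a. G k $ l * Z (a - l) k)"

definition odds :: "nat set" where "odds = {i. odd i \<and> 3 \<le> i \<and> i \<le> a}"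

definition linear_form :: real where "linear_form = rho0 + (\<Sum>i\<in>odds. rho i * zeta i)"

text \<open>The rearrangement is done for finite \<open>T\<close>, since the harmonic sums belonging
  to \<open>i = 1\<close> diverge. Their coefficient \<open>rho 1\<close> vanishes, and the
  differences \<open>Z i (T + k) - Z i T\<close> tend to 0 for every
  \<open>i \<ge> 1\<close>.\<close>

lemma linear_form_sums: "(\<lambda>m. R (real (Suc m))) sums linear_form"
  unfolding sums_def
proof -
  have fin: "finite odds" unfolding odds_def by (rule finite_subset[of _ "{..a}"]) auto
  have eq: "(\<Sum>m<T. R (real (Suc m))) = (\<Sum>i\<in>odds. rho i * Z i T) + rho0 + (\<Sum>k\<le>n. \<Sum>l<a. G k $ l * (Z (a - l) (T + k) - Z (a - l) T))" for T
  proof -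
    have "(\<Sum>i\<in>odds. rho i * Z i T) = (\<Sum>i\<in>{1..a}. rho i * Z i T)"
    proof (rule sum.mono_neutral_left)
      show "\<forall>i\<in>{1..a} - odds. rho i * Z i T = 0"
      proof
        fix i assume i: "i \<in> {1..a} - odds"
        show "rho i * Z i T = 0"
        proof (cases "even i")
          case True thus ?thesis using rho_even[of i] i by simp
        next
          case False
          hence "i = 1" using i by (auto simp: odds_def) presburger
          thus ?thesis using rho_1 by simp
        qed
      qed
    qed (auto simp: odds_def)
    also have "\<dots> = (\<Sum>l<a. rho (a - l) * Z (a - l) T)"
      by (rule sum.reindex_bij_witness[of _ "\<lambda>l. a - l" "\<lambda>i. a - i"]) auto
    also have "\<dots> = (\<Sum>l<a. \<Sum>k\<le>n. G k $ l * Z (a - l) T)"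
      unfolding rho_def sum_distrib_right by (intro sum.cong refl) auto
    also have "\<dots> = (\<Sum>k\<le>n. \<Sum>l<a. G k $ l * Z (a - l) T)" by (rule sum.swap)
    finally show ?thesis unfolding R_partial_sum rho0_def
      by (simp add: sum.distrib[symmetric] sum_subtractf[symmetric] algebra_simps)
  qed
  have "(\<lambda>T. (\<Sum>i\<in>odds. rho i * Z i T) + rho0 + (\<Sum>k\<le>n. \<Sum>l<a. G k $ l * (Z (a - l) (T + k) - Z (a - l) T)))
     \<longlonglongrightarrow> (\<Sum>i\<in>odds. rho i * zeta i) + rho0 + (\<Sum>k\<le>n. \<Sum>l<a. G k $ l * 0)"
  proof (intro tendsto_add tendsto_sum tendsto_mult tendsto_const Z_diff_tendsto)
    show "(\<lambda>T. Z i T) \<longlonglongrightarrow> zeta i" if "i \<in> odds" for i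
      unfolding Z_def zeta_def using that by (intro summable_LIMSEQ summable_zeta) (auto simp: odds_def)
  qed auto
  thus "(\<lambda>T. \<Sum>m<T. R (real (Suc m))) \<longlonglongrightarrow> linear_form" unfolding eq by (simp add: linear_form_def add.commute)
qed

lemma linear_form_lower: "linear_form \<ge> amplitude * (real n ^ (r * n) * real (r * n) ^ (r * n)) / real ((r + 2) * n) ^ decay_exponent"
proof -
  have "(r + 1) * n > 0" using n_pos by simp
  then obtain m where m: "(r + 1) * n = Suc m" using gr0_implies_Suc by blast
  have "(\<Sum>m\<in>{m}. R (real (Suc m))) \<le> (\<Sum>m. R (real (Suc m)))"
    by (rule sum_le_suminf[OF sums_summable[OF linear_form_sums]]) (use R_nonneg[of "Suc _"] in \<open>auto simp del: of_nat_Suc\<close>)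
  hence "R (real ((r + 1) * n)) \<le> linear_form" using sums_unique[OF linear_form_sums] unfolding m by simp
  thus ?thesis using R_lower by linarith
qed

lemma linear_form_upper: "linear_form \<le> amplitude * 3 ^ (r * n) / real (r * n) ^ (decay_exponent - 2 * (r * n) - 2) * zeta 2"
proof -
  define C where "C = amplitude * 3 ^ (r * n) / real (r * n) ^ (decay_exponent - 2 * (r * n) - 2)"
  have C0: "C \<ge> 0" unfolding C_def using amplitude_pos by auto
  have "(\<lambda>m. C * (1 / real (Suc m) ^ 2)) sums (C * zeta 2)"
    unfolding zeta_def by (intro sums_mult summable_sums summable_zeta) simp
  moreover have le: "R (real (Suc m)) \<le> C * (1 / real (Suc m) ^ 2)" for m
  proof (cases "Suc m \<le> r * n")
    case True thus ?thesis using R_zero[of "Suc m"] C0 by (simp del: of_nat_Suc)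
  next
    case False thus ?thesis unfolding C_def by (intro R_bound_sq) simp
  qed
  ultimately show ?thesis using sums_le[OF le linear_form_sums] unfolding C_def by simp
qed

end

section \<open>Common denominators of the coefficients\<close>

lemma p_integral_all_int:
  assumes "\<And>p. prime p \<Longrightarrow> p_integral p x"
  obtains z :: int where "x = of_int z"
proof -
  \<comment> \<open>The prime 2 serves only to obtain some representation of \<open>x\<close> as a
    fraction.\<close>
  obtain a b :: int where "\<not> int 2 dvd b" "x = of_int a / of_int b"
    using assms[OF two_is_prime_nat] unfolding p_integral_def by blast
  moreover have "b \<noteq> 0" using \<open>\<not> int 2 dvd b\<close> by auto
  ultimately show thesis using p_integral_imp_int[of x a b] assms that by blast
qed

context zudilin_form
begin

text \<open>The exponent of \<open>p\<close> in \<open>lcm(1,\<dots>,n)\<close>. The description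
  determines it when \<open>p\<close> is a prime.\<close>

definition max_exponent :: "nat \<Rightarrow> nat" where "max_exponent p = (SOME e. p ^ e \<le> n \<and> n < p ^ Suc e)"

lemma max_exponent: assumes "prime p" shows "p ^ max_exponent p \<le> n" "n < p ^ Suc (max_exponent p)"
proof -
  have "\<exists>e. p ^ e \<le> n \<and> n < p ^ Suc e"
    using ex_power_ivl1[of p n] prime_ge_2_nat[OF assms] n_pos by auto
  from someI_ex[OF this] show "p ^ max_exponent p \<le> n" "n < p ^ Suc (max_exponent p)" unfolding max_exponent_def by auto
qed

text \<open>It makes the natural subtraction \<open>a * max_exponent p - gain p\<close> exact. A
  special prime is at most \<open>n\<close>, so its exponent is at least 1, and
  \<open>q \<le> a\<close>.\<close>

lemma gain_le: assumes "prime p" shows "gain p \<le> a * max_exponent p"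
proof (cases "special p")
  case True
  then obtain m where m: "1 \<le> m" "m * p \<le> 20 * nu" by (auto simp: special_def)
  have "1 * p \<le> m * p" using m(1) by (rule mult_right_mono) simp
  hence "p \<le> n" using m(2) unfolding n_def by linarith
  hence "max_exponent p \<noteq> 0" using max_exponent(2)[OF assms] by (intro notI) simp
  hence "a * 1 \<le> a * max_exponent p" by (intro mult_left_mono) auto
  thus ?thesis by (simp add: gain_def a_def)
qed (simp add: gain_def)

definition denom :: nat where "denom = (\<Prod>p\<in>{p. prime p \<and> p \<le> n}. p ^ (a * max_exponent p - gain p))"

lemma fin_primes: "finite {p. prime p \<and> p \<le> n}" by (rule finite_subset[of _ "{..n}"]) auto

lemma denom_pos: "denom > 0" unfolding denom_def by (rule prod_pos) (auto dest: prime_gt_0_nat)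

lemma denom_dvd: assumes p: "prime p" shows "p ^ (a * max_exponent p) dvd denom * p ^ gain p"
proof (cases "p \<le> n")
  case True
  have "p ^ (a * max_exponent p - gain p) dvd denom"
    unfolding denom_def by (rule dvd_prodI[OF fin_primes]) (use True p in auto)
  hence "p ^ (a * max_exponent p - gain p) * p ^ gain p dvd denom * p ^ gain p" by (rule mult_dvd_mono) simp
  thus ?thesis using gain_le[OF p] by (simp flip: power_add)
next
  case False
  have "max_exponent p = 0"
  proof (rule ccontr)
    assume "max_exponent p \<noteq> 0"
    hence "p ^ 1 \<le> p ^ max_exponent p" using p prime_ge_1_nat by (intro power_increasing) auto
    thus False using max_exponent(1)[OF p] False by simp
  qed
  thus ?thesis by simp
qed

text \<open>One estimate for both kinds of coefficients: \<open>x = 1\<close> serves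
  \<open>rho i\<close>, and \<open>x = j + 1\<close> with \<open>j < k\<close> serves the summands
  of \<open>rho0\<close>.\<close>

lemma p_integral_term:
  assumes p: "prime p" and k: "k \<le> n" and l: "l < a" and x: "1 \<le> x" "x \<le> n"
  shows "p_integral p (real denom * G k $ l / real x ^ (a - l))"
proof -
  define e where "e = max_exponent p"
  have e: "int p ^ e \<le> int n" "int n < int p ^ Suc e"
    using max_exponent[OF p] unfolding e_def by (simp_all only: of_nat_power[symmetric] of_nat_le_iff of_nat_less_iff)
  have p0: "real p > 0" using p by (auto dest: prime_gt_0_nat)
  have A: "p_integral p (G k $ l * real p powi (int (e * l) - int (gain p)))"
    using val_bounded_gain[OF p e k] unfolding val_bounded_def[OF p] by blast
  obtain D' where D': "denom * p ^ gain p = p ^ (a * e) * D'" using denom_dvd[OF p] unfolding e_def by (rule dvdE)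
  have "\<bar>int x\<bar> < int p ^ Suc e" using x e by simp
  then obtain x' where x': "int x = int p ^ val_upto p e (int x) * x'" "\<not> int p dvd x'"
    using val_upto_exact[OF p, of "int x" e] x by auto
  define v where "v = val_upto p e (int x)"
  have v: "v \<le> e" unfolding v_def by (rule val_upto_le[OF p])
  have x'0: "real_of_int x' \<noteq> 0" using x'(2) by auto
  have xr: "real x = real p ^ v * of_int x'"
  proof -
    have "real_of_int (int x) = real_of_int (int p ^ v * x')" using x'(1) unfolding v_def by (simp only:)
    thus ?thesis by simp
  qed
  have Dr: "real denom = real p ^ (a * e) * real D' / real p ^ gain p"
  proof -
    have "real (denom * p ^ gain p) = real (p ^ (a * e) * D')" unfolding D' ..
    thus ?thesis using p0 by (simp add: field_simps)
  qed
  \<comment> \<open>The budget of \<open>a * e\<close> powers of \<open>p\<close>: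
    \<open>e * l\<close> pays for the coefficient of index \<open>l\<close>,
    \<open>v * (a - l)\<close> for the power of \<open>x\<close>, and the middle part is a
    surplus.\<close>
  have ex: "a * e = e * l + (e - v) * (a - l) + v * (a - l)"
  proof -
    have "(e - v) * (a - l) + v * (a - l) = e * (a - l)" using v by (simp flip: distrib_right)
    moreover have "e * l + e * (a - l) = e * a" using l by (simp flip: distrib_left)
    ultimately show ?thesis by (simp add: mult.commute)
  qed
  have pi: "real p powi (int (e * l) - int (gain p)) = real p ^ (e * l) / real p ^ gain p"
    using p0 by (simp add: power_int_diff flip: of_nat_mult)
  have "real denom * G k $ l / real x ^ (a - l) =
     (G k $ l * real p powi (int (e * l) - int (gain p))) * real D' * (1 / of_int x') ^ (a - l) * real p ^ ((e - v) * (a - l))"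
    unfolding Dr xr pi ex power_mult_distrib power_add power_mult[symmetric] using p0 x'0
    by (simp add: power_divide field_simps)
  also have "p_integral p \<dots>"
    by (rule p_integral_mult[OF p p_integral_mult[OF p p_integral_mult[OF p A p_integral_of_nat[OF p]]
          p_integral_power[OF p p_integral_inverse_int[OF p x'(2)]]] p_integral_power[OF p p_integral_of_nat[OF p]]])
  finally show ?thesis .
qed

lemma int_rho: assumes "i \<in> odds" obtains z :: int where "real denom * rho i = of_int z"
proof (rule p_integral_all_int)
  fix p :: nat assume p: "prime p"
  have "real denom * rho i = (\<Sum>k\<le>n. real denom * G k $ (a - i) / real 1 ^ (a - (a - i)))"
    by (simp add: rho_def sum_distrib_left)
  also have "p_integral p \<dots>"
    by (intro p_integral_sum[OF p] p_integral_term[OF p]) (use assms n_pos in \<open>auto simp: odds_def a_def\<close>)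
  finally show "p_integral p (real denom * rho i)" .
qed

lemma int_rho0: obtains z :: int where "real denom * rho0 = of_int z"
proof (rule p_integral_all_int)
  fix p :: nat assume p: "prime p"
  have "real denom * rho0 = - (\<Sum>k\<le>n. \<Sum>l<a. \<Sum>j<k. real denom * G k $ l / real (Suc j) ^ (a - l))"
    by (simp add: rho0_def Z_def sum_distrib_left mult.assoc)
  also have "p_integral p \<dots>"
    by (intro p_integral_uminus[OF p] p_integral_sum[OF p] p_integral_term[OF p]) auto
  finally show "p_integral p (real denom * rho0)" .
qed

definition coeff_bound :: real where "coeff_bound = real (n + 1) * (real a * (2 ^ a * G_bound * real (n + 1)))"

lemma G_bound_nonneg: "G_bound \<ge> 0" using weighted_norm_G[of 0 0] weighted_norm_nonneg[of 0 "G 0"] by simp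

lemma rho_bound: assumes "i \<in> odds" shows "\<bar>rho i\<bar> \<le> coeff_bound"
proof -
  have "\<bar>rho i\<bar> \<le> (\<Sum>k\<le>n. \<bar>G k $ (a - i)\<bar>)" unfolding rho_def by (rule sum_abs)
  also have "\<dots> \<le> (\<Sum>k\<le>n. 2 ^ a * G_bound)" by (intro sum_mono G_coeff_bound) auto
  also have "\<dots> = real (n + 1) * (1 * (2 ^ a * G_bound * 1))" by simp
  also have "\<dots> \<le> coeff_bound" unfolding coeff_bound_def
    by (intro mult_left_mono mult_mono) (use G_bound_nonneg in \<open>auto simp: a_def\<close>)
  finally show ?thesis .
qed

lemma rho0_bound: "\<bar>rho0\<bar> \<le> coeff_bound"
proof -
  have Z: "\<bar>Z i k\<bar> \<le> real (n + 1)" if "k \<le> n" for i k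
  proof -
    have "\<bar>Z i k\<bar> \<le> (\<Sum>j<k. \<bar>1 / real (Suc j) ^ i\<bar>)" unfolding Z_def by (rule sum_abs)
    also have "\<dots> \<le> (\<Sum>j<k. 1)"
    proof (rule sum_mono)
      fix j
      have "(1::real) \<le> real (Suc j) ^ i" by (rule one_le_power) simp
      thus "\<bar>1 / real (Suc j) ^ i\<bar> \<le> 1" by simp
    qed
    also have "\<dots> \<le> real (n + 1)" using that by simp
    finally show ?thesis .
  qed
  have "\<bar>rho0\<bar> \<le> (\<Sum>k\<le>n. \<bar>\<Sum>l<a. G k $ l * Z (a - l) k\<bar>)" unfolding rho0_def abs_minus_cancel by (rule sum_abs)
  also have "\<dots> \<le> (\<Sum>k\<le>n. \<Sum>l<a. \<bar>G k $ l * Z (a - l) k\<bar>)" by (intro sum_mono sum_abs)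
  also have "\<dots> \<le> (\<Sum>k\<le>n. \<Sum>l<a. 2 ^ a * G_bound * real (n + 1))"
    unfolding abs_mult by (intro sum_mono mult_mono G_coeff_bound Z) (use G_bound_nonneg in auto)
  also have "\<dots> = coeff_bound" by (simp add: coeff_bound_def)
  finally show ?thesis .
qed

lemma special_sum:
  "(\<Sum>p | prime p \<and> p \<le> n \<and> special p. ln (real p)) =
     (\<Sum>m\<in>{1..10}. theta (20 * nu div m) - theta (19 * nu div m))"
proof -
  define S where "S = (\<lambda>m. {p. prime p \<and> m * p \<le> 20 * nu \<and> 19 * nu < m * p})"
  have fin: "finite (S m)" if "m \<in> {1..10}" for m
  proof (rule finite_subset[of _ "{..20 * nu}"])
    show "S m \<subseteq> {..20 * nu}"
    proof
      fix p assume p: "p \<in> S m"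
      have "1 * p \<le> m * p" using that by (intro mult_right_mono) auto
      also have "m * p \<le> 20 * nu" using p by (simp add: S_def)
      finally show "p \<in> {..20 * nu}" by simp
    qed
  qed simp
  have eq: "{p. prime p \<and> p \<le> n \<and> special p} = (\<Union>m\<in>{1..10}. S m)"
  proof (intro equalityI subsetI)
    fix p assume "p \<in> (\<Union>m\<in>{1..10}. S m)"
    then obtain m where m: "m \<in> {1..10}" "p \<in> S m" by blast
    have "1 * p \<le> m * p" using m by (intro mult_right_mono) auto
    also have "m * p \<le> n" using m by (simp add: S_def n_def)
    finally have "p \<le> n" by simp
    thus "p \<in> {p. prime p \<and> p \<le> n \<and> special p}"
      using m by (auto simp: S_def special_def)
  qed (auto simp: S_def special_def)
  \<comment> \<open>A prime in two of these sets would satisfy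
    \<open>(m + 1) * p \<le> 20 * \<nu>\<close> and \<open>19 * \<nu> < m * p\<close>. Then
    \<open>p < \<nu>\<close>, and \<open>m * p \<le> 10 * p\<close> contradicts the second
    inequality.\<close>
  have disj: "S m \<inter> S m' = {}" if "m \<in> {1..10}" "m < m'" for m m'
  proof (rule ccontr)
    assume "S m \<inter> S m' \<noteq> {}"
    then obtain p where p: "p \<in> S m" "p \<in> S m'" by blast
    have "(m + 1) * p \<le> m' * p" using that by (intro mult_right_mono) auto
    hence "m * p + p \<le> 20 * nu" using p by (simp add: S_def)
    moreover have "m * p \<le> 10 * p" using that by (intro mult_right_mono) auto
    moreover have "19 * nu < m * p" using p by (simp add: S_def)
    ultimately show False by linarith
  qed
  have "(\<Sum>p | prime p \<and> p \<le> n \<and> special p. ln (real p)) = (\<Sum>m\<in>{1..10}. \<Sum>p\<in>S m. ln (real p))"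
    unfolding eq
  proof (rule sum.UNION_disjoint)
    show "\<forall>i\<in>{1..10}. \<forall>j\<in>{1..10}. i \<noteq> j \<longrightarrow> S i \<inter> S j = {}"
      using disj by (metis inf_commute nat_neq_iff)
  qed (use fin in auto)
  also have "\<dots> = (\<Sum>m\<in>{1..10}. theta (20 * nu div m) - theta (19 * nu div m))"
  proof (intro sum.cong refl)
    fix m :: nat assume m: "m \<in> {1..10}"
    have m0: "m > 0" using m by simp
    have Sm: "S m = {p. prime p \<and> p \<le> 20 * nu div m} - {p. prime p \<and> p \<le> 19 * nu div m}"
      unfolding S_def using m0 by (auto simp: less_eq_div_iff_mult_less_eq mult.commute not_le)
    have sub: "{p. prime p \<and> p \<le> 19 * nu div m} \<subseteq> {p. prime p \<and> p \<le> 20 * nu div m}"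
      using div_le_mono[of "19 * nu" "20 * nu" m] by auto
    have f: "finite {p. prime p \<and> p \<le> (N::nat)}" for N by (rule finite_subset[of _ "{..N}"]) auto
    show "(\<Sum>p\<in>S m. ln (real p)) = theta (20 * nu div m) - theta (19 * nu div m)"
      unfolding Sm theta_def by (rule sum_diff[OF f sub])
  qed
  finally show ?thesis .
qed

text \<open>Above \<open>sqrt n\<close> the exponent of a prime in the least common multiple is 1.
  The at most \<open>sqrt n\<close> smaller primes contribute no more than \<open>ln n\<close> each,
  which is an error of order \<open>sqrt n * ln n\<close>.\<close>

lemma ln_denom: "ln (real denom) \<le> real a * (theta n + sqrt (real n) * ln (real n)) -
    real q * (\<Sum>m\<in>{1..10}. theta (20 * nu div m) - theta (19 * nu div m))"
proof -
  let ?P = "{p. prime p \<and> p \<le> n}"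
  have lnn: "ln (real n) \<ge> 0" using n_pos by simp
  have "ln (real denom) = (\<Sum>p\<in>?P. ln (real (p ^ (a * max_exponent p - gain p))))"
    unfolding denom_def of_nat_prod by (rule ln_prod[OF fin_primes]) (auto dest: prime_gt_0_nat)
  also have "\<dots> = (\<Sum>p\<in>?P. (real a * real (max_exponent p) - real (gain p)) * ln (real p))"
  proof (intro sum.cong refl)
    fix p assume p: "p \<in> ?P"
    hence "real (a * max_exponent p - gain p) = real a * real (max_exponent p) - real (gain p)"
      using gain_le[of p] by (simp add: of_nat_diff)
    thus "ln (real (p ^ (a * max_exponent p - gain p))) = (real a * real (max_exponent p) - real (gain p)) * ln (real p)"
      using p by (simp add: ln_realpow prime_gt_0_nat)
  qed
  also have "\<dots> = real a * (\<Sum>p\<in>?P. real (max_exponent p) * ln (real p)) - (\<Sum>p\<in>?P. real (gain p) * ln (real p))"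
    by (simp add: left_diff_distrib sum_subtractf sum_distrib_left mult.assoc)
  also have "(\<Sum>p\<in>?P. real (gain p) * ln (real p)) = real q * (\<Sum>p | prime p \<and> p \<le> n \<and> special p. ln (real p))"
  proof -
    have "(\<Sum>p\<in>?P. real (gain p) * ln (real p)) = (\<Sum>p | prime p \<and> p \<le> n \<and> special p. real q * ln (real p))"
      by (rule sum.mono_neutral_cong_right[OF fin_primes]) (auto simp: gain_def)
    thus ?thesis by (simp add: sum_distrib_left)
  qed
  also have "(\<Sum>p\<in>?P. real (max_exponent p) * ln (real p)) \<le> theta n + sqrt (real n) * ln (real n)"
  proof -
    have "(\<Sum>p\<in>?P. real (max_exponent p) * ln (real p)) \<le> (\<Sum>p\<in>?P. ln (real p) + (if p ^ 2 \<le> n then ln (real n) else 0))"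
    proof (rule sum_mono)
      fix p assume "p \<in> ?P"
      hence p: "prime p" "p \<le> n" by auto
      have lp: "ln (real p) \<ge> 0" using prime_ge_1_nat[OF p(1)] by simp
      show "real (max_exponent p) * ln (real p) \<le> ln (real p) + (if p ^ 2 \<le> n then ln (real n) else 0)"
      proof (cases "p ^ 2 \<le> n")
        case True
        have "real (max_exponent p) * ln (real p) = ln (real (p ^ max_exponent p))" using p by (simp add: ln_realpow prime_gt_0_nat)
        also have "\<dots> \<le> ln (real n)" using max_exponent(1)[OF p(1)] p
          by (subst ln_le_cancel_iff) (auto simp: prime_gt_0_nat n_pos simp del: of_nat_power)
        finally show ?thesis using True lp by simp
      next
        case False
        have "max_exponent p < 2"
        proof (rule ccontr)
          assume "\<not> max_exponent p < 2"
          hence "p ^ 2 \<le> p ^ max_exponent p" using prime_ge_1_nat[OF p(1)] by (intro power_increasing) auto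
          thus False using max_exponent(1)[OF p(1)] False by simp
        qed
        hence "real (max_exponent p) * ln (real p) \<le> 1 * ln (real p)" using lp by (intro mult_right_mono) auto
        thus ?thesis using False by simp
      qed
    qed
    also have "\<dots> = theta n + (\<Sum>p\<in>?P. if p ^ 2 \<le> n then ln (real n) else 0)"
      by (simp add: sum.distrib theta_def)
    also have "(\<Sum>p\<in>?P. if p ^ 2 \<le> n then ln (real n) else 0) = (\<Sum>p\<in>{p\<in>?P. p ^ 2 \<le> n}. ln (real n))"
      by (rule sum.inter_filter[OF fin_primes, symmetric])
    also have "\<dots> = real (card {p\<in>?P. p ^ 2 \<le> n}) * ln (real n)" by simp
    also have "\<dots> \<le> sqrt (real n) * ln (real n)"
    proof (rule mult_right_mono[OF _ lnn])
      have "{p\<in>?P. p ^ 2 \<le> n} \<subseteq> {1..nat \<lfloor>sqrt (real n)\<rfloor>}"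
      proof
        fix p assume p: "p \<in> {p\<in>?P. p ^ 2 \<le> n}"
        hence "(real p)\<^sup>2 \<le> real n" by (simp flip: of_nat_power)
        hence "real p \<le> sqrt (real n)" by (rule real_le_rsqrt)
        thus "p \<in> {1..nat \<lfloor>sqrt (real n)\<rfloor>}" using p prime_ge_1_nat[of p] by (auto simp: le_nat_floor)
      qed
      from card_mono[OF _ this] have "card {p\<in>?P. p ^ 2 \<le> n} \<le> nat \<lfloor>sqrt (real n)\<rfloor>" by simp
      moreover have "real (nat \<lfloor>sqrt (real n)\<rfloor>) \<le> sqrt (real n)" by simp
      ultimately show "real (card {p\<in>?P. p ^ 2 \<le> n}) \<le> sqrt (real n)" by linarith
    qed
    finally show ?thesis by simp
  qed
  finally show ?thesis unfolding special_sum by (simp add: mult_left_mono)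
qed

end

section \<open>Asymptotics\<close>

text \<open>Stirling's formula to the precision needed, by induction with
  \<open>1 / (n + 1) \<le> ln (1 + 1 / n) \<le> 1 / n\<close>.\<close>

lemma ln_fact_bounds:
  assumes "n \<ge> 1"
  shows "ln (fact n) \<ge> real n * ln (real n) - real n"
    "ln (fact n) \<le> real n * ln (real n) - real n + ln (real n) + 1"
  using assms
proof (induction n rule: dec_induct)
  case (step n)
  have n: "real n > 0" using step by simp
  have f: "ln (fact (Suc n)) = ln (real n + 1) + ln (fact n)"
    by (simp add: ln_mult_pos add.commute)
  have d: "ln (real n + 1) - ln (real n) = ln (1 + 1 / real n)"
  proof -
    have "ln (real n + 1) - ln (real n) = ln ((real n + 1) / real n)"
      by (rule ln_divide_pos[symmetric]) (use n in auto)
    also have "(real n + 1) / real n = 1 + 1 / real n" using n by (simp add: field_simps)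
    finally show ?thesis .
  qed
  {
    case 1
    have "ln (1 + 1 / real n) \<le> 1 / real n" using n by (intro ln_add_one_self_le_self) auto
    hence "real n * (ln (real n + 1) - ln (real n)) \<le> real n * (1 / real n)" unfolding d using n by (intro mult_left_mono) auto
    hence "real n * ln (real n + 1) - real n * ln (real n) \<le> 1" using n by (simp add: right_diff_distrib)
    thus ?case using step.IH(1) unfolding f by (simp add: algebra_simps)
  next
    case 2
    have "ln (1 + 1 / real n) = - ln (real n / (real n + 1))"
      using n by (subst ln_inverse[symmetric]) (auto simp: field_simps)
    moreover have "ln (real n / (real n + 1)) \<le> real n / (real n + 1) - 1" using n by (intro ln_le_minus_one) auto
    ultimately have "ln (1 + 1 / real n) \<ge> 1 / (real n + 1)" using n by (simp add: field_simps)
    hence "(real n + 1) * (1 / (real n + 1)) \<le> (real n + 1) * (ln (real n + 1) - ln (real n))"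
      unfolding d using n by (intro mult_left_mono) auto
    hence "1 \<le> (real n + 1) * ln (real n + 1) - (real n + 1) * ln (real n)"
      using n by (simp add: right_diff_distrib)
    thus ?case using step.IH(2) unfolding f by (simp add: algebra_simps)
  }
qed auto

lemma ln_fact_asymp:
  assumes m: "m > 0"
  shows "(\<lambda>\<nu>. (ln (fact (m * \<nu>)) - real m * real \<nu> * ln (real \<nu>)) / real \<nu>) \<longlonglongrightarrow> real m * ln (real m) - real m"
proof (rule tendsto_sandwich)
  have eq: "real (m * \<nu>) * ln (real (m * \<nu>)) = real m * real \<nu> * ln (real \<nu>) + real m * real \<nu> * ln (real m)" if "\<nu> > 0" for \<nu>
    using that m by (simp add: ln_mult_pos distrib_left)
  show "eventually (\<lambda>\<nu>. real m * ln (real m) - real m \<le> (ln (fact (m * \<nu>)) - real m * real \<nu> * ln (real \<nu>)) / real \<nu>) sequentially"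
    using eventually_gt_at_top[of 0]
  proof eventually_elim
    case (elim \<nu>)
    have "1 \<le> m * \<nu>" using elim m by simp
    from ln_fact_bounds(1)[OF this] have "real \<nu> * (real m * ln (real m) - real m) \<le> ln (fact (m * \<nu>)) - real m * real \<nu> * ln (real \<nu>)"
      unfolding eq[OF elim] by (simp add: algebra_simps)
    thus ?case using elim by (simp add: pos_le_divide_eq mult.commute)
  qed
  show "eventually (\<lambda>\<nu>. (ln (fact (m * \<nu>)) - real m * real \<nu> * ln (real \<nu>)) / real \<nu> \<le>
     real m * ln (real m) - real m + (ln (real m * real \<nu>) + 1) / real \<nu>) sequentially"
    using eventually_gt_at_top[of 0]
  proof eventually_elim
    case (elim \<nu>)
    have "1 \<le> m * \<nu>" using elim m by simp
    from ln_fact_bounds(2)[OF this] have "ln (fact (m * \<nu>)) - real m * real \<nu> * ln (real \<nu>) \<le> real \<nu> * (real m * ln (real m) - real m) + (ln (real m * real \<nu>) + 1)"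
      unfolding eq[OF elim] by (simp add: algebra_simps)
    hence "(ln (fact (m * \<nu>)) - real m * real \<nu> * ln (real \<nu>)) / real \<nu> \<le> (real \<nu> * (real m * ln (real m) - real m) + (ln (real m * real \<nu>) + 1)) / real \<nu>"
      by (rule divide_right_mono) simp
    thus ?case using elim by (simp add: add_divide_distrib)
  qed
  have "(\<lambda>\<nu>::nat. (ln (real m * real \<nu>) + 1) / real \<nu>) \<longlonglongrightarrow> 0" using m by real_asymp
  from tendsto_add[OF tendsto_const this]
  show "(\<lambda>\<nu>. real m * ln (real m) - real m + (ln (real m * real \<nu>) + 1) / real \<nu>) \<longlonglongrightarrow> real m * ln (real m) - real m" by simp
qed simp

lemma theta_div_asymp:
  assumes "m > 0" "c > 0"
  shows "(\<lambda>\<nu>. theta (c * \<nu> div m) / real \<nu>) \<longlonglongrightarrow> real c / real m"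
proof -
  have fl: "filterlim (\<lambda>\<nu>. c * \<nu> div m) at_top sequentially"
    unfolding filterlim_at_top
  proof
    fix Z
    show "eventually (\<lambda>\<nu>. Z \<le> c * \<nu> div m) sequentially"
      using eventually_ge_at_top[of "Z * m"]
    proof eventually_elim
      case (elim \<nu>)
      have "1 * \<nu> \<le> c * \<nu>" using assms by (intro mult_right_mono) auto
      hence "Z * m \<le> c * \<nu>" using elim by linarith
      thus ?case using assms(1) by (subst less_eq_div_iff_mult_less_eq)
    qed
  qed
  have 1: "(\<lambda>\<nu>. theta (c * \<nu> div m) / real (c * \<nu> div m)) \<longlonglongrightarrow> 1"
    by (rule filterlim_compose[OF theta_asymp fl])
  have 2: "(\<lambda>\<nu>. real (c * \<nu> div m) / real \<nu>) \<longlonglongrightarrow> real c / real m"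
  proof (rule tendsto_sandwich)
    show "eventually (\<lambda>\<nu>. (real c * real \<nu> / real m - 1) / real \<nu> \<le> real (c * \<nu> div m) / real \<nu>) sequentially"
    proof (intro always_eventually allI divide_right_mono)
      fix \<nu>
      have "c * \<nu> < (c * \<nu> div m + 1) * m" using dividend_less_div_times[OF assms(1), of "c * \<nu>"] by (simp add: algebra_simps)
      hence "real (c * \<nu>) < real ((c * \<nu> div m + 1) * m)" by (simp only: of_nat_less_iff)
      hence "real c * real \<nu> / real m < real (c * \<nu> div m) + 1" using assms(1) by (simp add: pos_divide_less_eq algebra_simps)
      thus "real c * real \<nu> / real m - 1 \<le> real (c * \<nu> div m)" by simp
    qed simp
    show "eventually (\<lambda>\<nu>. real (c * \<nu> div m) / real \<nu> \<le> (real c * real \<nu> / real m) / real \<nu>) sequentially"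
      using of_nat_div_le_of_nat[of "c * _" m, where 'a = real]
      by (intro always_eventually allI divide_right_mono) auto
    show "(\<lambda>\<nu>::nat. (real c * real \<nu> / real m - 1) / real \<nu>) \<longlonglongrightarrow> real c / real m" unfolding divide_inverse[of "real c"] using assms by real_asymp
    show "(\<lambda>\<nu>::nat. (real c * real \<nu> / real m) / real \<nu>) \<longlonglongrightarrow> real c / real m" unfolding divide_inverse[of "real c"] using assms by real_asymp
  qed
  have "(\<lambda>\<nu>. theta (c * \<nu> div m) / real (c * \<nu> div m) * (real (c * \<nu> div m) / real \<nu>)) \<longlonglongrightarrow> 1 * (real c / real m)"
    by (rule tendsto_mult[OF 1 2])
  moreover have "eventually (\<lambda>\<nu>. theta (c * \<nu> div m) / real (c * \<nu> div m) * (real (c * \<nu> div m) / real \<nu>) = theta (c * \<nu> div m) / real \<nu>) sequentially"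
    using filterlim_at_top[THEN iffD1, OF fl, rule_format, of 1]
    by eventually_elim auto
  ultimately show ?thesis by (auto intro: Lim_transform_eventually)
qed

lemma ln_mult3: "x > 0 \<Longrightarrow> y > 0 \<Longrightarrow> z > 0 \<Longrightarrow> ln (x * y * z) = ln x + ln y + ln (z::real)"
  by (simp add: ln_mult_pos)

context
  fixes q r :: nat
  assumes r: "r > 0" and rq: "2 * r \<le> q"
begin

lemma zudilin_formI: "\<nu> > 0 \<Longrightarrow> zudilin_form \<nu> q r"
  using r rq by unfold_locales auto

text \<open>The part \<open>20 * \<nu> * ln \<nu>\<close> grows faster than any rate and is split
  off. In all later bounds such parts cancel: factorials, powers of \<open>n\<close> in the
  numerator and powers of \<open>n\<close> in the denominator balance.\<close>

definition fact_rate20 :: "nat \<Rightarrow> real" where "fact_rate20 \<nu> = (ln (fact (20 * \<nu>)) - 20 * real \<nu> * ln (real \<nu>)) / real \<nu>"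
definition fact_rate18 :: "nat \<Rightarrow> real" where "fact_rate18 \<nu> = (ln (fact (18 * \<nu>)) - 18 * real \<nu> * ln (real \<nu>)) / real \<nu>"

lemma fact_rate20_lim: "fact_rate20 \<longlonglongrightarrow> 20 * ln 20 - 20" and fact_rate18_lim: "fact_rate18 \<longlonglongrightarrow> 18 * ln 18 - 18"
  using ln_fact_asymp[of 20] ln_fact_asymp[of 18] by (simp_all add: fact_rate20_def[abs_def] fact_rate18_def[abs_def])

lemma fact_rate20_eq: "\<nu> > 0 \<Longrightarrow> ln (fact (20 * \<nu>)) = real \<nu> * (fact_rate20 \<nu> + 20 * ln (real \<nu>))"
  and fact_rate18_eq: "\<nu> > 0 \<Longrightarrow> ln (fact (18 * \<nu>)) = real \<nu> * (fact_rate18 \<nu> + 18 * ln (real \<nu>))"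
  by (simp_all add: fact_rate20_def fact_rate18_def distrib_left)

text \<open>Each \<open>\<dots>_rate\<close> below is the exponential growth rate in \<open>\<nu>\<close>.\<close>
definition degree_rate :: real where "degree_rate = 38 * real q + 20"
definition denom_rate :: real where "denom_rate = 20 * (2 * real q + 1) - real q * (\<Sum>m\<in>{1..10::nat}. 1 / real m)"
definition amplitude_rate :: real where
  "amplitude_rate = (real q + 1 - 2 * real r) * (20 * ln 20 - 20) + real q * (18 * ln 18 - 18)"
definition lower_rate :: real where
  "lower_rate = amplitude_rate + 20 * real r * (2 * ln 20 + ln (real r)) - degree_rate * (ln 20 + ln (real r + 2))"
definition upper_rate :: real where
  "upper_rate = amplitude_rate + 20 * real r * ln 3 - (degree_rate - 40 * real r) * (ln 20 + ln (real r))"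
definition coeff_rate :: real where "coeff_rate = 40 * real r * (ln (real r + 2) + 1) + degree_rate * ln 2"

lemma ln_amplitude:
  assumes \<nu>: "\<nu> > 0"
  shows "ln (zudilin_form.amplitude \<nu> q r) = real \<nu> * ((real q + 1 - 2 * real r) * (fact_rate20 \<nu> + 20 * ln (real \<nu>)) + real q * (fact_rate18 \<nu> + 18 * ln (real \<nu>)))"
proof -
  interpret zudilin_form \<nu> q r by (rule zudilin_formI[OF \<nu>])
  have "ln amplitude = real (q + 1) * ln (fact (20 * \<nu>)) + real q * ln (fact (18 * \<nu>)) - real (2 * r) * ln (fact (20 * \<nu>))"
    unfolding amplitude_def n_def by (subst ln_divide_pos, simp, simp, subst ln_mult_pos, simp, simp, simp only: ln_realpow fact_gt_zero)
  thus ?thesis unfolding fact_rate20_eq[OF \<nu>] fact_rate18_eq[OF \<nu>] by (simp add: algebra_simps)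
qed

text \<open>The factorials contribute \<open>38 * q + 20 - 40 * r\<close> and the numerator
  \<open>40 * r\<close> to the coefficient of \<open>\<nu> * ln \<nu>\<close>; together this is
  \<open>degree_rate\<close>, which the denominator removes. What remains is linear in
  \<open>\<nu>\<close>.\<close>

lemma linear_form_lower_ev: "\<epsilon> > 0 \<Longrightarrow> eventually (\<lambda>\<nu>. exp ((lower_rate - \<epsilon>) * real \<nu>) \<le> zudilin_form.linear_form \<nu> q r) sequentially"
proof -
  assume \<epsilon>: "\<epsilon> > 0"
  \<comment> \<open>Exactly \<open>ln X / \<nu>\<close> for the lower bound \<open>X\<close> below;
    the last summand is the part of order \<open>ln \<nu> / \<nu>\<close>.\<close>
  define g where "g = (\<lambda>\<nu>. (real q + 1 - 2 * real r) * fact_rate20 \<nu> + real q * fact_rate18 \<nu> + 20 * real r * (2 * ln 20 + ln (real r))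
     - degree_rate * (ln 20 + ln (real r + 2)) - (2 * real q + 1) * (ln (20 * (real r + 2) * real \<nu>) / real \<nu>))"
  have "(\<lambda>\<nu>::nat. ln (20 * (real r + 2) * real \<nu>) / real \<nu>) \<longlonglongrightarrow> 0" by real_asymp
  hence "g \<longlonglongrightarrow> (real q + 1 - 2 * real r) * (20 * ln 20 - 20) + real q * (18 * ln 18 - 18) + 20 * real r * (2 * ln 20 + ln (real r))
     - degree_rate * (ln 20 + ln (real r + 2)) - (2 * real q + 1) * 0"
    unfolding g_def by (intro tendsto_intros fact_rate20_lim fact_rate18_lim)
  hence "g \<longlonglongrightarrow> lower_rate" by (simp add: lower_rate_def amplitude_rate_def)
  hence "eventually (\<lambda>\<nu>. g \<nu> > lower_rate - \<epsilon>) sequentially" using \<epsilon> by (intro order_tendstoD) auto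
  thus ?thesis using eventually_gt_at_top[of 0]
  proof eventually_elim
    case (elim \<nu>)
    hence \<nu>: "\<nu> > 0" by simp
    interpret zudilin_form \<nu> q r by (rule zudilin_formI[OF \<nu>])
    define X where "X = amplitude * (real n ^ (r * n) * real (r * n) ^ (r * n)) / real ((r + 2) * n) ^ decay_exponent"
    have nn: "real n > 0" "real (r * n) > 0" "real ((r + 2) * n) > 0" unfolding of_nat_0_less_iff using n_pos r by simp_all
    have X0: "X > 0" unfolding X_def using amplitude_pos nn by (intro divide_pos_pos mult_pos_pos zero_less_power) auto
    have lnn: "ln (real n) = ln 20 + ln (real \<nu>)" "ln (real (r * n)) = ln (real r) + ln 20 + ln (real \<nu>)"
      "ln (real ((r + 2) * n)) = ln (real r + 2) + ln 20 + ln (real \<nu>)"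
      "ln (20 * (real r + 2) * real \<nu>) = ln (real r + 2) + ln 20 + ln (real \<nu>)"
      using \<nu> r ln_mult3[of 20 "real r + 2" "real \<nu>"] by (simp_all add: n_def ln_mult_pos algebra_simps)
    have "ln X = ln amplitude + (real (r * n) * ln (real n) + real (r * n) * ln (real (r * n))) - real decay_exponent * ln (real ((r + 2) * n))"
    proof -
      have "ln X = ln (amplitude * (real n ^ (r * n) * real (r * n) ^ (r * n))) - ln (real ((r + 2) * n) ^ decay_exponent)"
        unfolding X_def by (rule ln_divide_pos) (use amplitude_pos nn in \<open>auto intro!: mult_pos_pos\<close>)
      also have "ln (amplitude * (real n ^ (r * n) * real (r * n) ^ (r * n))) = ln amplitude + ln (real n ^ (r * n) * real (r * n) ^ (r * n))"
        by (rule ln_mult_pos) (use amplitude_pos nn in \<open>auto intro!: mult_pos_pos\<close>)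
      also have "ln (real n ^ (r * n) * real (r * n) ^ (r * n)) = ln (real n ^ (r * n)) + ln (real (r * n) ^ (r * n))"
        by (rule ln_mult_pos) (use nn in auto)
      finally show ?thesis using nn by (simp only: ln_realpow)
    qed
    also have "\<dots> = real \<nu> * g \<nu>"
    proof -
      have Exr: "real decay_exponent = real \<nu> * degree_rate + (2 * real q + 1)" unfolding decay_exponent_eq degree_rate_def by (simp add: algebra_simps)
      have rn: "real (r * n) = real \<nu> * (20 * real r)" by (simp add: n_def)
      have "real \<nu> * ((2 * real q + 1) * (ln (20 * (real r + 2) * real \<nu>) / real \<nu>)) = (2 * real q + 1) * (ln (real r + 2) + ln 20 + ln (real \<nu>))"
        using \<nu> unfolding lnn(4) by simp
      moreover have "real \<nu> * g \<nu> = real \<nu> * ((real q + 1 - 2 * real r) * fact_rate20 \<nu> + real q * fact_rate18 \<nu> + 20 * real r * (2 * ln 20 + ln (real r))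
         - degree_rate * (ln 20 + ln (real r + 2))) - real \<nu> * ((2 * real q + 1) * (ln (20 * (real r + 2) * real \<nu>) / real \<nu>))"
        unfolding g_def by (rule right_diff_distrib)
      ultimately show ?thesis unfolding ln_amplitude[OF \<nu>] Exr lnn(1,2,3) unfolding rn degree_rate_def by (simp add: algebra_simps)
    qed
    finally have "ln X = real \<nu> * g \<nu>" .
    moreover have "real \<nu> * (lower_rate - \<epsilon>) \<le> real \<nu> * g \<nu>" using elim by (intro mult_left_mono) auto
    ultimately have "(lower_rate - \<epsilon>) * real \<nu> \<le> ln X" by (simp add: mult.commute)
    hence "exp ((lower_rate - \<epsilon>) * real \<nu>) \<le> exp (ln X)" by simp
    hence "exp ((lower_rate - \<epsilon>) * real \<nu>) \<le> X" using X0 by simp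
    also have "X \<le> linear_form" unfolding X_def by (rule linear_form_lower)
    finally show ?case .
  qed
qed

lemma zeta_2_pos: "zeta 2 > 0"
  unfolding zeta_def by (intro suminf_pos summable_zeta) auto

lemma linear_form_upper_ev: "\<epsilon> > 0 \<Longrightarrow> eventually (\<lambda>\<nu>. zudilin_form.linear_form \<nu> q r \<le> exp ((upper_rate + \<epsilon>) * real \<nu>)) sequentially"
proof -
  assume \<epsilon>: "\<epsilon> > 0"
  define g where "g = (\<lambda>\<nu>. (real q + 1 - 2 * real r) * fact_rate20 \<nu> + real q * fact_rate18 \<nu> + 20 * real r * ln 3
     - (degree_rate - 40 * real r) * (ln 20 + ln (real r)) - (2 * real q - 1) * (ln (20 * real r * real \<nu>) / real \<nu>) + ln (zeta 2) / real \<nu>)"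
  have "(\<lambda>\<nu>::nat. ln (20 * real r * real \<nu>) / real \<nu>) \<longlonglongrightarrow> 0" using r by real_asymp
  moreover have "(\<lambda>\<nu>::nat. ln (zeta 2) / real \<nu>) \<longlonglongrightarrow> 0" by real_asymp
  ultimately have "g \<longlonglongrightarrow> (real q + 1 - 2 * real r) * (20 * ln 20 - 20) + real q * (18 * ln 18 - 18) + 20 * real r * ln 3
     - (degree_rate - 40 * real r) * (ln 20 + ln (real r)) - (2 * real q - 1) * 0 + 0"
    unfolding g_def by (intro tendsto_intros fact_rate20_lim fact_rate18_lim)
  hence "g \<longlonglongrightarrow> upper_rate" by (simp add: upper_rate_def amplitude_rate_def)
  hence "eventually (\<lambda>\<nu>. g \<nu> < upper_rate + \<epsilon>) sequentially" using \<epsilon> by (intro order_tendstoD) auto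
  thus ?thesis using eventually_gt_at_top[of 0]
  proof eventually_elim
    case (elim \<nu>)
    hence \<nu>: "\<nu> > 0" by simp
    interpret zudilin_form \<nu> q r by (rule zudilin_formI[OF \<nu>])
    define M where "M = decay_exponent - 2 * (r * n) - 2"
    define X where "X = amplitude * 3 ^ (r * n) / real (r * n) ^ M * zeta 2"
    have nn: "real (r * n) > 0" using n_pos r by simp
    have X0: "X > 0" unfolding X_def using amplitude_pos nn zeta_2_pos by (intro divide_pos_pos mult_pos_pos zero_less_power) auto
    have lnn: "ln (real (r * n)) = ln (real r) + ln 20 + ln (real \<nu>)"
      "ln (20 * real r * real \<nu>) = ln (real r) + ln 20 + ln (real \<nu>)"
      using \<nu> r by (simp_all add: n_def ln_mult_pos)
    have "ln X = ln amplitude + real (r * n) * ln 3 - real M * ln (real (r * n)) + ln (zeta 2)"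
    proof -
      have "ln X = ln (amplitude * 3 ^ (r * n) / real (r * n) ^ M) + ln (zeta 2)"
        unfolding X_def by (rule ln_mult_pos) (use amplitude_pos nn zeta_2_pos in auto)
      also have "ln (amplitude * 3 ^ (r * n) / real (r * n) ^ M) = ln (amplitude * 3 ^ (r * n)) - ln (real (r * n) ^ M)"
        by (rule ln_divide_pos) (use amplitude_pos nn in auto)
      also have "ln (amplitude * 3 ^ (r * n)) = ln amplitude + ln (3 ^ (r * n))"
        by (rule ln_mult_pos) (use amplitude_pos in auto)
      finally show ?thesis using nn by (simp only: ln_realpow)
    qed
    also have "\<dots> = real \<nu> * g \<nu>"
    proof -
      have "real M = real decay_exponent - 2 * real (r * n) - 2" unfolding M_def using decay_exponent_ge by (simp add: of_nat_diff)
      hence Mr: "real M = real \<nu> * (degree_rate - 40 * real r) + (2 * real q - 1)" unfolding decay_exponent_eq degree_rate_def n_def by (simp add: algebra_simps)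
      have rn: "real (r * n) = real \<nu> * (20 * real r)" by (simp add: n_def)
      have 1: "real \<nu> * ((2 * real q - 1) * (ln (20 * real r * real \<nu>) / real \<nu>)) = (2 * real q - 1) * (ln (real r) + ln 20 + ln (real \<nu>))"
        using \<nu> unfolding lnn(2) by simp
      have 2: "real \<nu> * (ln (zeta 2) / real \<nu>) = ln (zeta 2)" using \<nu> by simp
      have "real \<nu> * g \<nu> = real \<nu> * ((real q + 1 - 2 * real r) * fact_rate20 \<nu> + real q * fact_rate18 \<nu> + 20 * real r * ln 3
         - (degree_rate - 40 * real r) * (ln 20 + ln (real r))) - real \<nu> * ((2 * real q - 1) * (ln (20 * real r * real \<nu>) / real \<nu>)) + real \<nu> * (ln (zeta 2) / real \<nu>)"
        unfolding g_def distrib_left right_diff_distrib by (simp only:)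
      thus ?thesis unfolding 1 2 unfolding ln_amplitude[OF \<nu>] Mr lnn(1) unfolding rn degree_rate_def by (simp add: algebra_simps)
    qed
    finally have lX: "ln X = real \<nu> * g \<nu>" .
    have "real \<nu> * g \<nu> \<le> real \<nu> * (upper_rate + \<epsilon>)" using elim by (intro mult_left_mono) auto
    hence "ln X \<le> (upper_rate + \<epsilon>) * real \<nu>" using lX by (simp add: mult.commute)
    hence "exp (ln X) \<le> exp ((upper_rate + \<epsilon>) * real \<nu>)" by simp
    hence "X \<le> exp ((upper_rate + \<epsilon>) * real \<nu>)" using X0 by simp
    moreover have "linear_form \<le> X" unfolding X_def M_def by (rule linear_form_upper)
    ultimately show ?case by linarith
  qed
qed

text \<open>The powers of 2 from the blocks have exponent \<open>\<nu> * degree_rate\<close>. The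
  \<open>2 * r\<close> numerator runs each have rate \<open>20 * (ln (r + 2) + 1)\<close>, and all
  other factors are polynomial in \<open>\<nu>\<close>.\<close>

lemma coeff_bound_ev: "eventually (\<lambda>\<nu>. zudilin_form.coeff_bound \<nu> q r \<le> exp ((coeff_rate + 1) * real \<nu>)) sequentially"
proof -
  define A where "A = 2 * q + 1"
  define g where "g = (\<lambda>\<nu>. 2 * real r * (20 * (ln 20 + ln (real r + 2)) - fact_rate20 \<nu>) + degree_rate * ln 2
     + real A * (ln (4 * (20 * real \<nu> + 1) ^ 2) / real \<nu>) + 2 * (ln (20 * real \<nu> + 1) / real \<nu>)
     + (ln (real A) + real A * ln 2) / real \<nu>)"
  have "(\<lambda>\<nu>::nat. ln (4 * (20 * real \<nu> + 1) ^ 2) / real \<nu>) \<longlonglongrightarrow> 0" by real_asymp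
  moreover have "(\<lambda>\<nu>::nat. ln (20 * real \<nu> + 1) / real \<nu>) \<longlonglongrightarrow> 0" by real_asymp
  moreover have "(\<lambda>\<nu>::nat. (ln (real A) + real A * ln 2) / real \<nu>) \<longlonglongrightarrow> 0" by real_asymp
  ultimately have "g \<longlonglongrightarrow> 2 * real r * (20 * (ln 20 + ln (real r + 2)) - (20 * ln 20 - 20)) + degree_rate * ln 2 + real A * 0 + 2 * 0 + 0"
    unfolding g_def by (intro tendsto_intros fact_rate20_lim)
  hence "g \<longlonglongrightarrow> coeff_rate" by (simp add: coeff_rate_def algebra_simps)
  hence "eventually (\<lambda>\<nu>. g \<nu> < coeff_rate + 1) sequentially" by (intro order_tendstoD) auto
  thus ?thesis using eventually_gt_at_top[of 0]
  proof eventually_elim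
    case (elim \<nu>)
    hence \<nu>: "\<nu> > 0" by simp
    interpret zudilin_form \<nu> q r by (rule zudilin_formI[OF \<nu>])
    have a_A: "a = A" by (simp add: a_def A_def)
    define F where "F = real ((r + 2) * n) ^ n / fact n"
    define Y where "Y = 4 * real (n + 1) ^ 2"
    have rn0: "real ((r + 2) * n) > 0" unfolding of_nat_0_less_iff using n_pos by simp
    hence F0: "F > 0" unfolding F_def by (intro divide_pos_pos zero_less_power) auto
    have Y0: "Y > 0" by (simp add: Y_def)
    have G_bound: "G_bound = F ^ (2 * r) * Y ^ A * 2 ^ (n * (q + 1) + 18 * \<nu> * q)"
    proof -
      have "(F * F) ^ r = F ^ (2 * r)" by (simp add: power_mult power2_eq_square)
      moreover have "Y ^ A = Y ^ (q + 1) * Y ^ q" unfolding A_def by (simp flip: power_add mult_2)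
      moreover have "(2::real) ^ (n * (q + 1) + 18 * \<nu> * q) = (2 ^ n) ^ (q + 1) * (2 ^ (18 * \<nu>)) ^ q"
        by (simp only: power_add power_mult)
      ultimately show ?thesis unfolding G_bound_def F_def[symmetric] Y_def[symmetric] power_mult_distrib by (simp only: mult_ac)
    qed
    have CBe: "coeff_bound = real (n + 1) ^ 2 * (real A * 2 ^ A) * (F ^ (2 * r) * Y ^ A * 2 ^ (n * (q + 1) + 18 * \<nu> * q))"
      unfolding coeff_bound_def G_bound a_A by (simp add: power2_eq_square mult_ac)
    have A0: "real A > 0" by (simp add: A_def)
    have C0: "coeff_bound > 0" unfolding CBe using F0 Y0 A0 by (intro mult_pos_pos zero_less_power) auto
    have "ln coeff_bound = 2 * ln (real (n + 1)) + (ln (real A) + real A * ln 2) + (real (2 * r) * ln F + real A * ln Y + real (n * (q + 1) + 18 * \<nu> * q) * ln 2)"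
    proof -
      have "ln coeff_bound = ln (real (n + 1) ^ 2 * (real A * 2 ^ A)) + ln (F ^ (2 * r) * Y ^ A * 2 ^ (n * (q + 1) + 18 * \<nu> * q))"
        unfolding CBe by (rule ln_mult_pos) (use F0 Y0 A0 in auto)
      also have "ln (real (n + 1) ^ 2 * (real A * 2 ^ A)) = ln (real (n + 1) ^ 2) + ln (real A * 2 ^ A)"
        by (rule ln_mult_pos) (use A0 in auto)
      also have "ln (real A * 2 ^ A) = ln (real A) + ln (2 ^ A)" by (rule ln_mult_pos) (use A0 in auto)
      also have "ln (F ^ (2 * r) * Y ^ A * 2 ^ (n * (q + 1) + 18 * \<nu> * q)) = ln (F ^ (2 * r) * Y ^ A) + ln (2 ^ (n * (q + 1) + 18 * \<nu> * q))"
        by (rule ln_mult_pos) (use F0 Y0 in auto)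
      also have "ln (F ^ (2 * r) * Y ^ A) = ln (F ^ (2 * r)) + ln (Y ^ A)" by (rule ln_mult_pos) (use F0 Y0 in auto)
      finally show ?thesis using F0 Y0 by (simp add: ln_realpow del: of_nat_add of_nat_Suc)
    qed
    also have "\<dots> = real \<nu> * g \<nu>"
    proof -
      have lF: "ln F = real \<nu> * (20 * (ln 20 + ln (real r + 2)) - fact_rate20 \<nu>)"
      proof -
        have "ln F = ln (real ((r + 2) * n) ^ n) - ln (fact n)"
          unfolding F_def by (rule ln_divide_pos[OF zero_less_power[OF rn0]]) auto
        also have "ln (real ((r + 2) * n) ^ n) = real n * ln (real ((r + 2) * n))"
          by (rule ln_realpow)
        also have "ln (real ((r + 2) * n)) = ln (real r + 2) + ln 20 + ln (real \<nu>)"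
          using \<nu> ln_mult3[of 20 "real r + 2" "real \<nu>"] by (simp add: n_def algebra_simps)
        also have "ln (fact n) = real \<nu> * (fact_rate20 \<nu> + 20 * ln (real \<nu>))" unfolding n_def by (rule fact_rate20_eq[OF \<nu>])
        finally show ?thesis by (simp add: n_def algebra_simps)
      qed
      have lY: "ln Y = real \<nu> * (ln (4 * (20 * real \<nu> + 1) ^ 2) / real \<nu>)" using \<nu> by (simp add: Y_def n_def add.commute)
      have l1: "ln (real (n + 1)) = real \<nu> * (ln (20 * real \<nu> + 1) / real \<nu>)" using \<nu> by (simp add: n_def add.commute)
      have l2: "ln (real A) + real A * ln 2 = real \<nu> * ((ln (real A) + real A * ln 2) / real \<nu>)" using \<nu> by simp
      have l3: "real (n * (q + 1) + 18 * \<nu> * q) = real \<nu> * degree_rate" by (simp add: n_def degree_rate_def algebra_simps)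
      show ?thesis unfolding lF lY l1 l3 g_def by (subst l2) (simp add: algebra_simps)
    qed
    finally have lX: "ln coeff_bound = real \<nu> * g \<nu>" .
    have "real \<nu> * g \<nu> \<le> real \<nu> * (coeff_rate + 1)" using elim by (intro mult_left_mono) auto
    hence "ln coeff_bound \<le> (coeff_rate + 1) * real \<nu>" using lX by (simp add: mult.commute)
    hence "exp (ln coeff_bound) \<le> exp ((coeff_rate + 1) * real \<nu>)" by simp
    thus ?case using C0 by simp
  qed
qed

text \<open>By the prime number theorem the special primes with multiplier \<open>m\<close> have
  rate \<open>20 / m - 19 / m = 1 / m\<close>, which produces the harmonic sum in
  \<open>denom_rate\<close>.\<close>

lemma denom_ev: "eventually (\<lambda>\<nu>. real (zudilin_form.denom \<nu> q) \<le> exp ((denom_rate + 1) * real \<nu>)) sequentially"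
proof -
  define A where "A = 2 * q + 1"
  define g where "g = (\<lambda>\<nu>. real A * (theta (20 * \<nu>) / real \<nu> + sqrt (20 * real \<nu>) * ln (20 * real \<nu>) / real \<nu>) -
    real q * (\<Sum>m\<in>{1..10}. theta (20 * \<nu> div m) / real \<nu> - theta (19 * \<nu> div m) / real \<nu>))"
  have "(\<lambda>\<nu>::nat. sqrt (20 * real \<nu>) * ln (20 * real \<nu>) / real \<nu>) \<longlonglongrightarrow> 0" by real_asymp
  moreover have "(\<lambda>\<nu>. theta (20 * \<nu>) / real \<nu>) \<longlonglongrightarrow> 20" using theta_div_asymp[of 1 20] by simp
  ultimately have "g \<longlonglongrightarrow> real A * (20 + 0) - real q * (\<Sum>m\<in>{1..10}. real 20 / real m - real 19 / real m)"
    unfolding g_def by (intro tendsto_intros theta_div_asymp) auto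
  also have "real A * (20 + 0) - real q * (\<Sum>m\<in>{1..10}. real 20 / real m - real 19 / real m) = denom_rate"
    unfolding denom_rate_def A_def by (simp add: diff_divide_distrib[symmetric])
  finally have "eventually (\<lambda>\<nu>. g \<nu> < denom_rate + 1) sequentially" by (intro order_tendstoD) auto
  thus ?thesis using eventually_gt_at_top[of 0]
  proof eventually_elim
    case (elim \<nu>)
    hence \<nu>: "\<nu> > 0" by simp
    interpret zudilin_form \<nu> q r by (rule zudilin_formI[OF \<nu>])
    have "ln (real denom) \<le> real a * (theta n + sqrt (real n) * ln (real n)) -
      real q * (\<Sum>m\<in>{1..10}. theta (20 * \<nu> div m) - theta (19 * \<nu> div m))" by (rule ln_denom)
    also have "\<dots> = real \<nu> * g \<nu>"
    proof -
      have "real \<nu> * (\<Sum>m\<in>{1..10}. theta (20 * \<nu> div m) / real \<nu> - theta (19 * \<nu> div m) / real \<nu>) =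
        (\<Sum>m\<in>{1..10}. theta (20 * \<nu> div m) - theta (19 * \<nu> div m))"
        unfolding sum_distrib_left by (intro sum.cong refl) (use \<nu> in \<open>simp add: right_diff_distrib\<close>)
      moreover have "real \<nu> * (theta (20 * \<nu>) / real \<nu> + sqrt (20 * real \<nu>) * ln (20 * real \<nu>) / real \<nu>) = theta n + sqrt (real n) * ln (real n)"
        using \<nu> by (simp add: n_def distrib_left)
      moreover have "real \<nu> * (real A * x - real q * y) = real A * (real \<nu> * x) - real q * (real \<nu> * y)" for x y
        by (simp add: algebra_simps)
      ultimately show ?thesis unfolding g_def a_def A_def by (simp only:)
    qed
    also have "\<dots> \<le> real \<nu> * (denom_rate + 1)" using elim by (intro mult_left_mono) auto
    finally have "ln (real denom) \<le> (denom_rate + 1) * real \<nu>" by (simp add: mult.commute)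
    hence "exp (ln (real denom)) \<le> exp ((denom_rate + 1) * real \<nu>)" by simp
    thus ?case using denom_pos by simp
  qed
qed

end

section \<open>Integer forms, choice of r and the final estimate\<close>

lemma half_floor: assumes "(x::real) \<ge> 1" shows "x / 2 \<le> of_int \<lfloor>x\<rfloor>"
proof -
  have "\<lfloor>x\<rfloor> \<ge> 1" using assms by simp
  hence "real_of_int \<lfloor>x\<rfloor> \<ge> 1" by linarith
  thus ?thesis using real_of_int_floor_add_one_gt[of x] by linarith
qed

text \<open>The sum is 7381/2520, about 2.92897. The bound 366/125 = 2.928 yields the coefficient
  4634/125 = 37.072 of \<open>q\<close> in the upper bound for \<open>denom_rate\<close>.\<close>

lemma harmonic_10: "(\<Sum>m\<in>{1..10::nat}. 1 / real m) \<ge> 366 / 125" "(\<Sum>m\<in>{1..10::nat}. 1 / real m) \<le> 3"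
  by (simp_all add: numeral_eq_Suc)

context
  fixes q r :: nat
  assumes r: "r > 0" and rq: "2 * r \<le> q"
begin

text \<open>The index \<open>0\<close> stands for the constant \<open>1\<close>.\<close>
definition form_indices :: "nat set" where "form_indices = insert 0 {i. odd i \<and> 3 \<le> i \<and> i \<le> 2 * q + 1}"

lemma finite_form_indices: "finite form_indices"
  unfolding form_indices_def by (rule finite.insertI, rule finite_subset[of _ "{..2 * q + 1}"]) auto

text \<open>The criterion needs a lower bound for the integer forms, but \<open>denom\<close> is
  bounded only from above. Multiplying by a further integer \<open>D\<close> brings
  \<open>D * denom\<close> between \<open>W / 2\<close> and \<open>W\<close>, so the scaling has a
  known rate from both sides.\<close>

lemma integer_forms_ev:
  "eventually (\<lambda>\<nu>. \<exists>l :: nat \<Rightarrow> int.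
     (\<forall>j\<in>form_indices. real_of_int \<bar>l j\<bar> \<le> exp ((denom_rate q + coeff_rate q r + 2) * real \<nu>)) \<and>
     exp (- (- (denom_rate q + lower_rate q r)) * real \<nu>) \<le> \<bar>\<Sum>j\<in>form_indices. of_int (l j) * (if j = 0 then 1 else zeta j)\<bar> \<and>
     \<bar>\<Sum>j\<in>form_indices. of_int (l j) * (if j = 0 then 1 else zeta j)\<bar> \<le> exp (- (- (denom_rate q + upper_rate q r + 2)) * real \<nu>)) sequentially"
proof -
  \<comment> \<open>The rate of \<open>W\<close> carries an extra 1. Giving up 1/2 in the lower
    bound leaves \<open>exp (\<nu> / 2)\<close>, at least 2 for \<open>\<nu> \<ge> 2\<close>, to
    absorb the factor in \<open>W / 2\<close>.\<close>
  have half: "(1/2::real) > 0" by simp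
  show ?thesis using linear_form_lower_ev[OF r rq half] linear_form_upper_ev[OF r rq zero_less_one] coeff_bound_ev[OF r rq] denom_ev[OF r rq] eventually_ge_at_top[of 2]
  proof eventually_elim
    case (elim \<nu>)
    interpret zudilin_form \<nu> q r using elim r rq by unfold_locales auto
    define W where "W = exp ((denom_rate q + 1) * real \<nu>)"
    define D where "D = nat \<lfloor>W / real denom\<rfloor>"
    have DD0: "real denom > 0" using denom_pos by simp
    have W1: "W / real denom \<ge> 1" using elim(4) DD0 unfolding W_def by simp
    hence Dr: "real D = of_int \<lfloor>W / real denom\<rfloor>" unfolding D_def by simp
    have "real D \<le> W / real denom" "W / real denom / 2 \<le> real D" unfolding Dr using half_floor[OF W1] by simp_all
    hence D: "real D * real denom \<le> W" "W / 2 \<le> real D * real denom" using DD0 by (simp_all add: field_simps)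
    obtain z0 where z0: "real denom * rho0 = of_int z0" by (rule int_rho0)
    have "\<forall>i\<in>odds. \<exists>z. real denom * rho i = of_int z" using int_rho by metis
    then obtain z where z: "real denom * rho i = of_int (z i)" if "i \<in> odds" for i by metis
    define l where "l = (\<lambda>j. int D * (if j = 0 then z0 else z j))"
    have form_indices: "form_indices = insert 0 odds" by (simp add: form_indices_def odds_def a_def)
    have odds: "0 \<notin> odds" "finite odds" using finite_form_indices unfolding form_indices by (auto simp: odds_def)
    have l0: "of_int (l 0) = real D * real denom * rho0" by (simp add: l_def flip: z0)
    have li: "of_int (l j) = real D * real denom * rho j" if "j \<in> odds" for j
      using that odds(1) by (auto simp: l_def simp flip: z)
    have "(\<Sum>j\<in>form_indices. of_int (l j) * (if j = 0 then 1 else zeta j)) =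
        of_int (l 0) + (\<Sum>j\<in>odds. of_int (l j) * (if j = 0 then 1 else zeta j))"
      unfolding form_indices using odds by simp
    also have "(\<Sum>j\<in>odds. of_int (l j) * (if j = 0 then 1 else zeta j)) = (\<Sum>j\<in>odds. real D * real denom * (rho j * zeta j))"
      by (intro sum.cong refl) (use odds(1) li in \<open>auto simp: mult.assoc\<close>)
    also have "of_int (l 0) + \<dots> = real D * real denom * linear_form"
      unfolding l0 linear_form_def by (simp only: sum_distrib_left distrib_left)
    finally have S: "(\<Sum>j\<in>form_indices. of_int (l j) * (if j = 0 then 1 else zeta j)) = real D * real denom * linear_form" .
    have LF0: "linear_form > 0" using elim(1) by (rule less_le_trans[OF exp_gt_zero])
    have B: "real_of_int \<bar>l j\<bar> \<le> exp ((denom_rate q + coeff_rate q r + 2) * real \<nu>)" if "j \<in> form_indices" for j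
    proof -
      obtain y where y: "of_int (l j) = real D * real denom * y" "\<bar>y\<bar> \<le> coeff_bound"
      proof (cases "j = 0")
        case True
        show ?thesis by (rule that[OF _ rho0_bound]) (simp only: True l0)
      next
        case False
        hence "j \<in> odds" using \<open>j \<in> form_indices\<close> unfolding form_indices by simp
        thus ?thesis using li rho_bound by (intro that)
      qed
      have "real_of_int \<bar>l j\<bar> = real D * real denom * \<bar>y\<bar>" using y(1) by (simp add: abs_mult)
      also have "\<dots> \<le> W * coeff_bound" using D(1) y(2) by (intro mult_mono) (auto simp: W_def)
      also have "\<dots> \<le> W * exp ((coeff_rate q r + 1) * real \<nu>)" using elim(3) by (intro mult_left_mono) (auto simp: W_def)
      also have "\<dots> = exp ((denom_rate q + coeff_rate q r + 2) * real \<nu>)" by (simp add: W_def algebra_simps flip: exp_add)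
      finally show ?thesis .
    qed
    have "exp (- (- (denom_rate q + lower_rate q r)) * real \<nu>) \<le> real D * real denom * linear_form"
    proof -
      have "2 \<le> exp (1/2 * real \<nu>)" using exp_ge_add_one_self[of "1/2 * real \<nu>"] elim(5) by linarith
      hence "exp ((denom_rate q + lower_rate q r) * real \<nu>) * 2 \<le> exp ((denom_rate q + lower_rate q r) * real \<nu>) * exp (1/2 * real \<nu>)"
        by (intro mult_left_mono) auto
      also have "\<dots> = W * exp ((lower_rate q r - 1/2) * real \<nu>)" by (simp add: W_def algebra_simps flip: exp_add)
      finally have "exp ((denom_rate q + lower_rate q r) * real \<nu>) \<le> W / 2 * exp ((lower_rate q r - 1/2) * real \<nu>)" by simp
      also have "\<dots> \<le> real D * real denom * linear_form" using D(2) elim(1) by (intro mult_mono) auto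
      finally show ?thesis by (simp only: minus_minus)
    qed
    moreover have "real D * real denom * linear_form \<le> exp (- (- (denom_rate q + upper_rate q r + 2)) * real \<nu>)"
    proof -
      have "real D * real denom * linear_form \<le> W * exp ((upper_rate q r + 1) * real \<nu>)"
        using D(1) elim(2) LF0 by (intro mult_mono) (auto simp: W_def)
      also have "\<dots> = exp (- (- (denom_rate q + upper_rate q r + 2)) * real \<nu>)" by (simp add: W_def algebra_simps flip: exp_add)
      finally show ?thesis .
    qed
    moreover have "real D * real denom * linear_form \<ge> 0" using LF0 by simp
    ultimately show ?case using B S by (intro exI[of _ l] conjI ballI) (simp_all only: abs_of_nonneg)
  qed
qed

lemma denom_rate_bounds: "denom_rate q \<ge> 37 * real q" "denom_rate q \<le> 4634 / 125 * real q + 20"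
proof -
  define H where "H = (\<Sum>m\<in>{1..10::nat}. 1 / real m)"
  have denom_rate: "denom_rate q = 40 * real q + 20 - real q * H" unfolding denom_rate_def[OF r rq] H_def by simp
  have "real q * (366 / 125) \<le> real q * H" "real q * H \<le> real q * 3"
    unfolding H_def by (rule mult_left_mono[OF harmonic_10(1)], simp, rule mult_left_mono[OF harmonic_10(2)], simp)
  thus "denom_rate q \<ge> 37 * real q" "denom_rate q \<le> 4634 / 125 * real q + 20" unfolding denom_rate by linarith+
qed

text \<open>That the rates of the two bounds are in the right order is not computed but read off
  from the forms, which satisfy both bounds at once. The second claim supplies the sign of the
  factor that multiplies \<open>N - 1\<close>.\<close>

lemma dim_lower:
  assumes \<tau>: "denom_rate q + upper_rate q r + 2 < 0"
  defines "N \<equiv> real (rat_vec.dim (insert 1 {zeta i | i. odd i \<and> 3 \<le> i \<and> i \<le> 2 * q + 1}))"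
  shows "- (denom_rate q + upper_rate q r + 2) \<le> (N - 1) * (coeff_rate q r + upper_rate q r - lower_rate q r + denom_rate q + 4)"
    and "coeff_rate q r + upper_rate q r - lower_rate q r + denom_rate q + 4 \<ge> 0"
proof -
  define \<xi> where "\<xi> = (\<lambda>j::nat. if j = 0 then 1 else zeta j)"
  define P where "P = (\<lambda>\<nu> (l :: nat \<Rightarrow> int). (\<forall>j\<in>form_indices. real_of_int \<bar>l j\<bar> \<le> exp ((denom_rate q + coeff_rate q r + 2) * real \<nu>)) \<and>
     exp (- (- (denom_rate q + lower_rate q r)) * real \<nu>) \<le> \<bar>\<Sum>j\<in>form_indices. of_int (l j) * \<xi> j\<bar> \<and>
     \<bar>\<Sum>j\<in>form_indices. of_int (l j) * \<xi> j\<bar> \<le> exp (- (- (denom_rate q + upper_rate q r + 2)) * real \<nu>))"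
  have ex: "eventually (\<lambda>\<nu>. \<exists>l. P \<nu> l) sequentially" unfolding P_def \<xi>_def by (rule integer_forms_ev)
  define l where "l = (\<lambda>\<nu>. SOME l. P \<nu> l)"
  have ev: "eventually (\<lambda>\<nu>. P \<nu> (l \<nu>)) sequentially"
    unfolding l_def using ex by (rule eventually_mono) (rule someI_ex[of "P _"])
  have P_le: "exp (- (- (denom_rate q + lower_rate q r)) * real \<nu>) \<le> exp (- (- (denom_rate q + upper_rate q r + 2)) * real \<nu>)" if "P \<nu> l" for \<nu> l
    using that unfolding P_def by (elim conjE) (rule order_trans)
  have "eventually (\<lambda>\<nu>. denom_rate q + lower_rate q r \<le> denom_rate q + upper_rate q r + 2) sequentially"
    using ev eventually_gt_at_top[of 0]
  proof eventually_elim
    case (elim \<nu>)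
    have "exp (- (- (denom_rate q + lower_rate q r)) * real \<nu>) \<le> exp (- (- (denom_rate q + upper_rate q r + 2)) * real \<nu>)"
      by (rule P_le[OF elim(1)])
    thus ?case using elim(2) by simp
  qed
  hence le: "denom_rate q + lower_rate q r \<le> denom_rate q + upper_rate q r + 2" by simp
  have "denom_rate q \<ge> 0" using denom_rate_bounds(1) by (rule order_trans[rotated]) simp
  moreover have "coeff_rate q r \<ge> 0" unfolding coeff_rate_def[OF r rq] degree_rate_def[OF r rq]
    by (intro add_nonneg_nonneg mult_nonneg_nonneg) auto
  ultimately have B: "denom_rate q + coeff_rate q r + 2 \<ge> 0" by simp
  have img: "\<xi> ` form_indices = insert 1 {zeta i | i. odd i \<and> 3 \<le> i \<and> i \<le> 2 * q + 1}"
  proof -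
    have "\<xi> ` {i. odd i \<and> 3 \<le> i \<and> i \<le> 2 * q + 1} = zeta ` {i. odd i \<and> 3 \<le> i \<and> i \<le> 2 * q + 1}"
      by (rule image_cong) (auto simp: \<xi>_def)
    also have "\<dots> = {zeta i | i. odd i \<and> 3 \<le> i \<and> i \<le> 2 * q + 1}" by (rule image_Collect)
    finally have "\<xi> ` {i. odd i \<and> 3 \<le> i \<and> i \<le> 2 * q + 1} = {zeta i | i. odd i \<and> 3 \<le> i \<and> i \<le> 2 * q + 1}" .
    moreover have "\<xi> 0 = 1" by (simp add: \<xi>_def)
    ultimately show ?thesis unfolding form_indices_def image_insert by (simp only:)
  qed
  have "- (denom_rate q + upper_rate q r + 2) \<le> (real (rat_vec.dim (\<xi> ` form_indices)) - 1) *
     (denom_rate q + coeff_rate q r + 2 + - (denom_rate q + lower_rate q r) - - (denom_rate q + upper_rate q r + 2))"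
  proof (rule linear_independence_criterion[OF finite_form_indices, of 0])
    show "0 \<in> form_indices" by (simp add: form_indices_def)
    show "\<xi> 0 = 1" by (simp add: \<xi>_def)
    show "eventually (\<lambda>\<nu>. (\<forall>j\<in>form_indices. real_of_int \<bar>l \<nu> j\<bar> \<le> exp ((denom_rate q + coeff_rate q r + 2) * real \<nu>)) \<and>
     exp (- (- (denom_rate q + lower_rate q r)) * real \<nu>) \<le> \<bar>\<Sum>j\<in>form_indices. of_int (l \<nu> j) * \<xi> j\<bar> \<and>
     \<bar>\<Sum>j\<in>form_indices. of_int (l \<nu> j) * \<xi> j\<bar> \<le> exp (- (- (denom_rate q + upper_rate q r + 2)) * real \<nu>)) sequentially"
      using ev unfolding P_def .
  qed (use B le \<tau> in auto)
  thus "- (denom_rate q + upper_rate q r + 2) \<le> (N - 1) * (coeff_rate q r + upper_rate q r - lower_rate q r + denom_rate q + 4)"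
    unfolding img N_def by (simp add: algebra_simps)
  show "coeff_rate q r + upper_rate q r - lower_rate q r + denom_rate q + 4 \<ge> 0" using B le by linarith
qed

text \<open>The logarithms from Stirling's formula cancel against those of \<open>20 * r\<close> up
  to \<open>18 * q * (ln 20 - ln 18)\<close>, which has a favourable sign and is dropped. The main
  term is \<open>- 38 * q * ln r\<close>.\<close>

lemma exponent_upper:
  "denom_rate q + upper_rate q r + 2 \<le> 40 * real q + 22 + 40 * real r - (38 * real q + 20 - 40 * real r) * (1 + ln (real r))"
proof -
  have "upper_rate q r = 20 * real r * ln 3 - 18 * real q * (ln 20 - ln 18) - (38 * real q + 20 - 40 * real r) * (1 + ln (real r))"
    unfolding upper_rate_def[OF r rq] amplitude_rate_def[OF r rq] degree_rate_def[OF r rq] by (simp add: algebra_simps)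
  moreover have "18 * real q * (ln 20 - ln 18) \<ge> 0" by (intro mult_nonneg_nonneg) auto
  moreover have "20 * real r * ln 3 \<le> 20 * real r * 2"
    using ln_le_minus_one[of "3::real"] by (intro mult_left_mono) auto
  ultimately show ?thesis using denom_rate_bounds(2) by linarith
qed

text \<open>The bracket collects terms of order \<open>r * ln r\<close> and \<open>q / r\<close>,
  from the numerator and from the gap between \<open>ln (r + 2)\<close> and \<open>ln r\<close>;
  they are negligible against \<open>q\<close> for the later choice of \<open>r\<close>.\<close>

lemma exponent_gap:
  "coeff_rate q r + upper_rate q r - lower_rate q r + denom_rate q + 4 \<le> 4634 / 125 * real q + 38 * ln 2 * real q +
     (40 * real r * (ln (real r + 2) + 1) + 40 * real r + 20 * real r * ln (real r) + (38 * real q + 20) * (2 / real r) + 44)"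
proof -
  have "upper_rate q r - lower_rate q r = 20 * real r * ln 3 + 20 * real r * ln (real r) + (38 * real q + 20) * (ln (real r + 2) - ln (real r))"
    unfolding upper_rate_def[OF r rq] lower_rate_def[OF r rq] degree_rate_def[OF r rq] by (simp add: algebra_simps)
  moreover have "20 * real r * ln 3 \<le> 20 * real r * 2"
    using ln_le_minus_one[of "3::real"] by (intro mult_left_mono) auto
  moreover have "(38 * real q + 20) * (ln (real r + 2) - ln (real r)) \<le> (38 * real q + 20) * (2 / real r)"
    using ln_diff_le[of "real r + 2" "real r"] r by (intro mult_left_mono) auto
  moreover have "20 * ln 2 \<le> (20::real)" using ln_le_minus_one[of "2::real"] by simp
  moreover have "coeff_rate q r = 40 * real r * (ln (real r + 2) + 1) + 38 * ln 2 * real q + 20 * ln 2"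
    unfolding coeff_rate_def[OF r rq] degree_rate_def[OF r rq] by (simp add: algebra_simps)
  ultimately show ?thesis using denom_rate_bounds(2) by linarith
qed

end

text \<open>Here 37.082 is 37.072 plus 0.01 for the negligible terms, 1.0001 absorbs the step from
  \<open>ln q\<close> to \<open>ln (2 * q + 2)\<close>, and 1.0091009 is 1.009 times 1.0001. The
  inequality between coefficients is affine in \<open>L\<close> and holds at both ends of
  \<open>[0, 1]\<close>.\<close>

lemma final_numeric:
  fixes L y N K :: real
  assumes "0 \<le> L" "L \<le> 1" "y \<ge> 0" "N \<ge> 0" "37.9 * y \<le> (N - 1) * (37.082 + 38 * L)"
  shows "1.009 / (1 + L) * (1.0001 * y) \<le> N"
proof -
  have "1.0091009 * (37.082 + 38 * L) * y \<le> 37.9 * (1 + L) * y" using assms by (intro mult_right_mono) auto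
  also have "\<dots> \<le> (1 + L) * ((N - 1) * (37.082 + 38 * L))" using assms(1) mult_left_mono[OF assms(5), of "1 + L"] by (simp only: mult_ac)
  also have "\<dots> = (37.082 + 38 * L) * ((1 + L) * (N - 1))" by simp
  finally have "(37.082 + 38 * L) * (1.0091009 * y) \<le> (37.082 + 38 * L) * ((1 + L) * (N - 1))" by (simp only: mult_ac)
  hence "1.0091009 * y \<le> (1 + L) * (N - 1)" using assms(1) by (subst (asm) mult_le_cancel_left_pos) auto
  also have "\<dots> \<le> (1 + L) * N" using assms by (intro mult_left_mono) auto
  finally show ?thesis using assms(1) by (simp add: field_simps)
qed

lemma dim_lower_ev:
  "eventually (\<lambda>q::nat. 1.009 / (1 + ln 2) * ln (2 * real q + 2) \<le>
     real (rat_vec.dim (insert 1 {zeta i | i. odd i \<and> 3 \<le> i \<and> i \<le> 2 * q + 1}))) sequentially"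
proof -
  \<comment> \<open>The exponent must be below 1, so that \<open>x * ln x\<close> is negligible
    against \<open>q\<close>, and above 37.9/38, so that \<open>38 * ln x\<close> exceeds
    \<open>37.9 * ln q\<close>.\<close>
  define x where "x = (\<lambda>q::nat. real q powr 0.999)"
  have "eventually (\<lambda>q. x q \<ge> 2) sequentially" unfolding x_def by real_asymp
  moreover have "eventually (\<lambda>q::nat. 2 * x q \<le> real q) sequentially" unfolding x_def by real_asymp
  \<comment> \<open>The leading coefficient is 38 * 0.999 = 37.962; lowering it to 37.9 absorbs all
    terms linear in \<open>q\<close>.\<close>
  moreover have "eventually (\<lambda>q::nat. 40 * real q + 22 + 40 * x q - (38 * real q + 20 - 40 * x q) * (1 + ln (x q / 2)) \<le> - (37.9 * ln (real q)) * real q) sequentially"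
    unfolding x_def by real_asymp
  moreover have "eventually (\<lambda>q::nat. 40 * x q * (ln (x q + 2) + 1) + 40 * x q + 20 * x q * ln (x q) + (38 * real q + 20) * (4 / x q) + 44 \<le> 0.01 * real q) sequentially"
    unfolding x_def by real_asymp
  moreover have "eventually (\<lambda>q::nat. ln (2 * real q + 2) \<le> 1.0001 * ln (real q)) sequentially" by real_asymp
  moreover have "eventually (\<lambda>q::nat. q \<ge> 2) sequentially" by (rule eventually_ge_at_top)
  ultimately show ?thesis
  proof eventually_elim
    case (elim q)
    define r where "r = nat \<lfloor>x q\<rfloor>"
    have "real r = of_int \<lfloor>x q\<rfloor>" unfolding r_def using elim(1) by simp
    hence rx: "real r \<le> x q" "x q / 2 \<le> real r" using half_floor[of "x q"] elim(1) by auto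
    have r: "r > 0" using rx elim(1) by (intro Nat.gr0I) auto
    have "real (2 * r) \<le> real q" using rx elim(2) by simp
    hence rq: "2 * r \<le> q" by (simp only: of_nat_le_iff)
    have lnq: "ln (real q) > 0" using elim(6) by simp
    define N where "N = real (rat_vec.dim (insert 1 {zeta i | i. odd i \<and> 3 \<le> i \<and> i \<le> 2 * q + 1}))"
    define Q where "Q = coeff_rate q r + upper_rate q r - lower_rate q r + denom_rate q + 4"
    have "(38 * real q + 20 - 40 * x q) * (1 + ln (x q / 2)) \<le> (38 * real q + 20 - 40 * real r) * (1 + ln (real r))"
      using rx elim(1,2) by (intro mult_mono add_left_mono) auto
    hence up: "denom_rate q + upper_rate q r + 2 \<le> - (37.9 * ln (real q)) * real q"
      using exponent_upper[OF r rq] elim(3) rx by linarith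
    also have "\<dots> < 0" using lnq elim(6) by (simp add: mult_neg_pos)
    finally have neg: "denom_rate q + upper_rate q r + 2 < 0" .
    note D = dim_lower[OF r rq neg, folded N_def Q_def]
    have "N \<ge> 1"
    proof (rule ccontr)
      assume "\<not> N \<ge> 1"
      hence "(N - 1) * Q \<le> 0" using D(2) by (intro mult_nonpos_nonneg) auto
      thus False using D(1) neg by linarith
    qed
    have "Q \<le> 4634 / 125 * real q + 38 * ln 2 * real q + 0.01 * real q"
    proof -
      have "40 * real r * (ln (real r + 2) + 1) \<le> 40 * x q * (ln (x q + 2) + 1)"
        using rx by (intro mult_mono) auto
      moreover have "20 * real r * ln (real r) \<le> 20 * x q * ln (x q)"
        using rx r by (intro mult_mono) auto
      moreover have "(38 * real q + 20) * (2 / real r) \<le> (38 * real q + 20) * (4 / x q)"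
        using rx r elim(1) by (intro mult_left_mono) (auto simp: field_simps)
      ultimately show ?thesis using exponent_gap[OF r rq] elim(4) rx unfolding Q_def by linarith
    qed
    also have "\<dots> = (37.082 + 38 * ln 2) * real q" by (simp add: algebra_simps)
    finally have "(N - 1) * Q \<le> (N - 1) * ((37.082 + 38 * ln 2) * real q)" using \<open>N \<ge> 1\<close> by (intro mult_left_mono) auto
    hence "37.9 * ln (real q) * real q \<le> (N - 1) * (37.082 + 38 * ln 2) * real q" using D(1) up by (simp only: mult.assoc)
    hence "37.9 * ln (real q) \<le> (N - 1) * (37.082 + 38 * ln 2)" using elim(6) by (subst (asm) mult_le_cancel_right_pos) auto
    hence "1.009 / (1 + ln 2) * (1.0001 * ln (real q)) \<le> N"
      using lnq \<open>N \<ge> 1\<close> ln_le_minus_one[of "2::real"] by (intro final_numeric) auto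
    moreover have "1.009 / (1 + ln 2) * ln (2 * real q + 2) \<le> 1.009 / (1 + ln 2) * (1.0001 * ln (real q))"
      using elim(5) by (intro mult_left_mono) auto
    ultimately show ?case unfolding N_def by linarith
  qed
qed

theorem theorem1:
  "\<exists>s0::nat. \<forall>s::nat. even s \<and> s \<ge> s0 \<longrightarrow>
     real (rat_vec.dim (rat_vec.span (insert 1 {zeta i | i. odd i \<and> 3 \<le> i \<and> i \<le> s - 1})))
       \<ge> 1.009 / (1 + ln 2) * ln (real s)"
proof -
  obtain q0 where q0: "1.009 / (1 + ln 2) * ln (2 * real q + 2) \<le>
     real (rat_vec.dim (insert 1 {zeta i | i. odd i \<and> 3 \<le> i \<and> i \<le> 2 * q + 1}))" if "q \<ge> q0" for q
    using dim_lower_ev unfolding eventually_sequentially by auto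
  show ?thesis
  proof (intro exI[of _ "2 * q0 + 2"] allI impI)
    fix s :: nat assume s: "even s \<and> s \<ge> 2 * q0 + 2"
    define q where "q = s div 2 - 1"
    have q: "s = 2 * q + 2" "q \<ge> q0" using s by (auto simp: q_def elim!: evenE)
    show "real (rat_vec.dim (rat_vec.span (insert 1 {zeta i | i. odd i \<and> 3 \<le> i \<and> i \<le> s - 1})))
       \<ge> 1.009 / (1 + ln 2) * ln (real s)"
      using q0[OF q(2)] unfolding rat_vec.dim_span q(1) by (simp add: add.commute)
  qed
qed

end
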